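(* Let $N\ge1$, $0<s<1$, let $\Omega\subset\mathbb{R}^N$ be a bounded domain with Lipschitz continuous boundary, let $\kappa\in L^1(\mathbb{R}^N\setminus\Omega)\cap L^\infty(\mathbb{R}^N\setminus\Omega)$ with $\kappa>0$ a.e. in $\mathbb{R}^N\setminus\Omega$, $d\mu=\kappa\,dx$, $Z_R:=L^2(\mathbb{R}^N\setminus\Omega,\mu)$, and $\xi\ge0$. Let $Z_{ad,R}$ be a closed and convex subset of $Z_R$. Let either $\xi>0$ or $Z_{ad,R}\subset Z_R$ be bounded. Moreover, let $J:L^2(\Omega)\to\mathbb{R}$ be weakly lower-semicontinuous. Then there exists a solution $\bar z$ to the reduced fractional Robin exterior control problem $$\min_{z\in Z_{ad,R}}\mathcal{J}(z):=J(Sz)+\frac\xi2\|z\|^2_{L^2(\mathbb{R}^N\setminus\Omega,\mu)},$$ and equivalently to the problem of minimizing $J(u)+\frac\xi2\|z\|^2_{Z_R}$ over $(u,z)\in W^{s,2}_{\Omega,\kappa}\times Z_{ad,R}$ such that $u$ is the weak solution of $(-\Delta)^su=0$ in $\Omega$, $\mathcal{N}_su+\kappa u=\kappa z$ in $\mathbb{R}^N\setminus\Omega$. If either $J$ is convex and $\xi>0$, or $J$ is strictly convex and $\xi\ge0$, then $\bar z$ is unique.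
   Context: $C_{N,s}:=\frac{s2^{2s}\Gamma\left(\frac{2s+N}{2}\right)}{\pi^{N/2}\Gamma(1-s)}$; $(-\Delta)^su(x)=C_{N,s}\,\mathrm{P.V.}\int_{\mathbb{R}^N}\frac{u(x)-u(y)}{|x-y|^{N+2s}}dy$; $\mathcal{N}_su(x)=C_{N,s}\int_\Omega\frac{u(x)-u(y)}{|x-y|^{N+2s}}dy$ for $x\in\mathbb{R}^N\setminus\overline\Omega$. $\mathbb{R}^{2N}\setminus(\mathbb{R}^N\setminus\Omega)^2:=(\Omega\times\Omega)\cup(\Omega\times(\mathbb{R}^N\setminus\Omega))\cup((\mathbb{R}^N\setminus\Omega)\times\Omega)$. $W^{s,2}_{\Omega,\kappa}$ is the Hilbert space of measurable $u:\mathbb{R}^N\to\mathbb{R}$ with finite norm $$\|u\|_{W^{s,2}_{\Omega,\kappa}}=\left(\|u\|^2_{L^2(\Omega)}+\|u\|^2_{L^2(\mathbb{R}^N\setminus\Omega,\mu)}+\iint_{\mathbb{R}^{2N}\setminus(\mathbb{R}^N\setminus\Omega)^2}\frac{|u(x)-u(y)|^2}{|x-y|^{N+2s}}dxdy\right)^{1/2}.$$ For $z\in Z_R$, the weak solution of $(-\Delta)^su=0$ in $\Omega$, $\mathcal{N}_su+\kappa u=\kappa z$ in $\mathbb{R}^N\setminus\Omega$ is $u\in W^{s,2}_{\Omega,\kappa}$ such that for every $v\in W^{s,2}_{\Omega,\kappa}$ $$\frac{C_{N,s}}{2}\iint_{\mathbb{R}^{2N}\setminus(\mathbb{R}^N\setminus\Omega)^2}\frac{(u(x)-u(y))(v(x)-v(y))}{|x-y|^{N+2s}}dxdy+\int_{\mathbb{R}^N\setminus\Omega}uv\,d\mu=\int_{\mathbb{R}^N\setminus\Omega}zv\,d\mu.$$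 The control-to-state map $S:Z_R\to W^{s,2}_{\Omega,\kappa}\hookrightarrow L^2(\Omega)$, $z\mapsto u$, is well-defined, linear and continuous (established in the paper beforehand), and is regarded as a map into $L^2(\Omega)$.
   Formalization: The admissible set is assumed nonempty, and when it is unbounded J is additionally assumed convex or bounded below; otherwise existence can fail, e.g. J(u) = −(∫_Ω u)^4 with all of Z_R admissible. *)

theory Defs
  imports "HOL-Analysis.Analysis"
begin

subsection \<open>Square-integrable functions\<close>

text \<open>
  Elements of \<open>L\<^sup>2(M)\<close> are represented by functions, and equality in \<open>L\<^sup>2(M)\<close> is equality
  almost everywhere. A functional on \<open>L\<^sup>2(M)\<close> is a functional on representatives, of which only
  the values on \<open>L2 M\<close> matter. Independence of the representative is a consequence of weak lower
  semicontinuity: if \<open>u = v\<close> a.e., then the constant sequence \<open>u\<close> converges weakly to \<open>v\<close> and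
  vice versa. Likewise every \<open>L2_closed\<close> set is saturated with respect to a.e. equality.
\<close>

definition L2 :: "'a measure \<Rightarrow> ('a \<Rightarrow> real) set" where
  "L2 M = {f \<in> borel_measurable M. integrable M (\<lambda>x. (f x)\<^sup>2)}"

definition L2_norm :: "'a measure \<Rightarrow> ('a \<Rightarrow> real) \<Rightarrow> real" where
  "L2_norm M f = sqrt (\<integral>x. (f x)\<^sup>2 \<partial>M)"

definition L2_closed :: "'a measure \<Rightarrow> ('a \<Rightarrow> real) set \<Rightarrow> bool" where
  "L2_closed M Z \<longleftrightarrow>
     (\<forall>f g. (\<forall>n::nat. f n \<in> Z) \<and> g \<in> L2 M \<and> (\<lambda>n. L2_norm M (\<lambda>x. f n x - g x)) \<longlonglongrightarrow> 0
        \<longrightarrow> g \<in> Z)"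

definition L2_bounded :: "'a measure \<Rightarrow> ('a \<Rightarrow> real) set \<Rightarrow> bool" where
  "L2_bounded M Z \<longleftrightarrow> (\<exists>B. \<forall>f\<in>Z. L2_norm M f \<le> B)"

definition convex_fun_set :: "('a \<Rightarrow> real) set \<Rightarrow> bool" where
  "convex_fun_set Z \<longleftrightarrow>
     (\<forall>f\<in>Z. \<forall>g\<in>Z. \<forall>t. 0 \<le> t \<and> t \<le> 1 \<longrightarrow> (\<lambda>x. (1 - t) * f x + t * g x) \<in> Z)"

definition L2_weak_tendsto :: "'a measure \<Rightarrow> (nat \<Rightarrow> 'a \<Rightarrow> real) \<Rightarrow> ('a \<Rightarrow> real) \<Rightarrow> bool" where
  "L2_weak_tendsto M f g \<longleftrightarrow>
     (\<forall>\<phi>\<in>L2 M. (\<lambda>n. \<integral>x. f n x * \<phi> x \<partial>M) \<longlonglongrightarrow> (\<integral>x. g x * \<phi> x \<partial>M))"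

text \<open>
  Lower semicontinuity along weakly convergent sequences; it is implied by lower semicontinuity
  with respect to the weak topology.
\<close>

definition L2_weakly_lsc :: "'a measure \<Rightarrow> (('a \<Rightarrow> real) \<Rightarrow> real) \<Rightarrow> bool" where
  "L2_weakly_lsc M J \<longleftrightarrow>
     (\<forall>f g. (\<forall>n. f n \<in> L2 M) \<and> g \<in> L2 M \<and> L2_weak_tendsto M f g
        \<longrightarrow> ereal (J g) \<le> liminf (\<lambda>n. ereal (J (f n))))"

definition L2_convex :: "'a measure \<Rightarrow> (('a \<Rightarrow> real) \<Rightarrow> real) \<Rightarrow> bool" where
  "L2_convex M J \<longleftrightarrow>
     (\<forall>f\<in>L2 M. \<forall>g\<in>L2 M. \<forall>t. 0 \<le> t \<and> t \<le> 1
        \<longrightarrow> J (\<lambda>x. (1 - t) * f x + t * g x) \<le> (1 - t) * J f + t * J g)"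

definition L2_strictly_convex :: "'a measure \<Rightarrow> (('a \<Rightarrow> real) \<Rightarrow> real) \<Rightarrow> bool" where
  "L2_strictly_convex M J \<longleftrightarrow>
     (\<forall>f\<in>L2 M. \<forall>g\<in>L2 M. \<forall>t. \<not> (AE x in M. f x = g x) \<and> 0 < t \<and> t < 1
        \<longrightarrow> J (\<lambda>x. (1 - t) * f x + t * g x) < (1 - t) * J f + t * J g)"


subsection \<open>Bounded Lipschitz domains\<close>

text \<open>
  Near each boundary point, \<open>\<Omega>\<close> is the strict epigraph, in some direction \<open>e\<close>, of a Lipschitz
  function \<open>\<gamma>\<close> on the hyperplane orthogonal to \<open>e\<close>. Since \<open>U\<close> is open, this forces the boundary
  inside \<open>U\<close> to be the graph of \<open>\<gamma>\<close>.
\<close>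

definition lipschitz_boundary :: "(real ^ 'n) set \<Rightarrow> bool" where
  "lipschitz_boundary \<Omega> \<longleftrightarrow>
     (\<forall>p\<in>frontier \<Omega>. \<exists>U e \<gamma> L. open U \<and> p \<in> U \<and> norm e = 1 \<and>
        L-lipschitz_on {y. y \<bullet> e = 0} \<gamma> \<and>
        \<Omega> \<inter> U = {x \<in> U. \<gamma> (x - (x \<bullet> e) *\<^sub>R e) < x \<bullet> e})"

definition bounded_lipschitz_domain :: "(real ^ 'n) set \<Rightarrow> bool" where
  "bounded_lipschitz_domain \<Omega> \<longleftrightarrow>
     open \<Omega> \<and> connected \<Omega> \<and> \<Omega> \<noteq> {} \<and> bounded \<Omega> \<and> lipschitz_boundary \<Omega>"


subsection \<open>The fractional Robin problem\<close>

definition frac_const :: "nat \<Rightarrow> real \<Rightarrow> real" where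
  "frac_const N s =
     s * 2 powr (2 * s) * Gamma ((2 * s + real N) / 2) / (pi powr (real N / 2) * Gamma (1 - s))"

definition robin_measure :: "(real ^ 'n) set \<Rightarrow> (real ^ 'n \<Rightarrow> real) \<Rightarrow> (real ^ 'n) measure" where
  "robin_measure \<Omega> \<kappa> = density (lebesgue_on (- \<Omega>)) (\<lambda>x. ennreal (\<kappa> x))"

definition cross_region :: "(real ^ 'n) set \<Rightarrow> ((real ^ 'n) \<times> (real ^ 'n)) set" where
  "cross_region \<Omega> = (\<Omega> \<times> \<Omega>) \<union> (\<Omega> \<times> (- \<Omega>)) \<union> ((- \<Omega>) \<times> \<Omega>)"

text \<open>
  On the diagonal the kernels below have the value \<open>0\<close>, by the convention for division by zero;
  the diagonal is a null set.
\<close>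

definition robin_sobolev_norm_sq ::
  "(real ^ 'n) set \<Rightarrow> (real ^ 'n \<Rightarrow> real) \<Rightarrow> real \<Rightarrow> (real ^ 'n \<Rightarrow> real) \<Rightarrow> ennreal" where
  "robin_sobolev_norm_sq \<Omega> \<kappa> s u =
     (\<integral>\<^sup>+x. ennreal ((u x)\<^sup>2) \<partial>lebesgue_on \<Omega>)
     + (\<integral>\<^sup>+x. ennreal ((u x)\<^sup>2) \<partial>robin_measure \<Omega> \<kappa>)
     + (\<integral>\<^sup>+(x, y)\<in>cross_region \<Omega>.
          ennreal (\<bar>u x - u y\<bar>\<^sup>2 / norm (x - y) powr (real CARD('n) + 2 * s))
          \<partial>(lebesgue \<Otimes>\<^sub>M lebesgue))"

definition robin_sobolev ::
  "(real ^ 'n) set \<Rightarrow> (real ^ 'n \<Rightarrow> real) \<Rightarrow> real \<Rightarrow> (real ^ 'n \<Rightarrow> real) set" where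
  "robin_sobolev \<Omega> \<kappa> s =
     {u \<in> borel_measurable lebesgue. robin_sobolev_norm_sq \<Omega> \<kappa> s u < \<infinity>}"

definition frac_form ::
  "(real ^ 'n) set \<Rightarrow> real \<Rightarrow> (real ^ 'n \<Rightarrow> real) \<Rightarrow> (real ^ 'n \<Rightarrow> real) \<Rightarrow> real" where
  "frac_form \<Omega> s u v =
     frac_const CARD('n) s / 2 *
     (LINT (x, y):cross_region \<Omega>|lebesgue \<Otimes>\<^sub>M lebesgue.
        (u x - u y) * (v x - v y) / norm (x - y) powr (real CARD('n) + 2 * s))"

definition robin_weak_solution ::
  "(real ^ 'n) set \<Rightarrow> (real ^ 'n \<Rightarrow> real) \<Rightarrow> real \<Rightarrow> (real ^ 'n \<Rightarrow> real) \<Rightarrow> (real ^ 'n \<Rightarrow> real) \<Rightarrow> bool" where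
  "robin_weak_solution \<Omega> \<kappa> s z u \<longleftrightarrow>
     u \<in> robin_sobolev \<Omega> \<kappa> s \<and>
     (\<forall>v \<in> robin_sobolev \<Omega> \<kappa> s.
        frac_form \<Omega> s u v + (\<integral>x. u x * v x \<partial>robin_measure \<Omega> \<kappa>)
          = (\<integral>x. z x * v x \<partial>robin_measure \<Omega> \<kappa>))"

text \<open>
  The weak solution is unique only up to equality a.e., so the control-to-state map selects a
  representative.
\<close>

definition robin_state ::
  "(real ^ 'n) set \<Rightarrow> (real ^ 'n \<Rightarrow> real) \<Rightarrow> real \<Rightarrow> (real ^ 'n \<Rightarrow> real) \<Rightarrow> (real ^ 'n \<Rightarrow> real)" where
  "robin_state \<Omega> \<kappa> s z = (SOME u. robin_weak_solution \<Omega> \<kappa> s z u)"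


subsection \<open>The optimal control problem\<close>

definition robin_cost ::
  "(real ^ 'n) set \<Rightarrow> (real ^ 'n \<Rightarrow> real) \<Rightarrow> ((real ^ 'n \<Rightarrow> real) \<Rightarrow> real) \<Rightarrow> real \<Rightarrow>
   (real ^ 'n \<Rightarrow> real) \<Rightarrow> (real ^ 'n \<Rightarrow> real) \<Rightarrow> real" where
  "robin_cost \<Omega> \<kappa> J \<xi> u z = J u + \<xi> / 2 * (L2_norm (robin_measure \<Omega> \<kappa>) z)\<^sup>2"

definition reduced_solution ::
  "(real ^ 'n) set \<Rightarrow> (real ^ 'n \<Rightarrow> real) \<Rightarrow> real \<Rightarrow> ((real ^ 'n \<Rightarrow> real) \<Rightarrow> real) \<Rightarrow> real \<Rightarrow>
   (real ^ 'n \<Rightarrow> real) set \<Rightarrow> (real ^ 'n \<Rightarrow> real) \<Rightarrow> bool" where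
  "reduced_solution \<Omega> \<kappa> s J \<xi> Zad z \<longleftrightarrow>
     is_arg_min (\<lambda>w. robin_cost \<Omega> \<kappa> J \<xi> (robin_state \<Omega> \<kappa> s w) w) (\<lambda>w. w \<in> Zad) z"

definition full_solution ::
  "(real ^ 'n) set \<Rightarrow> (real ^ 'n \<Rightarrow> real) \<Rightarrow> real \<Rightarrow> ((real ^ 'n \<Rightarrow> real) \<Rightarrow> real) \<Rightarrow> real \<Rightarrow>
   (real ^ 'n \<Rightarrow> real) set \<Rightarrow> (real ^ 'n \<Rightarrow> real) \<Rightarrow> (real ^ 'n \<Rightarrow> real) \<Rightarrow> bool" where
  "full_solution \<Omega> \<kappa> s J \<xi> Zad u z \<longleftrightarrow>
     is_arg_min (\<lambda>(u, z). robin_cost \<Omega> \<kappa> J \<xi> u z)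
       (\<lambda>(u, z). u \<in> robin_sobolev \<Omega> \<kappa> s \<and> z \<in> Zad \<and> robin_weak_solution \<Omega> \<kappa> s z u) (u, z)"

end

theory Submission
  imports Defs "HOL-Library.Diagonal_Subsequence"
begin

text \<open>
  Existence is the direct method. A minimizing sequence of controls is bounded in
  \<open>L\<^sup>2(\<mu>)\<close>, so a subsequence converges weakly; its limit is admissible because a closed convex
  set is weakly closed, the squared norm and the reduced cost \<open>z \<mapsto> J (S z)\<close> are weakly lower
  semicontinuous, and the limit is a minimizer (\<open>minimizer_exists\<close>). If \<open>\<xi> > 0\<close> and the admissible
  set is unbounded, boundedness of the sequence comes from the penalty: it grows quadratically, while
  a convex lower semicontinuous functional decreases at most linearly
  (\<open>convex_lsc_lower_bound\<close>).

  That \<open>J \<circ> S\<close> inherits weak lower semicontinuity rests on the weak continuity of \<open>S\<close>. The form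
  of the Robin problem is symmetric, and it is an inner product that controls the full norm of
  \<open>W\<close> by an elementary inequality of Poincare type (\<open>Poincare_inequality\<close>). The Riesz representation
  theorem thus solves the state equation for every control. It also yields, for every
  \<open>\<phi>\<close> in \<open>L\<^sup>2(\<Omega>)\<close>, an adjoint state \<open>w\<close> with \<open>\<integral>\<^sub>\<Omega> (S z) \<phi> = \<integral> z w d\<mu>\<close>, which turns weak
  convergence of controls into weak convergence of states.

  Uniqueness for convex \<open>J\<close> and \<open>\<xi> > 0\<close> is strict convexity of the squared norm. For strictly
  convex \<open>J\<close> and \<open>\<xi> = 0\<close> two minimizers only have the same state in \<open>\<Omega>\<close>, and one needs that \<open>S\<close> is
  injective. This is unique continuation: if a state \<open>w\<close> vanishes in \<open>\<Omega>\<close>, then its equation says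
  that the potential of \<open>w\<close> restricted to the complement, with kernel \<open>|x - y|\<close> to the power
  \<open>-(N + 2 s)\<close>, vanishes in \<open>\<Omega>\<close>, and such a density must be zero
  (\<open>AE_eq_0_if_potential_eq_0\<close>). The proof goes as follows. The Laplacian of \<open>|x|\<close> to the power
  \<open>-b\<close> is a nonzero multiple of \<open>|x|\<close> to the power \<open>-b - 2\<close>, hence all potentials with exponents
  \<open>N + 2 s + 2 k\<close> vanish on a ball. By the Weierstrass theorem in the variable
  \<open>1 / |x - y|\<^sup>2\<close>, so do all integrals against Gaussians centred in that ball. Products of Gaussians
  are Gaussians, so the Stone--Weierstrass theorem, applied after an inversion that makes the
  complement of the ball relatively compact, shows that these are enough test functions. Once \<open>w = 0\<close>,
  the weak formulation reduces to \<open>\<integral> z v d\<mu> = 0\<close> for every \<open>v\<close>, in particular for every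
  bounded Lipschitz function, so \<open>z = 0\<close>.
\<close>

section \<open>Hilbert spaces of functions\<close>

text \<open>Besides the Cauchy--Schwarz inequality, this gives orthogonality relations from minimality, both
  exact (\<open>p = 0\<close>) and approximate (\<open>p\<close> small).\<close>

lemma quadratic_nonneg_discriminant:
  fixes p q r :: real
  assumes "\<And>t. 0 \<le> p + 2 * t * q + t\<^sup>2 * r" "0 \<le> r"
  shows "q\<^sup>2 \<le> p * r"
proof (cases "r = 0")
  case True
  have "q = 0"
  proof (rule ccontr)
    assume "q \<noteq> 0"
    then show False using assms(1)[of "(- p - 1) / (2 * q)"] True by (simp add: field_simps)
  qed
  then show ?thesis using True by simp
next
  case False
  have "0 \<le> p + 2 * (- q / r) * q + (- q / r)\<^sup>2 * r" by (rule assms)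
  also have "\<dots> = p - q\<^sup>2 / r" using False by (simp add: field_simps power2_eq_square)
  finally show ?thesis using False assms(2) by (simp add: field_simps)
qed

text \<open>The functions of the spaces below matter only up to equality almost everywhere. Working with
  representatives avoids quotients, at the price that the form is merely semidefinite and that limits
  are not unique.\<close>

locale semi_hilbert =
  fixes V :: "('a \<Rightarrow> real) set" and B :: "('a \<Rightarrow> real) \<Rightarrow> ('a \<Rightarrow> real) \<Rightarrow> real"
  assumes zero_mem: "(\<lambda>x. 0) \<in> V"
    and lincomb_mem: "f \<in> V \<Longrightarrow> g \<in> V \<Longrightarrow> (\<lambda>x. a * f x + b * g x) \<in> V"
    and sym: "f \<in> V \<Longrightarrow> g \<in> V \<Longrightarrow> B f g = B g f"
    and linear: "f \<in> V \<Longrightarrow> g \<in> V \<Longrightarrow> h \<in> V \<Longrightarrow> B (\<lambda>x. a * f x + b * g x) h = a * B f h + b * B g h"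
    and nonneg: "f \<in> V \<Longrightarrow> 0 \<le> B f f"
    and complete: "(\<And>n. F n \<in> V) \<Longrightarrow>
      (\<And>e. e > 0 \<Longrightarrow> \<exists>N. \<forall>m\<ge>N. \<forall>n\<ge>N. B (\<lambda>x. F m x - F n x) (\<lambda>x. F m x - F n x) < e) \<Longrightarrow>
      \<exists>f\<in>V. (\<lambda>n. B (\<lambda>x. F n x - f x) (\<lambda>x. F n x - f x)) \<longlonglongrightarrow> 0"
begin

lemma linear_right:
  assumes "f \<in> V" "g \<in> V" "h \<in> V"
  shows "B h (\<lambda>x. a * f x + b * g x) = a * B h f + b * B h g"
  using linear[OF assms] sym[OF lincomb_mem[OF assms(1,2)] assms(3)] sym[OF assms(1,3)] sym[OF assms(2,3)]
  by simp

lemma quadratic_expand: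
  assumes "f \<in> V" "g \<in> V"
  shows "B (\<lambda>x. a * f x + b * g x) (\<lambda>x. a * f x + b * g x) = a\<^sup>2 * B f f + 2 * a * b * B f g + b\<^sup>2 * B g g"
proof -
  have "B (\<lambda>x. a * f x + b * g x) (\<lambda>x. a * f x + b * g x)
      = a * (a * B f f + b * B f g) + b * (a * B g f + b * B g g)"
    using assms by (simp add: linear linear_right lincomb_mem)
  also have "B g f = B f g" using assms by (intro sym)
  finally show ?thesis by (simp add: algebra_simps power2_eq_square)
qed

lemma diff_mem: "f \<in> V \<Longrightarrow> g \<in> V \<Longrightarrow> (\<lambda>x. f x - g x) \<in> V"
  using lincomb_mem[of f g 1 "-1"] by simp

lemma diff_expand:
  assumes "f \<in> V" "g \<in> V"
  shows "B (\<lambda>x. f x - g x) (\<lambda>x. f x - g x) = B f f - 2 * B f g + B g g"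
  using quadratic_expand[OF assms, of 1 "-1"] by simp

lemma diff_left:
  assumes "f \<in> V" "g \<in> V" "h \<in> V"
  shows "B (\<lambda>x. f x - g x) h = B f h - B g h"
  using linear[OF assms, of 1 "-1"] by simp

lemma scale_mem: "f \<in> V \<Longrightarrow> (\<lambda>x. a * f x) \<in> V"
  using lincomb_mem[of f f a 0] by simp

lemma scale_left: "f \<in> V \<Longrightarrow> h \<in> V \<Longrightarrow> B (\<lambda>x. a * f x) h = a * B f h"
  using linear[of f f h a 0] by simp

lemma Cauchy_Schwarz:
  assumes "f \<in> V" "g \<in> V"
  shows "(B f g)\<^sup>2 \<le> B f f * B g g"
proof (rule quadratic_nonneg_discriminant)
  show "0 \<le> B f f + 2 * t * B f g + t\<^sup>2 * B g g" for t
    using quadratic_expand[OF assms, of 1 t] nonneg[OF lincomb_mem[OF assms, of 1 t]] by simp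
qed (use assms nonneg in auto)

lemma Cauchy_Schwarz_abs:
  assumes "f \<in> V" "g \<in> V"
  shows "\<bar>B f g\<bar> \<le> sqrt (B f f) * sqrt (B g g)"
  using real_sqrt_le_mono[OF Cauchy_Schwarz[OF assms]] by (simp add: real_sqrt_mult)

lemma tendsto_strong_imp_weak:
  assumes F: "\<And>n. F n \<in> V" and f: "f \<in> V" and h: "h \<in> V"
    and lim: "(\<lambda>n. B (\<lambda>x. F n x - f x) (\<lambda>x. F n x - f x)) \<longlonglongrightarrow> 0"
  shows "(\<lambda>n. B (F n) h) \<longlonglongrightarrow> B f h"
proof -
  have "(\<lambda>n. sqrt (B (\<lambda>x. F n x - f x) (\<lambda>x. F n x - f x)) * sqrt (B h h)) \<longlonglongrightarrow> 0"
    using tendsto_mult[OF tendsto_real_sqrt[OF lim] tendsto_const[of "sqrt (B h h)"]] by simp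
  moreover have "\<bar>B (F n) h - B f h\<bar> \<le> sqrt (B (\<lambda>x. F n x - f x) (\<lambda>x. F n x - f x)) * sqrt (B h h)" for n
    using Cauchy_Schwarz_abs[OF diff_mem[OF F f] h, of n] diff_left[OF F f h, of n] by simp
  then have "\<forall>\<^sub>F n in sequentially. norm (B (F n) h - B f h) \<le> sqrt (B (\<lambda>x. F n x - f x) (\<lambda>x. F n x - f x)) * sqrt (B h h)"
    unfolding real_norm_def by (intro always_eventually allI)
  ultimately have "(\<lambda>n. B (F n) h - B f h) \<longlonglongrightarrow> 0"
    by (rule Lim_null_comparison[rotated])
  then show ?thesis by (simp add: LIM_zero_iff)
qed

lemma tendsto_strong_imp_norm:
  assumes F: "\<And>n. F n \<in> V" and f: "f \<in> V"
    and lim: "(\<lambda>n. B (\<lambda>x. F n x - f x) (\<lambda>x. F n x - f x)) \<longlonglongrightarrow> 0"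
  shows "(\<lambda>n. B (F n) (F n)) \<longlonglongrightarrow> B f f"
proof -
  have "B (F n) (F n) = B (\<lambda>x. F n x - f x) (\<lambda>x. F n x - f x) + 2 * B (F n) f - B f f" for n
    using diff_expand[OF F f, of n] by simp
  then show ?thesis
    using tendsto_diff[OF tendsto_add[OF lim tendsto_mult[OF tendsto_const[of 2] tendsto_strong_imp_weak[OF F f f lim]]]
        tendsto_const[of "B f f"]] by simp
qed

text \<open>Midpoints are what the parallelogram identity speaks about.\<close>

definition midconvex :: "('a \<Rightarrow> real) set \<Rightarrow> bool" where
  "midconvex C \<longleftrightarrow> (\<forall>f\<in>C. \<forall>g\<in>C. (\<lambda>x. 1/2 * f x + 1/2 * g x) \<in> C)"

text \<open>Nearly shortest elements of a decreasing sequence of convex sets form a Cauchy sequence, by the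
  parallelogram identity. A constant sequence of sets yields the shortest element used for the Riesz
  representation. The convex hulls of the tails of a sequence yield its weak limit, together with
  convex combinations that approach it strongly.\<close>

lemma nested_convex_limit:
  assumes C: "\<And>k. C k \<subseteq> V" "\<And>k. midconvex (C k)" "\<And>j k. j \<le> k \<Longrightarrow> C k \<subseteq> C j"
    and bound: "\<And>k. \<exists>f\<in>C k. B f f \<le> M"
  obtains p f where "\<And>k. p k \<in> C k" "f \<in> V"
    "(\<lambda>n. B (\<lambda>x. p n x - f x) (\<lambda>x. p n x - f x)) \<longlonglongrightarrow> 0"
    "\<And>h. h \<in> (\<Inter>k. C k) \<Longrightarrow> B f f \<le> B h h"
proof -
  define d where "d k = Inf ((\<lambda>f. B f f) ` C k)" for k
  have bdd: "bdd_below ((\<lambda>f. B f f) ` C k)" for k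
    using C(1) nonneg by (intro bdd_belowI[of _ 0]) auto
  have ne: "C k \<noteq> {}" for k using bound[of k] by auto
  have d_le: "d k \<le> B f f" if "f \<in> C k" for f k
    unfolding d_def using that bdd by (intro cInf_lower) auto
  have d_le_M: "d k \<le> M" for k using bound[of k] d_le[of _ k] by force
  have d_mono: "d j \<le> d k" if "j \<le> k" for j k
    unfolding d_def using ne C(3)[OF that] bdd by (intro cInf_superset_mono) auto
  have "\<exists>f\<in>C k. B f f < d k + 1 / real (Suc k)" for k
  proof -
    have "Inf ((\<lambda>f. B f f) ` C k) < d k + 1 / real (Suc k)" by (simp add: d_def)
    then show ?thesis using cInf_lessD[of "(\<lambda>f. B f f) ` C k"] ne by auto
  qed
  then obtain p where p: "\<And>k. p k \<in> C k" "\<And>k. B (p k) (p k) < d k + 1 / real (Suc k)"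
    by metis
  have pV: "p k \<in> V" for k using p(1) C(1) by auto
  obtain D where D: "d \<longlonglongrightarrow> D" and D_ge: "\<And>k. d k \<le> D"
  proof -
    have "incseq d" using d_mono by (auto simp: incseq_def)
    moreover have "bdd_above (range d)" using d_le_M by (intro bdd_aboveI[of _ M]) auto
    ultimately show ?thesis
      using that LIMSEQ_incseq_SUP[of d] cSUP_upper[of _ UNIV d] by blast
  qed
  \<comment> \<open>The parallelogram identity: the midpoint of two points of \<open>C j\<close> cannot be shorter than \<open>d j\<close>.\<close>
  have par: "B (\<lambda>x. p j x - p k x) (\<lambda>x. p j x - p k x) \<le> 4 * (D - d j) + 4 / real (Suc j)" if "j \<le> k" for j k
  proof -
    have "p k \<in> C j" using p(1) C(3)[OF that] by auto
    then have "(\<lambda>x. 1/2 * p j x + 1/2 * p k x) \<in> C j"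
      using C(2)[of j] p(1) by (auto simp: midconvex_def)
    from d_le[OF this] have "d j \<le> (1/2)\<^sup>2 * B (p j) (p j) + 2 * (1/2) * (1/2) * B (p j) (p k) + (1/2)\<^sup>2 * B (p k) (p k)"
      by (simp only: quadratic_expand[OF pV[of j] pV[of k], of "1/2" "1/2"])
    then have "4 * d j \<le> B (p j) (p j) + 2 * B (p j) (p k) + B (p k) (p k)"
      by (simp add: power2_eq_square)
    moreover have "1 / real (Suc k) \<le> 1 / real (Suc j)" using that by (simp add: frac_le)
    ultimately show ?thesis
      using p(2)[of j] p(2)[of k] D_ge[of k] D_ge[of j] by (simp add: diff_expand pV)
  qed
  have "(\<lambda>j. 4 * (D - d j) + 4 * (1 / real (Suc j))) \<longlonglongrightarrow> 4 * (D - D) + 4 * 0"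
    by (intro tendsto_intros D LIMSEQ_Suc[OF lim_1_over_n])
  then have small: "(\<lambda>j. 4 * (D - d j) + 4 / real (Suc j)) \<longlonglongrightarrow> 0" by simp
  have "\<exists>f\<in>V. (\<lambda>n. B (\<lambda>x. p n x - f x) (\<lambda>x. p n x - f x)) \<longlonglongrightarrow> 0"
  proof (rule complete)
    fix e :: real assume "e > 0"
    with small have "\<forall>\<^sub>F j in sequentially. 4 * (D - d j) + 4 / real (Suc j) < e"
      by (intro order_tendstoD) auto
    then obtain N where N: "\<And>j. j \<ge> N \<Longrightarrow> 4 * (D - d j) + 4 / real (Suc j) < e"
      by (auto simp: eventually_sequentially)
    have "B (\<lambda>x. p m x - p n x) (\<lambda>x. p m x - p n x) < e" if "m \<ge> N" "n \<ge> N" for m n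
    proof (cases "m \<le> n")
      case True
      then show ?thesis using par[of m n] N[of m] that by simp
    next
      case False
      then have "B (\<lambda>x. p n x - p m x) (\<lambda>x. p n x - p m x) < e"
        using par[of n m] N[of n] that by simp
      then show ?thesis by (simp add: diff_expand pV sym[OF pV pV, of n m])
    qed
    then show "\<exists>N. \<forall>m\<ge>N. \<forall>n\<ge>N. B (\<lambda>x. p m x - p n x) (\<lambda>x. p m x - p n x) < e" by blast
  qed (rule pV)
  then obtain f where f: "f \<in> V" "(\<lambda>n. B (\<lambda>x. p n x - f x) (\<lambda>x. p n x - f x)) \<longlonglongrightarrow> 0" by blast
  have "B f f \<le> B h h" if "h \<in> (\<Inter>k. C k)" for h
  proof -
    have "(\<lambda>k. B (p k) (p k)) \<longlonglongrightarrow> B f f" by (rule tendsto_strong_imp_norm[OF pV f])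
    moreover have "(\<lambda>k. B h h + 1 / real (Suc k)) \<longlonglongrightarrow> B h h + 0"
      by (intro tendsto_intros LIMSEQ_Suc[OF lim_1_over_n])
    moreover have "B (p k) (p k) \<le> B h h + 1 / real (Suc k)" for k
      using p(2)[of k] d_le[of h k] that by auto
    ultimately show ?thesis by (auto intro: LIMSEQ_le)
  qed
  with p(1) f show ?thesis by (rule that)
qed

text \<open>The shortest element of the hyperplane \<open>l = 1\<close> is orthogonal to the kernel of \<open>l\<close>, so a multiple
  of it represents \<open>l\<close>.\<close>

lemma Riesz_representation:
  assumes add: "\<And>f g a b. f \<in> V \<Longrightarrow> g \<in> V \<Longrightarrow> l (\<lambda>x. a * f x + b * g x) = a * l f + b * l g"
    and bound: "\<And>f. f \<in> V \<Longrightarrow> \<bar>l f\<bar> \<le> c * sqrt (B f f)"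
  shows "\<exists>u\<in>V. \<forall>f\<in>V. B u f = l f"
proof (cases "\<forall>f\<in>V. l f = 0")
  case True
  have "B (\<lambda>x. 0) f = 0" if "f \<in> V" for f using scale_left[OF that that, of 0] by simp
  then show ?thesis using True zero_mem by auto
next
  case False
  then obtain f0 where f0: "f0 \<in> V" "l f0 \<noteq> 0" by blast
  have scale: "l (\<lambda>x. a * f x) = a * l f" if "f \<in> V" for f a using add[OF that that, of a 0] by simp
  define C where "C = {f \<in> V. l f = 1}"
  have "(\<lambda>x. 1 / l f0 * f0 x) \<in> C" using f0 scale[OF f0(1), of "1 / l f0"] scale_mem[of f0 "1 / l f0"] by (simp add: C_def)
  then obtain M where "\<exists>f\<in>C. B f f \<le> M" by blast
  moreover have "midconvex C"
    unfolding midconvex_def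
  proof (intro ballI)
    fix f g assume "f \<in> C" "g \<in> C"
    then have f: "f \<in> V" "l f = 1" and g: "g \<in> V" "l g = 1" by (auto simp: C_def)
    show "(\<lambda>x. 1/2 * f x + 1/2 * g x) \<in> C"
      using add[OF f(1) g(1), of "1/2" "1/2"] lincomb_mem[OF f(1) g(1), of "1/2" "1/2"] f g by (simp add: C_def)
  qed
  ultimately obtain p u where p: "\<And>k::nat. p k \<in> C" and u: "u \<in> V"
    and pu: "(\<lambda>n. B (\<lambda>x. p n x - u x) (\<lambda>x. p n x - u x)) \<longlonglongrightarrow> 0"
    and min: "\<And>h. h \<in> C \<Longrightarrow> B u u \<le> B h h"
    using nested_convex_limit[of "\<lambda>k. C" M] by (auto simp: C_def)
  have pV: "p k \<in> V" for k using p by (auto simp: C_def)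
  have lu: "l u = 1"
  proof -
    have "(\<lambda>n. c * sqrt (B (\<lambda>x. p n x - u x) (\<lambda>x. p n x - u x))) \<longlonglongrightarrow> 0"
      using tendsto_mult[OF tendsto_const[of c] tendsto_real_sqrt[OF pu]] by simp
    moreover have "\<bar>1 - l u\<bar> \<le> c * sqrt (B (\<lambda>x. p n x - u x) (\<lambda>x. p n x - u x))" for n
      using bound[OF diff_mem[OF pV u], of n] add[OF pV u, of 1 n "-1"] p[of n] by (simp add: C_def)
    ultimately have "\<bar>1 - l u\<bar> \<le> 0" by (intro LIMSEQ_le_const) auto
    then show ?thesis by simp
  qed
  have pos: "B u u > 0"
  proof -
    have "B u u \<noteq> 0" using bound[OF u] lu by auto
    then show ?thesis using nonneg[OF u] by simp
  qed
  have orth: "B u h = 0" if h: "h \<in> V" "l h = 0" for h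
  proof -
    have "0 \<le> 0 + 2 * t * B u h + t\<^sup>2 * B h h" for t
    proof -
      have "(\<lambda>x. 1 * u x + t * h x) \<in> C" using u h lu add[OF u h(1), of 1 t] lincomb_mem[OF u h(1), of 1 t] by (simp add: C_def)
      from min[OF this] show ?thesis using quadratic_expand[OF u h(1), of 1 t] by simp
    qed
    then have "(B u h)\<^sup>2 \<le> 0 * B h h" using nonneg[OF h(1)] by (rule quadratic_nonneg_discriminant)
    then show ?thesis by simp
  qed
  have "B (\<lambda>x. 1 / B u u * u x) f = l f" if f: "f \<in> V" for f
  proof -
    have "B u (\<lambda>x. 1 * f x + (- l f) * u x) = 0"
      using f u lu add[OF f u, of 1 "- l f"] lincomb_mem[OF f u, of 1 "- l f"] by (intro orth) auto
    then have "B u f = l f * B u u" using linear_right[OF f u u, of 1 "- l f"] by simp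
    then show ?thesis using pos f u scale_left[OF u f, of "1 / B u u"] by simp
  qed
  then show ?thesis using scale_mem[OF u, of "1 / B u u"] by blast
qed

text \<open>A diagonal argument makes the inner products with each member of the sequence converge, hence those
  with each element of the span. The inner products with an arbitrary \<open>w\<close> follow, because \<open>w\<close> is an
  element of the span up to a residual that is nearly orthogonal to the span. The limit functional is
  represented by the point in which the convex hulls of the tails concentrate. That point is a strong
  limit of elements of \<open>Z\<close>, which is Mazur's lemma and will put it into \<open>Z\<close> if \<open>Z\<close> is closed.\<close>

lemma weakly_convergent_subsequence:
  assumes Z: "Z \<subseteq> V" "midconvex Z" and f: "\<And>n. f n \<in> Z" and bound: "\<And>n. B (f n) (f n) \<le> M"
  obtains r p g where "strict_mono (r :: nat \<Rightarrow> nat)" "g \<in> V"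
    "\<And>w. w \<in> V \<Longrightarrow> (\<lambda>n. B (f (r n)) w) \<longlonglongrightarrow> B g w"
    "\<And>k::nat. p k \<in> Z" "(\<lambda>k. B (\<lambda>x. p k x - g x) (\<lambda>x. p k x - g x)) \<longlonglongrightarrow> 0"
proof -
  have fV: "f n \<in> V" for n using f Z(1) by auto
  have M: "0 \<le> M" using nonneg[OF fV[of 0]] bound[of 0] by simp
  have "\<exists>r. strict_mono r \<and> (\<forall>m. convergent (\<lambda>n. B (f (r n)) (f m)))"
  proof -
    let ?P = "\<lambda>m s. convergent (\<lambda>n. B (f (s n)) (f m))"
    interpret subseqs ?P
    proof
      fix m :: nat and s :: "nat \<Rightarrow> nat" assume "strict_mono s"
      have "\<bar>B (f n) (f m)\<bar> \<le> sqrt M * sqrt M" for n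
      proof -
        have "\<bar>B (f n) (f m)\<bar> \<le> sqrt (B (f n) (f n)) * sqrt (B (f m) (f m))"
          by (rule Cauchy_Schwarz_abs[OF fV fV])
        also have "\<dots> \<le> sqrt M * sqrt M"
          using bound M nonneg[OF fV] by (intro mult_mono) auto
        finally show ?thesis .
      qed
      then have "bounded (range (\<lambda>n. B (f (s n)) (f m)))"
        by (auto intro!: boundedI)
      then obtain l r' where "strict_mono r'" "((\<lambda>n. B (f (s n)) (f m)) \<circ> r') \<longlonglongrightarrow> l"
        using bounded_imp_convergent_subsequence by blast
      then show "\<exists>r'. strict_mono r' \<and> convergent (\<lambda>n. B (f ((s \<circ> r') n)) (f m))"
        by (auto simp: o_def convergent_def)
    qed
    have "?P m diagseq" for m
    proof -
      have "?P m (diagseq \<circ> (+) (Suc m))"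
      proof (rule diagseq_holds)
        fix k s n assume "strict_mono (s :: nat \<Rightarrow> nat)" "?P n k"
        then show "?P n (k \<circ> s)"
          using convergent_subseq_convergent[of "\<lambda>i. B (f (k i)) (f n)" s] by (simp add: o_def)
      qed
      then show ?thesis
        using convergent_ignore_initial_segment[of "\<lambda>n. B (f (diagseq n)) (f m)" "Suc m"]
        by (simp add: o_def add.commute)
    qed
    then show ?thesis using subseq_diagseq by blast
  qed
  then obtain r where r: "strict_mono r" and conv_f: "\<And>m. convergent (\<lambda>n. B (f (r n)) (f m))"
    by blast
  define subspace where "subspace T \<longleftrightarrow> T \<subseteq> V \<and> (\<forall>g\<in>T. \<forall>h\<in>T. \<forall>a b. (\<lambda>x. a * g x + b * h x) \<in> T)" for T
  define S where "S = \<Inter>{T. subspace T \<and> range f \<subseteq> T}"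
  have "subspace V" by (auto simp: subspace_def lincomb_mem)
  then have S: "S \<subseteq> V" "range f \<subseteq> S" using fV by (auto simp: S_def)
  have S_lin: "(\<lambda>x. a * g x + b * h x) \<in> S" if "g \<in> S" "h \<in> S" for g h a b
    using that unfolding S_def subspace_def by blast
  have conv_S: "convergent (\<lambda>n. B (f (r n)) q)" if "q \<in> S" for q
  proof -
    have "subspace {q \<in> V. convergent (\<lambda>n. B (f (r n)) q)}"
      by (auto simp: subspace_def lincomb_mem linear_right fV intro!: convergent_add convergent_mult convergent_const)
    moreover have "range f \<subseteq> {q \<in> V. convergent (\<lambda>n. B (f (r n)) q)}" using fV conv_f by auto
    ultimately show ?thesis using that unfolding S_def by blast
  qed
  \<comment> \<open>A near-best approximation \<open>q\<close> of \<open>w\<close> from the span leaves a residual almost orthogonal to the span.\<close>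
  have approx: "\<exists>q\<in>S. \<forall>n. \<bar>B (f n) w - B (f n) q\<bar> \<le> e" if w: "w \<in> V" and e: "e > 0" for w e
  proof -
    define D where "D = (\<lambda>q. B (\<lambda>x. w x - q x) (\<lambda>x. w x - q x)) ` S"
    define \<delta> where "\<delta> = e\<^sup>2 / (M + 1)"
    have \<delta>: "\<delta> > 0" "\<delta> * M \<le> e\<^sup>2" using e M by (auto simp: \<delta>_def field_simps)
    have bdd: "bdd_below D" using S w nonneg diff_mem by (intro bdd_belowI[of _ 0]) (auto simp: D_def)
    have "D \<noteq> {}" using S by (auto simp: D_def)
    then obtain q where q: "q \<in> S" and qd: "B (\<lambda>x. w x - q x) (\<lambda>x. w x - q x) < Inf D + \<delta>"
      using cInf_lessD[of D "Inf D + \<delta>"] \<delta> by (auto simp: D_def)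
    have "\<bar>B (f n) w - B (f n) q\<bar> \<le> e" for n
    proof -
      have qV: "q \<in> V" using q S by auto
      note wq = diff_mem[OF w qV]
      have "0 \<le> \<delta> + 2 * t * B (\<lambda>x. w x - q x) (f n) + t\<^sup>2 * B (f n) (f n)" for t
      proof -
        have "(\<lambda>x. 1 * q x + (- t) * f n x) \<in> S" using q S by (intro S_lin) auto
        then have "Inf D \<le> B (\<lambda>x. w x - (1 * q x + (- t) * f n x)) (\<lambda>x. w x - (1 * q x + (- t) * f n x))"
          using bdd unfolding D_def by (intro cInf_lower imageI)
        also have "(\<lambda>x. w x - (1 * q x + (- t) * f n x)) = (\<lambda>x. 1 * (w x - q x) + t * f n x)"
          by (auto simp: algebra_simps)
        finally show ?thesis using qd unfolding quadratic_expand[OF wq fV] by simp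
      qed
      then have "(B (\<lambda>x. w x - q x) (f n))\<^sup>2 \<le> \<delta> * B (f n) (f n)"
        using nonneg[OF fV] by (rule quadratic_nonneg_discriminant)
      also have "\<dots> \<le> \<delta> * M" using \<delta> bound by (intro mult_left_mono) auto
      also have "\<dots> \<le> e\<^sup>2" by (rule \<delta>)
      finally have "\<bar>B (\<lambda>x. w x - q x) (f n)\<bar> \<le> e" using e by (simp add: abs_le_square_iff[symmetric])
      then show ?thesis using diff_left[OF w qV fV, of n] sym[OF w fV, of n] sym[OF qV fV, of n] by simp
    qed
    then show ?thesis using q by blast
  qed
  have "convergent (\<lambda>n. B (f (r n)) w)" if w: "w \<in> V" for w
  proof -
    have "Cauchy (\<lambda>n. B (f (r n)) w)"
    proof (rule metric_CauchyI)
      fix e :: real assume e: "e > 0"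
      obtain q where q: "q \<in> S" and qe: "\<And>n. \<bar>B (f n) w - B (f n) q\<bar> \<le> e / 3"
        using approx[OF w, of "e / 3"] e by auto
      have "Cauchy (\<lambda>n. B (f (r n)) q)" using conv_S[OF q] by (simp add: Cauchy_convergent_iff)
      then obtain N where N: "\<And>m n. m \<ge> N \<Longrightarrow> n \<ge> N \<Longrightarrow> dist (B (f (r m)) q) (B (f (r n)) q) < e / 3"
        using e unfolding Cauchy_def by (meson zero_less_divide_iff zero_less_numeral)
      have "dist (B (f (r m)) w) (B (f (r n)) w) < e" if "m \<ge> N" "n \<ge> N" for m n
        using N[OF that] qe[of "r m"] qe[of "r n"] unfolding dist_real_def by linarith
      then show "\<exists>N. \<forall>m\<ge>N. \<forall>n\<ge>N. dist (B (f (r m)) w) (B (f (r n)) w) < e" by blast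
    qed
    then show ?thesis by (simp add: Cauchy_convergent_iff)
  qed
  then obtain l where l: "\<And>w. w \<in> V \<Longrightarrow> (\<lambda>n. B (f (r n)) w) \<longlonglongrightarrow> l w"
    unfolding convergent_def by metis
  \<comment> \<open>Every closed half-space that contains a tail contains the corresponding \<open>C k\<close>.\<close>
  define C where "C k = \<Inter>{T. T \<subseteq> V \<and> midconvex T \<and> (\<forall>n\<ge>k. f (r n) \<in> T)}" for k :: nat
  have midV: "midconvex V" unfolding midconvex_def by (blast intro: lincomb_mem)
  have CV: "C k \<subseteq> V" for k using midV fV by (auto simp: C_def)
  have CZ: "C k \<subseteq> Z" for k using Z f by (auto simp: C_def)
  have C1: "midconvex (C k)" for k unfolding C_def midconvex_def by blast
  have C2: "C k \<subseteq> C j" if "j \<le> k" for j k using that unfolding C_def by (auto dest: order.trans)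
  have C3: "\<exists>g\<in>C k. B g g \<le> M" for k using bound by (intro bexI[of _ "f (r k)"]) (auto simp: C_def)
  obtain p g where p: "\<And>k. p k \<in> C k" and g: "g \<in> V"
    and lim: "(\<lambda>n. B (\<lambda>x. p n x - g x) (\<lambda>x. p n x - g x)) \<longlonglongrightarrow> 0"
    by (rule nested_convex_limit[of C M, OF CV C1 C2 C3]) (assumption, (rule that; assumption))
  have pV: "p k \<in> V" for k using p CV by blast
  have Bg: "B g w = l w" if w: "w \<in> V" for w
  proof -
    have "(\<lambda>k. B (p k) w) \<longlonglongrightarrow> l w"
    proof (rule LIMSEQ_I)
      fix e :: real assume e: "e > 0"
      obtain N where N: "\<And>n. n \<ge> N \<Longrightarrow> \<bar>B (f (r n)) w - l w\<bar> < e / 2"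
        using LIMSEQ_D[OF l[OF w], of "e / 2"] e by auto
      let ?H = "{h \<in> V. \<bar>B h w - l w\<bar> \<le> e / 2}"
      have "midconvex ?H"
        unfolding midconvex_def
      proof (intro ballI)
        fix a b assume a: "a \<in> ?H" and b: "b \<in> ?H"
        then have "B (\<lambda>x. 1/2 * a x + 1/2 * b x) w = 1/2 * B a w + 1/2 * B b w" using w by (intro linear) auto
        moreover have "\<bar>B a w - l w\<bar> \<le> e / 2" "\<bar>B b w - l w\<bar> \<le> e / 2" using a b by auto
        then have "\<bar>1/2 * B a w + 1/2 * B b w - l w\<bar> \<le> e / 2" by linarith
        moreover have "(\<lambda>x. 1/2 * a x + 1/2 * b x) \<in> V" using a b by (intro lincomb_mem) auto
        ultimately show "(\<lambda>x. 1/2 * a x + 1/2 * b x) \<in> ?H" by simp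
      qed
      then have "C k \<subseteq> ?H" if "k \<ge> N" for k
        unfolding C_def using N fV that by (intro Inter_lower) (auto intro: less_imp_le)
      then have "norm (B (p k) w - l w) < e" if "k \<ge> N" for k using p[of k] that e by fastforce
      then show "\<exists>N. \<forall>k\<ge>N. norm (B (p k) w - l w) < e" by blast
    qed
    then show ?thesis using tendsto_strong_imp_weak[OF pV g w lim] LIMSEQ_unique by blast
  qed
  have weak: "(\<lambda>n. B (f (r n)) w) \<longlonglongrightarrow> B g w" if "w \<in> V" for w using l[OF that] Bg[OF that] by simp
  show ?thesis by (rule that[OF r g weak subsetD[OF CZ p] lim])
qed

definition weakly_lsc :: "(('a \<Rightarrow> real) \<Rightarrow> real) \<Rightarrow> bool" where
  "weakly_lsc j \<longleftrightarrow> (\<forall>F g. (\<forall>n. F n \<in> V) \<and> g \<in> V \<and> (\<forall>w\<in>V. (\<lambda>n. B (F n) w) \<longlonglongrightarrow> B g w)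
     \<longrightarrow> ereal (j g) \<le> liminf (\<lambda>n. ereal (j (F n))))"

text \<open>The form in which semicontinuity is used: no extended reals, and no need to know beforehand that the
  infimum of the cost is finite.\<close>

lemma weakly_lscD:
  assumes "weakly_lsc j" "\<And>n. F n \<in> V" "g \<in> V" "\<And>w. w \<in> V \<Longrightarrow> (\<lambda>n. B (F n) w) \<longlonglongrightarrow> B g w" "c < j g"
  shows "\<forall>\<^sub>F n in sequentially. c < j (F n)"
proof -
  have "ereal c < ereal (j g)" using assms(5) by simp
  also have "ereal (j g) \<le> liminf (\<lambda>n. ereal (j (F n)))"
    by (rule assms(1)[unfolded weakly_lsc_def, THEN spec[of _ F], THEN spec[of _ g], THEN mp])
      (intro conjI allI ballI assms(2-4))
  finally have "\<forall>\<^sub>F n in sequentially. ereal c < ereal (j (F n))" by (rule less_LiminfD)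
  then show ?thesis by simp
qed

text \<open>The direct method. The subsequence is chosen so that the squared norms also converge, to some \<open>L\<close>
  that is at least the squared norm of the weak limit.\<close>

lemma minimizer_exists:
  assumes Z: "Z \<subseteq> V" "Z \<noteq> {}" "midconvex Z"
    and closed: "\<And>p g. (\<And>k::nat. p k \<in> Z) \<Longrightarrow> g \<in> V \<Longrightarrow>
        (\<lambda>k. B (\<lambda>x. p k x - g x) (\<lambda>x. p k x - g x)) \<longlonglongrightarrow> 0 \<Longrightarrow> g \<in> Z"
    and lsc: "weakly_lsc j" and \<xi>: "\<xi> \<ge> 0"
    and coercive: "\<And>c. \<exists>M. \<forall>f\<in>Z. j f + \<xi> / 2 * B f f \<le> c \<longrightarrow> B f f \<le> M"
  shows "\<exists>g\<in>Z. \<forall>f\<in>Z. j g + \<xi> / 2 * B g g \<le> j f + \<xi> / 2 * B f f"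
proof -
  define c where "c f = j f + \<xi> / 2 * B f f" for f
  define m where "m = Inf ((\<lambda>f. ereal (c f)) ` Z)"
  have m_le: "m \<le> ereal (c f)" if "f \<in> Z" for f unfolding m_def using that by (intro Inf_lower) auto
  obtain y where "\<And>n. y n \<in> (\<lambda>f. ereal (c f)) ` Z" and ylim: "y \<longlonglongrightarrow> m"
    using Inf_as_limit[of "(\<lambda>f. ereal (c f)) ` Z"] Z(2) unfolding m_def by (auto simp only: image_is_empty)
  then obtain z where z: "\<And>n. z n \<in> Z" and y: "\<And>n. y n = ereal (c (z n))"
    unfolding image_iff by metis
  obtain z0 where z0: "z0 \<in> Z" using Z(2) by blast
  have below: "\<forall>\<^sub>F n in sequentially. c (z n) < t" if "f \<in> Z" "c f < t" for f t
  proof -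
    have "m < ereal t" using m_le[OF that(1)] that(2) by (metis less_ereal.simps(1) le_less_trans)
    from order_tendstoD(2)[OF ylim this] show ?thesis by (simp add: y)
  qed
  from below[OF z0, of "c z0 + 1"] obtain N where N: "\<And>n. n \<ge> N \<Longrightarrow> c (z n) \<le> c z0 + 1"
    by (auto simp: eventually_sequentially intro: less_imp_le)
  obtain M where M: "\<And>f. f \<in> Z \<Longrightarrow> c f \<le> c z0 + 1 \<Longrightarrow> B f f \<le> M" using coercive unfolding c_def by blast
  define f where "f n = z (n + N)" for n
  have f: "f n \<in> Z" "B (f n) (f n) \<le> M" for n using z N M by (auto simp: f_def)
  have fV: "f n \<in> V" for n using f Z by auto
  have "bounded (range (\<lambda>n. B (f n) (f n)))"
    using f(2) nonneg[OF fV] by (intro boundedI[of _ M]) auto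
  then obtain L r1 where r1: "strict_mono r1" and L: "((\<lambda>n. B (f n) (f n)) \<circ> r1) \<longlonglongrightarrow> L"
    using bounded_imp_convergent_subsequence by blast
  obtain r2 p g where r2: "strict_mono (r2 :: nat \<Rightarrow> nat)" and g: "g \<in> V"
    and weak: "\<And>w. w \<in> V \<Longrightarrow> (\<lambda>n. B (f (r1 (r2 n))) w) \<longlonglongrightarrow> B g w"
    and p: "\<And>k::nat. p k \<in> Z" "(\<lambda>k. B (\<lambda>x. p k x - g x) (\<lambda>x. p k x - g x)) \<longlonglongrightarrow> 0"
    by (rule weakly_convergent_subsequence[OF Z(1,3), of "\<lambda>n. f (r1 n)", OF f(1) f(2)]) (rule that; assumption)
  define F where "F n = f (r1 (r2 n))" for n
  have FV: "F n \<in> V" for n by (simp add: F_def fV)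
  have gZ: "g \<in> Z" using closed p g by blast
  have L: "(\<lambda>n. B (F n) (F n)) \<longlonglongrightarrow> L"
    using LIMSEQ_subseq_LIMSEQ[OF L r2] by (simp add: F_def o_def)
  have Lg: "B g g \<le> L"
  proof -
    have "(\<lambda>n. B (F n) (F n) - 2 * B (F n) g + B g g) \<longlonglongrightarrow> L - 2 * B g g + B g g"
      using weak[OF g] by (intro tendsto_intros L) (simp add: F_def)
    moreover have "0 \<le> B (F n) (F n) - 2 * B (F n) g + B g g" for n
      using nonneg[OF diff_mem[OF FV g, of n]] diff_expand[OF FV g, of n] by simp
    ultimately have "0 \<le> L - 2 * B g g + B g g" by (intro LIMSEQ_le_const) auto
    then show ?thesis by simp
  qed
  have "c g \<le> c h" if h: "h \<in> Z" for h
  proof (rule ccontr)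
    assume "\<not> c g \<le> c h"
    define \<delta> where "\<delta> = c g - c h"
    have \<delta>: "\<delta> > 0" using \<open>\<not> c g \<le> c h\<close> by (simp add: \<delta>_def)
    have "strict_mono (\<lambda>n. r1 (r2 n) + N)" using r1 r2 by (simp add: strict_mono_def)
    from filterlim_subseq[OF this] below[OF h, of "c h + \<delta> / 3"] \<delta>
    have "\<forall>\<^sub>F n in sequentially. c (F n) < c h + \<delta> / 3"
      unfolding F_def f_def by (auto simp: filterlim_iff)
    moreover have "\<forall>\<^sub>F n in sequentially. j g - \<delta> / 3 < j (F n)"
      using weak \<delta> by (intro weakly_lscD[OF lsc FV g]) (auto simp: F_def)
    moreover have "\<forall>\<^sub>F n in sequentially. \<xi> / 2 * L - \<delta> / 3 < \<xi> / 2 * B (F n) (F n)"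
      using \<delta> by (intro order_tendstoD(1)[OF tendsto_mult[OF tendsto_const L]]) auto
    ultimately have "\<forall>\<^sub>F n in sequentially. False"
    proof eventually_elim
      case (elim n)
      have "\<xi> / 2 * B g g \<le> \<xi> / 2 * L" using \<xi> Lg by (intro mult_left_mono) auto
      with elim show False using c_def[of "F n"] c_def[of g] \<delta>_def by linarith
    qed
    then show False by simp
  qed
  with gZ show ?thesis unfolding c_def by blast
qed

text \<open>If \<open>j (u n) < -(n + 1)\<^sup>2 (1 + |u n|)\<close>, then the factor \<open>t n = 1 / ((n + 1) (1 + |u n|))\<close> makes
  \<open>t n u n\<close> tend to \<open>0\<close>, whereas convexity between \<open>0\<close> and \<open>u n\<close> bounds \<open>j (t n u n)\<close> by a
  constant minus \<open>n + 1\<close>. This contradicts semicontinuity at \<open>0\<close>.\<close>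

lemma convex_lsc_lower_bound:
  assumes convex: "\<And>f g t. f \<in> V \<Longrightarrow> g \<in> V \<Longrightarrow> 0 \<le> t \<Longrightarrow> t \<le> 1 \<Longrightarrow>
      j (\<lambda>x. (1 - t) * f x + t * g x) \<le> (1 - t) * j f + t * j g"
    and lsc: "weakly_lsc j"
  shows "\<exists>C\<ge>0. \<forall>f\<in>V. - C * (1 + sqrt (B f f)) \<le> j f"
proof (rule ccontr)
  assume neg: "\<not> ?thesis"
  have "\<exists>f\<in>V. j f < - (real (Suc n))\<^sup>2 * (1 + sqrt (B f f))" for n
  proof -
    have "(real (Suc n))\<^sup>2 \<ge> 0" by simp
    with neg show ?thesis by (meson not_le)
  qed
  then obtain u where u: "\<And>n. u n \<in> V" and ju: "\<And>n. j (u n) < - (real (Suc n))\<^sup>2 * (1 + sqrt (B (u n) (u n)))"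
    by metis
  define t where "t n = 1 / (real (Suc n) * (1 + sqrt (B (u n) (u n))))" for n
  define v where "v n = (\<lambda>x. (1 - t n) * 0 + t n * u n x)" for n
  have s1: "1 + sqrt (B (u n) (u n)) > 0" for n using nonneg[OF u[of n]] by (simp add: add_pos_nonneg)
  have t: "0 \<le> t n" "t n \<le> 1" for n
  proof -
    have "1 * 1 \<le> real (Suc n) * (1 + sqrt (B (u n) (u n)))" using nonneg[OF u[of n]] by (intro mult_mono) auto
    then show "t n \<le> 1" by (simp add: t_def)
    show "0 \<le> t n" using s1[of n] by (simp add: t_def)
  qed
  have vV: "v n \<in> V" for n unfolding v_def using zero_mem u by (intro lincomb_mem)
  have "B (v n) (v n) \<le> (1 / real (Suc n))\<^sup>2" for n
  proof -
    have "B (v n) (v n) = (t n * sqrt (B (u n) (u n)))\<^sup>2"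
      using scale_left[OF u scale_mem[OF u], of "t n"] sym[OF u scale_mem[OF u], of n "t n"] scale_left[OF u u, of "t n"] nonneg[OF u]
      by (simp add: v_def power2_eq_square power_mult_distrib)
    also have "t n * sqrt (B (u n) (u n)) \<le> 1 / real (Suc n)"
      using s1[of n] nonneg[OF u[of n]] by (simp add: t_def divide_simps)
    then have "(t n * sqrt (B (u n) (u n)))\<^sup>2 \<le> (1 / real (Suc n))\<^sup>2"
      using t[of n] nonneg[OF u[of n]] by (intro power_mono) auto
    finally show ?thesis .
  qed
  moreover have "(\<lambda>n. (1 / real (Suc n))\<^sup>2) \<longlonglongrightarrow> 0\<^sup>2" by (intro tendsto_power LIMSEQ_Suc[OF lim_1_over_n])
  ultimately have lim0: "(\<lambda>n. B (v n) (v n)) \<longlonglongrightarrow> 0"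
    using nonneg[OF vV] by (rule_tac tendsto_sandwich[of "\<lambda>n. 0" _ sequentially "\<lambda>n. (1 / real (Suc n))\<^sup>2"]) simp_all
  then have "(\<lambda>n. B (v n) w) \<longlonglongrightarrow> B (\<lambda>x. 0) w" if "w \<in> V" for w
    using tendsto_strong_imp_weak[of v "\<lambda>x. 0" w, OF vV zero_mem that] by simp
  then have "\<forall>\<^sub>F n in sequentially. j (\<lambda>x. 0) - 1 < j (v n)"
    by (intro weakly_lscD[OF lsc vV zero_mem]) auto
  moreover have "j (v n) \<le> \<bar>j (\<lambda>x. 0)\<bar> - real (Suc n)" for n
  proof -
    have "j (v n) \<le> (1 - t n) * j (\<lambda>x. 0) + t n * j (u n)"
      unfolding v_def by (rule convex[OF zero_mem u t])
    also have "t n * j (u n) \<le> t n * (- (real (Suc n))\<^sup>2 * (1 + sqrt (B (u n) (u n))))"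
      using t ju by (intro mult_left_mono) (auto intro: less_imp_le)
    also have "\<dots> = - real (Suc n)" using s1[of n] by (simp add: t_def power2_eq_square divide_simps)
    also have "(1 - t n) * j (\<lambda>x. 0) \<le> 1 * \<bar>j (\<lambda>x. 0)\<bar>"
      using t[of n] by (intro order_trans[OF mult_left_mono[OF abs_ge_self] mult_right_mono]) auto
    finally show ?thesis by simp
  qed
  moreover have "\<forall>\<^sub>F n in sequentially. 2 * \<bar>j (\<lambda>x. 0)\<bar> + 1 < real (Suc n)"
    using filterlim_at_top_dense[THEN iffD1, OF filterlim_compose[OF filterlim_real_sequentially filterlim_Suc]] by blast
  ultimately have "\<forall>\<^sub>F n in sequentially. False"
  proof (elim eventually_rev_mp, intro always_eventually allI impI)
    fix n assume *: "\<And>n. j (v n) \<le> \<bar>j (\<lambda>x. 0)\<bar> - real (Suc n)"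
      "2 * \<bar>j (\<lambda>x. 0)\<bar> + 1 < real (Suc n)" "j (\<lambda>x. 0) - 1 < j (v n)"
    show False using *(1)[of n] *(2,3) by linarith
  qed
  then show False by simp
qed

lemma coercive_if_lower_bound:
  assumes C: "C \<ge> 0" "\<And>f. f \<in> V \<Longrightarrow> - C * (1 + sqrt (B f f)) \<le> j f" and \<xi>: "\<xi> > 0"
  shows "\<exists>M. \<forall>f\<in>V. j f + \<xi> / 2 * B f f \<le> c \<longrightarrow> B f f \<le> M"
proof -
  \<comment> \<open>For \<open>b = sqrt (B f f) \<ge> 1\<close> the hypothesis gives \<open>\<xi> / 2 * b\<^sup>2 \<le> (\<bar>c\<bar> + 2 * C) * b\<close>, that is, \<open>b \<le> K\<close>.\<close>
  define K where "K = 2 * (\<bar>c\<bar> + 2 * C) / \<xi>"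
  have K: "K \<ge> 0" using C \<xi> by (simp add: K_def)
  have "B f f \<le> (1 + K)\<^sup>2" if f: "f \<in> V" "j f + \<xi> / 2 * B f f \<le> c" for f
  proof -
    define b where "b = sqrt (B f f)"
    have b: "b \<ge> 0" "B f f = b\<^sup>2" using nonneg[OF f(1)] by (auto simp: b_def)
    have "b \<le> 1 + K"
    proof (cases "b \<le> 1")
      case False
      have "\<xi> / 2 * b\<^sup>2 \<le> c + C + C * b" using f C(2)[OF f(1)] b by (simp add: b_def[symmetric] algebra_simps)
      also have "\<dots> \<le> (\<bar>c\<bar> + C) * b + C * b"
      proof -
        have "(\<bar>c\<bar> + C) * 1 \<le> (\<bar>c\<bar> + C) * b" using False C by (intro mult_left_mono) auto
        then show ?thesis by simp
      qed
      finally have "\<xi> / 2 * b * b \<le> (\<bar>c\<bar> + 2 * C) * b" by (simp add: power2_eq_square algebra_simps)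
      then have "\<xi> / 2 * b \<le> \<bar>c\<bar> + 2 * C" using False by (simp add: mult_le_cancel_right)
      then have "b \<le> K" using \<xi> by (simp add: K_def field_simps)
      then show ?thesis by simp
    qed (use K in simp)
    then show ?thesis using b by (simp add: power_mono)
  qed
  then show ?thesis by blast
qed

end

section \<open>Square-integrable functions\<close>

lemma L2_I:
  assumes "f \<in> borel_measurable M" "(\<integral>\<^sup>+x. ennreal ((f x)\<^sup>2) \<partial>M) < \<infinity>"
  shows "f \<in> L2 M"
  using assms unfolding L2_def by (auto intro!: integrableI_nonneg)

lemma L2_nn_integral:
  assumes "f \<in> L2 M"
  shows "(\<integral>\<^sup>+x. ennreal ((f x)\<^sup>2) \<partial>M) = ennreal (\<integral>x. f x * f x \<partial>M)"
  using assms unfolding L2_def by (auto simp: nn_integral_eq_integral power2_eq_square)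

lemma L2_iff_nn_integral:
  "f \<in> L2 M \<longleftrightarrow> f \<in> borel_measurable M \<and> (\<integral>\<^sup>+x. ennreal ((f x)\<^sup>2) \<partial>M) < \<infinity>"
  using L2_I[of f M] L2_nn_integral[of f M] by (auto simp: L2_def)

lemma L2_measurable: "f \<in> L2 M \<Longrightarrow> f \<in> borel_measurable M"
  by (simp add: L2_def)

lemma L2_mult_integrable:
  assumes "f \<in> L2 M" "g \<in> L2 M"
  shows "integrable M (\<lambda>x. f x * g x)"
proof (rule Bochner_Integration.integrable_bound)
  show "integrable M (\<lambda>x. (f x)\<^sup>2 + (g x)\<^sup>2)" using assms by (auto simp: L2_def)
  show "(\<lambda>x. f x * g x) \<in> borel_measurable M" using assms by (auto simp: L2_def)
  have "\<bar>f x * g x\<bar> \<le> (f x)\<^sup>2 + (g x)\<^sup>2" for x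
    using sum_squares_bound[of "\<bar>f x\<bar>" "\<bar>g x\<bar>"] mult_nonneg_nonneg[of "\<bar>f x\<bar>" "\<bar>g x\<bar>"]
    unfolding abs_mult power2_abs by linarith
  then show "AE x in M. norm (f x * g x) \<le> norm ((f x)\<^sup>2 + (g x)\<^sup>2)" by simp
qed

lemma L2_lincomb:
  assumes "f \<in> L2 M" "g \<in> L2 M"
  shows "(\<lambda>x. a * f x + b * g x) \<in> L2 M"
proof -
  have "integrable M (\<lambda>x. a\<^sup>2 * (f x)\<^sup>2 + 2 * a * b * (f x * g x) + b\<^sup>2 * (g x)\<^sup>2)"
    using assms L2_mult_integrable[OF assms] by (auto simp: L2_def)
  moreover have "(a * f x + b * g x)\<^sup>2 = a\<^sup>2 * (f x)\<^sup>2 + 2 * a * b * (f x * g x) + b\<^sup>2 * (g x)\<^sup>2" for x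
    by (simp add: power2_eq_square algebra_simps)
  ultimately show ?thesis using assms by (auto simp: L2_def)
qed

text \<open>Fatou's lemma; it transfers bounds on \<open>F m - F n\<close> to bounds on \<open>f - F n\<close>.\<close>

lemma nn_integral_square_le_of_limit:
  fixes g :: "'a \<Rightarrow> real"
  assumes G: "\<And>k. G k \<in> borel_measurable M"
    and lim: "AE x in M. (\<lambda>k::nat. G k x) \<longlonglongrightarrow> g x"
    and bound: "\<forall>\<^sub>F k in sequentially. (\<integral>\<^sup>+x. ennreal ((G k x)\<^sup>2) \<partial>M) \<le> c"
  shows "(\<integral>\<^sup>+x. ennreal ((g x)\<^sup>2) \<partial>M) \<le> c"
proof -
  have "AE x in M. ennreal ((g x)\<^sup>2) = liminf (\<lambda>k. ennreal ((G k x)\<^sup>2))"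
    using lim
  proof eventually_elim
    case (elim x)
    have "(\<lambda>k. ennreal ((G k x)\<^sup>2)) \<longlonglongrightarrow> ennreal ((g x)\<^sup>2)"
      by (intro tendsto_ennrealI tendsto_power elim)
    then show ?case using lim_imp_Liminf[OF sequentially_bot] by metis
  qed
  then have "(\<integral>\<^sup>+x. ennreal ((g x)\<^sup>2) \<partial>M) = (\<integral>\<^sup>+x. liminf (\<lambda>k. ennreal ((G k x)\<^sup>2)) \<partial>M)"
    by (rule nn_integral_cong_AE)
  also have "\<dots> \<le> liminf (\<lambda>k. \<integral>\<^sup>+x. ennreal ((G k x)\<^sup>2) \<partial>M)"
    using G by (intro nn_integral_liminf) measurable
  also have "\<dots> \<le> limsup (\<lambda>k. \<integral>\<^sup>+x. ennreal ((G k x)\<^sup>2) \<partial>M)" by (intro Liminf_le_Limsup) simp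
  also have "\<dots> \<le> c" using bound by (rule Limsup_bounded)
  finally show ?thesis .
qed

text \<open>The subsequence has consecutive distances whose squares are at most \<open>(1/8)\<^sup>k\<close>. These still have a
  finite sum with the weights \<open>4\<^sup>k\<close>, so the increments are almost everywhere at most a constant times
  \<open>(1/2)\<^sup>k\<close>.\<close>

lemma L2_Cauchy_AE_subsequence:
  fixes F :: "nat \<Rightarrow> 'a \<Rightarrow> real"
  assumes F[measurable]: "\<And>n. F n \<in> borel_measurable M"
    and Cauchy: "\<And>e. e > 0 \<Longrightarrow> \<exists>N. \<forall>m\<ge>N. \<forall>n\<ge>N. (\<integral>\<^sup>+x. ennreal ((F m x - F n x)\<^sup>2) \<partial>M) \<le> ennreal e"
  obtains r f where "strict_mono (r :: nat \<Rightarrow> nat)" "f \<in> borel_measurable M"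
    "AE x in M. (\<lambda>k. F (r k) x) \<longlonglongrightarrow> f x"
proof -
  let ?P = "\<lambda>k N. \<forall>m\<ge>N. \<forall>n\<ge>N. (\<integral>\<^sup>+x. ennreal ((F m x - F n x)\<^sup>2) \<partial>M) \<le> ennreal ((1/8)^k)"
  have "\<exists>r. \<forall>k. ?P k (r k) \<and> r k < r (Suc k)"
  proof (rule dependent_nat_choice)
    show "\<exists>N. ?P 0 N" using Cauchy[of 1] by simp
    fix N k :: nat
    obtain N' where "?P (Suc k) N'" using Cauchy[of "(1/8)^Suc k"] by auto
    then show "\<exists>N'. ?P (Suc k) N' \<and> N < N'" by (intro exI[of _ "max N' (Suc N)"]) auto
  qed
  then obtain r where rP: "\<And>k. ?P k (r k)" and r: "\<And>k. r k < r (Suc k)" by blast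
  have mono: "strict_mono r" using r by (simp add: strict_mono_Suc_iff)
  define d where "d k x = ennreal (4 ^ k * (F (r (Suc k)) x - F (r k) x)\<^sup>2)" for k x
  have d[measurable]: "d k \<in> borel_measurable M" for k unfolding d_def by measurable
  have "(\<integral>\<^sup>+x. (\<Sum>k. d k x) \<partial>M) = (\<Sum>k. \<integral>\<^sup>+x. d k x \<partial>M)" by (rule nn_integral_suminf) measurable
  also have "\<dots> \<le> (\<Sum>k. ennreal ((1/2)^k))"
  proof (intro suminf_le)
    fix k
    have "(\<integral>\<^sup>+x. d k x \<partial>M) = ennreal (4^k) * (\<integral>\<^sup>+x. ennreal ((F (r (Suc k)) x - F (r k) x)\<^sup>2) \<partial>M)"
      unfolding d_def by (subst nn_integral_cmult[symmetric]) (auto simp: ennreal_mult)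
    also have "\<dots> \<le> ennreal (4^k) * ennreal ((1/8)^k)"
      using rP[of k] r[of k] by (intro mult_left_mono) auto
    also have "\<dots> = ennreal ((1/2)^k)"
      by (simp add: ennreal_mult[symmetric] power_mult_distrib[symmetric])
    finally show "(\<integral>\<^sup>+x. d k x \<partial>M) \<le> ennreal ((1/2)^k)" .
  qed auto
  also have "\<dots> < \<infinity>" by (subst suminf_ennreal2) (auto intro: summable_geometric)
  finally have "(\<integral>\<^sup>+x. (\<Sum>k. d k x) \<partial>M) \<noteq> \<infinity>" by simp
  then have fin: "AE x in M. (\<Sum>k. d k x) \<noteq> \<infinity>" by (intro nn_integral_PInf_AE) measurable
  have conv: "AE x in M. convergent (\<lambda>k. F (r k) x)"
    using fin
  proof eventually_elim
    case (elim x)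
    then obtain S where S: "S \<ge> 0" "(\<Sum>k. d k x) = ennreal S"
      by (cases "\<Sum>k. d k x") auto
    have step: "norm (F (r (Suc k)) x - F (r k) x) \<le> sqrt S * (1/2)^k" for k
    proof -
      have "d k x \<le> (\<Sum>k. d k x)" by (rule sum_le_suminf[of _ "{k}", simplified]) auto
      then have "4 ^ k * (F (r (Suc k)) x - F (r k) x)\<^sup>2 \<le> S" using S by (simp add: d_def)
      then have "sqrt (4 ^ k * (F (r (Suc k)) x - F (r k) x)\<^sup>2) \<le> sqrt S" by (rule real_sqrt_le_mono)
      moreover have "sqrt (4 ^ k) = 2 ^ k" by (simp add: real_sqrt_power)
      ultimately have "2 ^ k * \<bar>F (r (Suc k)) x - F (r k) x\<bar> \<le> sqrt S" by (simp add: real_sqrt_mult)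
      then show ?thesis by (simp add: field_simps power_one_over)
    qed
    have "summable (\<lambda>k. sqrt S * (1/2)^k)" by (intro summable_mult summable_geometric) simp
    then have "summable (\<lambda>k. F (r (Suc k)) x - F (r k) x)"
      using step by (rule summable_comparison_test'[where N = 0])
    then have "convergent (\<lambda>n. F (r n) x - F (r 0) x)"
      unfolding summable_iff_convergent sum_lessThan_telescope[of "\<lambda>k. F (r k) x"] .
    from convergent_add[OF this convergent_const[of "F (r 0) x"]] show ?case by simp
  qed
  show ?thesis
  proof
    show "(\<lambda>x. lim (\<lambda>k. F (r k) x)) \<in> borel_measurable M" by measurable
    show "AE x in M. (\<lambda>k. F (r k) x) \<longlonglongrightarrow> lim (\<lambda>k. F (r k) x)"
      using conv by eventually_elim (simp add: convergent_LIMSEQ_iff)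
  qed (rule mono)
qed

lemma semi_hilbert_L2: "semi_hilbert (L2 M) (\<lambda>f g. \<integral>x. f x * g x \<partial>M)"
proof
  show "(\<lambda>x. 0) \<in> L2 M" by (simp add: L2_def)
  show "(\<lambda>x. a * f x + b * g x) \<in> L2 M" if "f \<in> L2 M" "g \<in> L2 M" for f g a b
    using that by (rule L2_lincomb)
  show "(\<integral>x. f x * g x \<partial>M) = (\<integral>x. g x * f x \<partial>M)" for f g :: "'a \<Rightarrow> real" by (simp add: mult.commute)
  show "(\<integral>x. (a * f x + b * g x) * h x \<partial>M) = a * (\<integral>x. f x * h x \<partial>M) + b * (\<integral>x. g x * h x \<partial>M)"
    if "f \<in> L2 M" "g \<in> L2 M" "h \<in> L2 M" for f g h a b
  proof -
    have "(\<integral>x. (a * f x + b * g x) * h x \<partial>M) = (\<integral>x. a * (f x * h x) + b * (g x * h x) \<partial>M)"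
      by (simp add: algebra_simps)
    also have "\<dots> = a * (\<integral>x. f x * h x \<partial>M) + b * (\<integral>x. g x * h x \<partial>M)"
      using L2_mult_integrable[OF that(1,3)] L2_mult_integrable[OF that(2,3)] by simp
    finally show ?thesis .
  qed
  show "0 \<le> (\<integral>x. f x * f x \<partial>M)" for f :: "'a \<Rightarrow> real" by (intro integral_nonneg_AE) simp
  fix F :: "nat \<Rightarrow> 'a \<Rightarrow> real"
  assume F: "\<And>n. F n \<in> L2 M"
    and Cauchy: "\<And>e. e > 0 \<Longrightarrow> \<exists>N. \<forall>m\<ge>N. \<forall>n\<ge>N. (\<integral>x. (F m x - F n x) * (F m x - F n x) \<partial>M) < e"
  have Fd: "(\<lambda>x. F m x - F n x) \<in> L2 M" for m n using L2_lincomb[OF F F, of 1 m "-1" n] by simp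
  have Cauchy': "\<exists>N. \<forall>m\<ge>N. \<forall>n\<ge>N. (\<integral>\<^sup>+x. ennreal ((F m x - F n x)\<^sup>2) \<partial>M) \<le> ennreal e" if "e > 0" for e
    using Cauchy[OF that] unfolding L2_nn_integral[OF Fd] by (elim ex_forward all_forward imp_forward) (auto intro: ennreal_leI less_imp_le)
  obtain r f where r: "strict_mono (r :: nat \<Rightarrow> nat)" and f: "f \<in> borel_measurable M"
    and lim: "AE x in M. (\<lambda>k. F (r k) x) \<longlonglongrightarrow> f x"
    by (rule L2_Cauchy_AE_subsequence[OF L2_measurable[OF F] Cauchy']) (assumption, (rule that; assumption))
  have le: "\<exists>N. \<forall>n\<ge>N. (\<integral>\<^sup>+x. ennreal ((F n x - f x)\<^sup>2) \<partial>M) \<le> ennreal e" if e: "e > 0" for e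
  proof -
    obtain N where N: "\<And>m n. m \<ge> N \<Longrightarrow> n \<ge> N \<Longrightarrow> (\<integral>\<^sup>+x. ennreal ((F m x - F n x)\<^sup>2) \<partial>M) \<le> ennreal e"
      using Cauchy'[OF e] by blast
    have "(\<integral>\<^sup>+x. ennreal ((F n x - f x)\<^sup>2) \<partial>M) \<le> ennreal e" if n: "n \<ge> N" for n
    proof (rule nn_integral_square_le_of_limit[where G = "\<lambda>k x. F n x - F (r k) x"])
      show "AE x in M. (\<lambda>k. F n x - F (r k) x) \<longlonglongrightarrow> F n x - f x"
        using lim by eventually_elim (intro tendsto_intros)
      show "\<forall>\<^sub>F k in sequentially. (\<integral>\<^sup>+x. ennreal ((F n x - F (r k) x)\<^sup>2) \<partial>M) \<le> ennreal e"
        using seq_suble[OF r] n by (intro eventually_sequentiallyI[of N] N) (auto intro: order_trans)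
    qed (use L2_measurable[OF Fd] in simp)
    then show ?thesis by blast
  qed
  obtain N where "(\<integral>\<^sup>+x. ennreal ((F N x - f x)\<^sup>2) \<partial>M) \<le> ennreal 1" using le[of 1] by auto
  then have "(\<lambda>x. F N x - f x) \<in> L2 M"
    using f L2_measurable[OF F] by (intro L2_I) (auto simp: le_less_trans)
  from L2_lincomb[OF F this, of 1 N "-1"] have fL: "f \<in> L2 M" by simp
  have Ff: "(\<lambda>x. F n x - f x) \<in> L2 M" for n using L2_lincomb[OF F fL, of 1 n "-1"] by simp
  have "(\<lambda>n. \<integral>x. (F n x - f x) * (F n x - f x) \<partial>M) \<longlonglongrightarrow> 0"
  proof (rule LIMSEQ_I)
    fix e :: real assume e: "e > 0"
    then obtain N where N: "\<And>n. n \<ge> N \<Longrightarrow> (\<integral>\<^sup>+x. ennreal ((F n x - f x)\<^sup>2) \<partial>M) \<le> ennreal (e / 2)"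
      using le[of "e / 2"] by auto
    have "norm ((\<integral>x. (F n x - f x) * (F n x - f x) \<partial>M) - 0) < e" if "n \<ge> N" for n
    proof -
      have "(\<integral>x. (F n x - f x) * (F n x - f x) \<partial>M) \<le> e / 2"
        using N[OF that] e unfolding L2_nn_integral[OF Ff] by simp
      moreover have "0 \<le> (\<integral>x. (F n x - f x) * (F n x - f x) \<partial>M)" by (intro integral_nonneg_AE) simp
      ultimately show ?thesis using e by simp
    qed
    then show "\<exists>N. \<forall>n\<ge>N. norm ((\<integral>x. (F n x - f x) * (F n x - f x) \<partial>M) - 0) < e" by blast
  qed
  with fL show "\<exists>f\<in>L2 M. (\<lambda>n. \<integral>x. (F n x - f x) * (F n x - f x) \<partial>M) \<longlonglongrightarrow> 0" by blast
qed

section \<open>Functions that annihilate all test functions\<close>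

lemma lebesgue_measurable_borel: "f \<in> borel \<rightarrow>\<^sub>M N \<Longrightarrow> f \<in> lebesgue \<rightarrow>\<^sub>M N"
  by (rule measurable_completion) simp

lemma integrable_mult_bounded:
  fixes f h :: "'a \<Rightarrow> real"
  assumes f: "integrable M f" and h: "h \<in> borel_measurable M" "\<And>x. \<bar>h x\<bar> \<le> c"
  shows "integrable M (\<lambda>x. f x * h x)"
proof (rule Bochner_Integration.integrable_bound)
  show "integrable M (\<lambda>x. c * \<bar>f x\<bar>)" using f by auto
  show "(\<lambda>x. f x * h x) \<in> borel_measurable M" using f h by auto
  show "AE x in M. norm (f x * h x) \<le> norm (c * \<bar>f x\<bar>)"
  proof (intro AE_I2)
    fix x
    have "\<bar>f x\<bar> * \<bar>h x\<bar> \<le> \<bar>f x\<bar> * c" using h(2) by (intro mult_left_mono) auto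
    also have "\<dots> \<le> \<bar>c * \<bar>f x\<bar>\<bar>" by (simp add: mult.commute)
    finally show "norm (f x * h x) \<le> norm (c * \<bar>f x\<bar>)" by (simp add: abs_mult)
  qed
qed

text \<open>The positive and the negative part of \<open>f\<close> are densities of finite measures that agree on closed
  sets, a generator of the Borel sets stable under intersection.\<close>

lemma AE_eq_0_if_closed_integrals_eq_0_borel:
  fixes f :: "'a::euclidean_space \<Rightarrow> real"
  assumes f: "integrable lborel f"
    and zero: "\<And>C. closed C \<Longrightarrow> (\<integral>x. f x * indicator C x \<partial>lborel) = 0"
  shows "AE x in lborel. f x = 0"
proof -
  let ?p = "\<lambda>x. ennreal (f x)" and ?n = "\<lambda>x. ennreal (- f x)"
  have fin: "(\<integral>\<^sup>+x. ?p x \<partial>lborel) \<noteq> \<infinity>" "(\<integral>\<^sup>+x. ?n x \<partial>lborel) \<noteq> \<infinity>"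
    using f by (auto simp: real_integrable_def)
  have m[measurable]: "f \<in> borel_measurable borel" using f by auto
  have eq: "density lborel ?p = density lborel ?n"
  proof (rule measure_eqI_generator_eq[where E = "Collect closed" and \<Omega> = UNIV and A = "\<lambda>_. UNIV"])
    fix C :: "'a set" assume "C \<in> Collect closed"
    then have C: "closed C" and [measurable]: "C \<in> sets borel" by auto
    have i: "integrable lborel (\<lambda>x. f x * indicator C x)"
      by (rule integrable_mult_bounded[OF f, where c = 1]) (auto split: split_indicator)
    have "ennreal (f x) * indicator C x = ennreal (f x * indicator C x)" for x by (auto split: split_indicator)
    moreover have "ennreal (- f x) * indicator C x = ennreal (- (f x * indicator C x))" for x by (auto split: split_indicator)
    moreover have "(\<integral>\<^sup>+x. ennreal (f x * indicator C x) \<partial>lborel) = (\<integral>\<^sup>+x. ennreal (- (f x * indicator C x)) \<partial>lborel)"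
    proof -
      have "enn2real (\<integral>\<^sup>+x. ennreal (f x * indicator C x) \<partial>lborel) = enn2real (\<integral>\<^sup>+x. ennreal (- (f x * indicator C x)) \<partial>lborel)"
        using zero[OF C] real_lebesgue_integral_def[OF i] by simp
      moreover have "(\<integral>\<^sup>+x. ennreal (f x * indicator C x) \<partial>lborel) < top" "(\<integral>\<^sup>+x. ennreal (- (f x * indicator C x)) \<partial>lborel) < top"
        using i unfolding real_integrable_def by (simp_all add: less_top)
      ultimately show ?thesis by (metis ennreal_enn2real)
    qed
    ultimately show "emeasure (density lborel ?p) C = emeasure (density lborel ?n) C"
      by (simp add: emeasure_density)
  next
    show "Int_stable (Collect closed)" by (auto simp: Int_stable_def)
    show "sets (density lborel ?p) = sigma_sets UNIV (Collect closed)" "sets (density lborel ?n) = sigma_sets UNIV (Collect closed)"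
      by (simp_all add: borel_eq_closed)
    show "emeasure (density lborel ?p) UNIV \<noteq> \<infinity>" using fin by (simp add: emeasure_density)
  qed auto
  have "AE x in lborel. ?p x = ?n x" by (rule sigma_finite_measure.density_unique[OF sigma_finite_lborel _ _ eq]) auto
  then show ?thesis
  proof eventually_elim
    case (elim x)
    then show ?case by (cases "f x" "0::real" rule: linorder_cases) (auto simp: ennreal_neg)
  qed
qed

lemma AE_eq_0_if_closed_integrals_eq_0:
  fixes f :: "'a::euclidean_space \<Rightarrow> real"
  assumes f: "integrable lebesgue f"
    and zero: "\<And>C. closed C \<Longrightarrow> (\<integral>x. f x * indicator C x \<partial>lebesgue) = 0"
  shows "AE x in lebesgue. f x = 0"
proof -
  obtain f' where f': "f' \<in> borel_measurable lborel" "AE x in lborel. f x = f' x"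
    using completion_ex_borel_measurable_real[OF borel_measurable_integrable[OF f]] by auto
  have ae: "AE x in lebesgue. f x = f' x" using f'(2) by (rule AE_completion)
  have m: "f' \<in> borel_measurable lebesgue" using f'(1) by (rule measurable_completion)
  have "integrable lebesgue f'" using f m ae by (metis integrable_cong_AE borel_measurable_integrable)
  then have "integrable lborel f'" using f'(1) integrable_completion by blast
  moreover have "(\<integral>x. f' x * indicator C x \<partial>lborel) = 0" if C: "closed C" for C
  proof -
    have [measurable]: "C \<in> sets borel" using C by auto
    have "(\<integral>x. f' x * indicator C x \<partial>lborel) = (\<integral>x. f' x * indicator C x \<partial>lebesgue)"
      using f'(1) by (intro integral_completion[symmetric]) auto
    also have "\<dots> = (\<integral>x. f x * indicator C x \<partial>lebesgue)"
    proof (rule integral_cong_AE)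
      show "(\<lambda>x. f' x * indicator C x) \<in> borel_measurable lebesgue"
        using f'(1) by (intro measurable_completion) auto
      show "(\<lambda>x. f x * indicator C x) \<in> borel_measurable lebesgue"
        using f by (intro borel_measurable_times borel_measurable_integrable[OF f] lebesgue_measurable_borel) auto
      show "AE x in lebesgue. f' x * indicator C x = f x * indicator C x" using ae by eventually_elim simp
    qed
    finally show ?thesis using zero[OF C] by simp
  qed
  ultimately have "AE x in lborel. f' x = 0" by (rule AE_eq_0_if_closed_integrals_eq_0_borel)
  then have "AE x in lebesgue. f' x = 0" by (rule AE_completion)
  with ae show ?thesis by eventually_elim simp
qed

text \<open>The indicator of a compact set \<open>C\<close> is the limit of the Lipschitz functions
  \<open>max 0 (1 - n dist(y, C))\<close>.\<close>

lemma AE_eq_0_if_test_integrals_eq_0: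
  fixes f :: "'a::euclidean_space \<Rightarrow> real"
  assumes f: "integrable lebesgue f"
    and zero: "\<And>H L \<rho>. L-lipschitz_on UNIV H \<Longrightarrow> (\<And>y. \<bar>H y\<bar> \<le> 1) \<Longrightarrow> (\<And>y. H y \<noteq> 0 \<Longrightarrow> norm y \<le> \<rho>) \<Longrightarrow>
      (\<integral>y. f y * H y \<partial>lebesgue) = 0"
  shows "AE x in lebesgue. f x = 0"
proof (rule AE_eq_0_if_closed_integrals_eq_0[OF f])
  have fm: "f \<in> borel_measurable lebesgue" using f by auto
  have cpt: "(\<integral>x. f x * indicator C x \<partial>lebesgue) = 0" if C: "compact C" for C
  proof (cases "C = {}")
    case False
    define H where "H n y = max 0 (1 - real (Suc n) * infdist y C)" for n y
    have lip: "(real (Suc n))-lipschitz_on UNIV (H n)" for n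
    proof (rule lipschitz_onI)
      fix x y
      have "\<bar>H n x - H n y\<bar> \<le> \<bar>real (Suc n) * infdist x C - real (Suc n) * infdist y C\<bar>"
        by (auto simp: H_def)
      also have "\<dots> = real (Suc n) * \<bar>infdist x C - infdist y C\<bar>"
        by (simp only: right_diff_distrib[symmetric] abs_mult abs_of_nat)
      also have "\<dots> \<le> real (Suc n) * dist x y" by (intro mult_left_mono infdist_triangle_abs) simp
      finally show "dist (H n x) (H n y) \<le> real (Suc n) * dist x y" by (simp add: dist_real_def)
    qed simp
    have bd: "0 \<le> H n y" "H n y \<le> 1" for n y using infdist_nonneg[of y C] by (auto simp: H_def)
    obtain \<rho> where \<rho>: "\<And>c. c \<in> C \<Longrightarrow> norm c \<le> \<rho>" using C compact_imp_bounded bounded_iff by metis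
    have supp: "norm y \<le> \<rho> + 1" if "H n y \<noteq> 0" for n y
    proof -
      have "real (Suc n) * infdist y C < 1" using that by (auto simp: H_def max_def split: if_splits)
      moreover have "1 * infdist y C \<le> real (Suc n) * infdist y C" using infdist_nonneg by (intro mult_right_mono) auto
      ultimately have "infdist y C < 1" by simp
      moreover obtain c where c: "c \<in> C" "infdist y C = dist y c"
        using infdist_attains_inf[of C y] compact_imp_closed[OF C] False by blast
      ultimately have "norm (y - c) < 1" by (simp add: dist_norm)
      then show ?thesis using \<rho>[OF c(1)] norm_triangle_ineq[of "y - c" c] by simp
    qed
    have Hm: "H n \<in> borel_measurable lebesgue" for n
      using lipschitz_on_continuous_on[OF lip] by (intro lebesgue_measurable_borel borel_measurable_continuous_onI)
    have lim: "(\<lambda>n. H n y) \<longlonglongrightarrow> indicator C y" for y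
    proof (cases "y \<in> C")
      case True
      then show ?thesis by (simp add: H_def)
    next
      case False
      then have "infdist y C > 0"
        using in_closed_iff_infdist_zero[OF compact_imp_closed[OF C] \<open>C \<noteq> {}\<close>] infdist_nonneg[of y C] by (metis less_eq_real_def)
      then obtain N where N: "1 / real (Suc N) < infdist y C" using nat_approx_posE by blast
      have "H n y = 0" if "n \<ge> N" for n
      proof -
        have "1 = real (Suc N) * (1 / real (Suc N))" by simp
        also have "\<dots> \<le> real (Suc n) * infdist y C" using N that by (intro mult_mono) auto
        finally show ?thesis by (simp add: H_def)
      qed
      then have "\<forall>\<^sub>F n in sequentially. H n y = 0" by (auto simp: eventually_sequentially)
      then show ?thesis using False by (simp add: tendsto_eventually)
    qed
    have "(\<lambda>n. \<integral>y. f y * H n y \<partial>lebesgue) \<longlonglongrightarrow> (\<integral>y. f y * indicator C y \<partial>lebesgue)"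
    proof (rule integral_dominated_convergence)
      show "(\<lambda>y. f y * indicator C y) \<in> borel_measurable lebesgue"
        using borel_compact[OF C] by (intro borel_measurable_times fm lebesgue_measurable_borel) simp
      show "(\<lambda>y. f y * H n y) \<in> borel_measurable lebesgue" for n by (intro borel_measurable_times fm Hm)
      show "integrable lebesgue (\<lambda>y. \<bar>f y\<bar>)" using f by simp
      show "AE y in lebesgue. (\<lambda>n. f y * H n y) \<longlonglongrightarrow> f y * indicator C y"
        by (intro AE_I2 tendsto_intros lim)
      show "AE y in lebesgue. norm (f y * H n y) \<le> \<bar>f y\<bar>" for n
        using bd by (intro AE_I2) (simp add: abs_mult mult_left_le)
    qed
    moreover have "(\<integral>y. f y * H n y \<partial>lebesgue) = 0" for n
      using bd supp by (intro zero[OF lip[of n], of "\<rho> + 1"]) auto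
    ultimately show ?thesis by (simp add: LIMSEQ_const_iff)
  qed simp
  show "(\<integral>x. f x * indicator C x \<partial>lebesgue) = 0" if C: "closed C" for C
  proof -
    have sets: "C \<inter> cball 0 (real n) \<in> sets borel" "C \<in> sets borel" for n using C by auto
    have "(\<lambda>n. \<integral>y. f y * indicator (C \<inter> cball 0 (real n)) y \<partial>lebesgue) \<longlonglongrightarrow> (\<integral>y. f y * indicator C y \<partial>lebesgue)"
    proof (rule integral_dominated_convergence)
      show "(\<lambda>y. f y * indicator C y) \<in> borel_measurable lebesgue"
        "(\<lambda>y. f y * indicator (C \<inter> cball 0 (real n)) y) \<in> borel_measurable lebesgue" for n
        by (intro borel_measurable_times fm lebesgue_measurable_borel borel_measurable_indicator sets)+
      show "integrable lebesgue (\<lambda>y. \<bar>f y\<bar>)" using f by simp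
      show "AE y in lebesgue. (\<lambda>n. f y * indicator (C \<inter> cball 0 (real n)) y) \<longlonglongrightarrow> f y * indicator C y"
      proof (intro AE_I2 tendsto_intros tendsto_eventually)
        fix y :: 'a
        obtain N where "norm y \<le> real N" using real_arch_simple by blast
        then show "\<forall>\<^sub>F n in sequentially. indicat_real (C \<inter> cball 0 (real n)) y = indicat_real C y"
          by (intro eventually_sequentiallyI[of N]) (auto simp: indicator_def)
      qed
      show "AE y in lebesgue. norm (f y * indicator (C \<inter> cball 0 (real n)) y) \<le> \<bar>f y\<bar>" for n
        by (intro AE_I2) (simp split: split_indicator)
    qed
    moreover have "(\<integral>y. f y * indicator (C \<inter> cball 0 (real n)) y \<partial>lebesgue) = 0" for n
      using C by (intro cpt closed_Int_compact) auto
    ultimately show ?thesis by (simp add: LIMSEQ_const_iff)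
  qed
qed

section \<open>The kernel along lines\<close>

lemma second_difference:
  fixes p p' p'' :: "real \<Rightarrow> real"
  assumes D: "\<And>t. \<bar>t\<bar> \<le> h \<Longrightarrow> (p has_real_derivative p' t) (at t)"
    "\<And>t. \<bar>t\<bar> \<le> h \<Longrightarrow> (p' has_real_derivative p'' t) (at t)" and h: "h > 0"
  obtains t1 t2 where "\<bar>t1\<bar> \<le> h" "\<bar>t2\<bar> \<le> h" "p h + p (- h) - 2 * p 0 = h\<^sup>2 * ((p'' t1 + p'' t2) / 2)"
proof -
  define diff where "diff m = (if m = 0 then p else if m = (1::nat) then p' else p'')" for m
  have DD: "\<forall>m t. m < 2 \<and> - h \<le> t \<and> t \<le> h \<longrightarrow> DERIV (diff m) t :> diff (Suc m) t"
    using D by (auto simp: diff_def less_2_cases_iff abs_le_iff)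
  obtain t1 where t1: "0 < t1" "t1 < h"
    "p h = (\<Sum>m<2. diff m 0 / fact m * (h - 0)^m) + diff 2 t1 / fact 2 * (h - 0)^2"
    using Taylor_up[OF _ _ DD, of p 0] h by (auto simp: diff_def)
  obtain t2 where t2: "- h < t2" "t2 < 0"
    "p (- h) = (\<Sum>m<2. diff m 0 / fact m * (- h - 0)^m) + diff 2 t2 / fact 2 * (- h - 0)^2"
    using Taylor_down[OF _ _ DD, of p 0] h by (auto simp: diff_def)
  have "p h + p (- h) - 2 * p 0 = h\<^sup>2 * ((p'' t1 + p'' t2) / 2)"
    using t1(3) t2(3) by (simp add: diff_def numeral_2_eq_2 algebra_simps)
  then show ?thesis using t1 t2 by (intro that[of t1 t2]) auto
qed

text \<open>Along the line \<open>z + t e\<close> the squared norm is the quadratic polynomial \<open>q t\<close>.\<close>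

lemma norm_powr_line_derivs:
  fixes z e :: "'a::real_inner" and a :: real
  defines "q \<equiv> \<lambda>t. z \<bullet> z + 2 * t * (z \<bullet> e) + t\<^sup>2"
  assumes e: "norm e = 1" and nz: "z + t *\<^sub>R e \<noteq> 0"
  shows "norm (z + t *\<^sub>R e) powr (- a) = q t powr (- a / 2)"
    and "q t > 0"
    and "((\<lambda>t. q t powr (- a / 2)) has_real_derivative
        (- a / 2 * q t powr (- a / 2 - 1) * (2 * (z \<bullet> e) + 2 * t))) (at t)"
    and "((\<lambda>t. - a / 2 * q t powr (- a / 2 - 1) * (2 * (z \<bullet> e) + 2 * t)) has_real_derivative
        (a * (a + 2) * q t powr (- a / 2 - 2) * (z \<bullet> e + t)\<^sup>2 - a * q t powr (- a / 2 - 1))) (at t)"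
proof -
  have q: "q t = norm (z + t *\<^sub>R e) ^ 2"
  proof -
    have "e \<bullet> e = 1" using e by (simp add: norm_eq_1)
    moreover have "norm (z + t *\<^sub>R e) ^ 2 = z \<bullet> z + 2 * t * (z \<bullet> e) + t * t * (e \<bullet> e)"
      unfolding power2_norm_eq_inner by (simp add: inner_add_left inner_add_right inner_commute algebra_simps)
    ultimately show ?thesis by (simp add: q_def power2_eq_square)
  qed
  show pos: "q t > 0" using q nz by simp
  have "q t powr (- a / 2) = (norm (z + t *\<^sub>R e) powr 2) powr (- a / 2)"
    unfolding q using nz by (subst powr_numeral) simp_all
  also have "\<dots> = norm (z + t *\<^sub>R e) powr (2 * (- a / 2))" by (rule powr_powr)
  finally show "norm (z + t *\<^sub>R e) powr (- a) = q t powr (- a / 2)" by simp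
  have dq: "(q has_real_derivative (2 * (z \<bullet> e) + 2 * t)) (at t)"
    unfolding q_def by (auto intro!: derivative_eq_intros)
  show "((\<lambda>t. q t powr (- a / 2)) has_real_derivative
        (- a / 2 * q t powr (- a / 2 - 1) * (2 * (z \<bullet> e) + 2 * t))) (at t)"
    using DERIV_fun_powr[OF dq pos, of "- a / 2"] by simp
  have "((\<lambda>t. q t powr (- a / 2 - 1)) has_real_derivative
        ((- a / 2 - 1) * q t powr (- a / 2 - 1 - 1) * (2 * (z \<bullet> e) + 2 * t))) (at t)"
    using DERIV_fun_powr[OF dq pos, of "- a / 2 - 1"] by simp
  moreover have "- a / 2 - 1 - 1 = - a / 2 - 2" by simp
  ultimately have d1: "((\<lambda>t. q t powr (- a / 2 - 1)) has_real_derivative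
        ((- a / 2 - 1) * q t powr (- a / 2 - 2) * (2 * (z \<bullet> e) + 2 * t))) (at t)" by metis
  have "((\<lambda>t. 2 * (z \<bullet> e) + 2 * t) has_real_derivative 2) (at t)" by (auto intro!: derivative_eq_intros)
  from DERIV_mult[OF DERIV_cmult[OF d1, of "- a / 2"] this]
  show "((\<lambda>t. - a / 2 * q t powr (- a / 2 - 1) * (2 * (z \<bullet> e) + 2 * t)) has_real_derivative
        (a * (a + 2) * q t powr (- a / 2 - 2) * (z \<bullet> e + t)\<^sup>2 - a * q t powr (- a / 2 - 1))) (at t)"
    by (rule DERIV_cong) (simp add: power2_eq_square field_simps)
qed

lemma norm_powr_second_deriv_bound:
  fixes z e :: "'a::real_inner"
  assumes e: "norm e = 1" and a: "a > 0" and \<rho>: "\<rho> > 0" "\<rho> \<le> norm (z + t *\<^sub>R e)"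
  defines "q \<equiv> z \<bullet> z + 2 * t * (z \<bullet> e) + t\<^sup>2"
  shows "\<bar>a * (a + 2) * q powr (- a / 2 - 2) * (z \<bullet> e + t)\<^sup>2 - a * q powr (- a / 2 - 1)\<bar>
    \<le> a * (a + 3) * \<rho> powr (- (a + 2))"
proof -
  have nz: "z + t *\<^sub>R e \<noteq> 0" using \<rho> by auto
  have q: "q > 0" unfolding q_def by (rule norm_powr_line_derivs(2)[OF e nz])
  have pw: "q powr (- a / 2 - 1) = norm (z + t *\<^sub>R e) powr (- (a + 2))"
  proof -
    have "- a / 2 - 1 = - (a + 2) / 2" by (simp add: field_simps)
    then show ?thesis by (simp only: q_def norm_powr_line_derivs(1)[OF e nz])
  qed
  have qn: "q = norm (z + t *\<^sub>R e) ^ 2"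
  proof -
    have "e \<bullet> e = 1" using e by (simp add: norm_eq_1)
    moreover have "norm (z + t *\<^sub>R e) ^ 2 = z \<bullet> z + 2 * t * (z \<bullet> e) + t * t * (e \<bullet> e)"
      unfolding power2_norm_eq_inner by (simp add: inner_add_left inner_add_right inner_commute algebra_simps)
    ultimately show ?thesis by (simp add: q_def power2_eq_square)
  qed
  have "z \<bullet> e + t = (z + t *\<^sub>R e) \<bullet> e" using e by (simp add: inner_add_left norm_eq_1)
  then have "\<bar>z \<bullet> e + t\<bar> \<le> norm (z + t *\<^sub>R e)" using Cauchy_Schwarz_ineq2[of "z + t *\<^sub>R e" e] e by simp
  then have "(z \<bullet> e + t)\<^sup>2 \<le> q" unfolding qn by (metis abs_ge_zero power2_abs power_mono)
  then have "q powr (- a / 2 - 2) * (z \<bullet> e + t)\<^sup>2 \<le> q powr (- a / 2 - 2) * q" by (intro mult_left_mono) auto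
  also have "\<dots> = q powr (- a / 2 - 1)"
  proof -
    have "- a / 2 - 1 = (- a / 2 - 2) + 1" by simp
    then show ?thesis using q by (simp only: powr_add powr_one)
  qed
  finally have "a * (a + 2) * (q powr (- a / 2 - 2) * (z \<bullet> e + t)\<^sup>2) \<le> a * (a + 2) * q powr (- a / 2 - 1)"
    using a by (intro mult_left_mono) auto
  moreover have "0 \<le> a * (a + 2) * (q powr (- a / 2 - 2) * (z \<bullet> e + t)\<^sup>2)" using a by simp
  moreover have "0 \<le> a * q powr (- a / 2 - 1)" using a by simp
  ultimately have "\<bar>a * (a + 2) * q powr (- a / 2 - 2) * (z \<bullet> e + t)\<^sup>2 - a * q powr (- a / 2 - 1)\<bar>
      \<le> a * (a + 3) * q powr (- a / 2 - 1)"
    by (simp add: algebra_simps abs_le_iff)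
  also have "\<dots> \<le> a * (a + 3) * \<rho> powr (- (a + 2))"
    unfolding pw using a \<rho> by (intro mult_left_mono powr_mono2') auto
  finally show ?thesis .
qed

text \<open>This bound does not depend on the step \<open>h\<close>, so it dominates the difference quotients of a
  potential under the integral sign.\<close>

lemma norm_powr_second_difference_bound:
  fixes z e :: "'a::real_inner"
  assumes e: "norm e = 1" and a: "a > 0" and \<rho>: "\<rho> > 0" and h: "h > 0"
    and away: "\<And>t. \<bar>t\<bar> \<le> h \<Longrightarrow> \<rho> \<le> norm (z + t *\<^sub>R e)"
  shows "\<bar>norm (z + h *\<^sub>R e) powr (- a) + norm (z - h *\<^sub>R e) powr (- a) - 2 * norm z powr (- a)\<bar>
    \<le> h\<^sup>2 * (a * (a + 3) * \<rho> powr (- (a + 2)))"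
proof -
  define q where "q t = z \<bullet> z + 2 * t * (z \<bullet> e) + t\<^sup>2" for t
  define p'' where "p'' t = a * (a + 2) * q t powr (- a / 2 - 2) * (z \<bullet> e + t)\<^sup>2 - a * q t powr (- a / 2 - 1)" for t
  have nz: "z + t *\<^sub>R e \<noteq> 0" if "\<bar>t\<bar> \<le> h" for t using away[OF that] \<rho> by auto
  have D1: "((\<lambda>t. q t powr (- a / 2)) has_real_derivative (- a / 2 * q t powr (- a / 2 - 1) * (2 * (z \<bullet> e) + 2 * t))) (at t)"
    if "\<bar>t\<bar> \<le> h" for t unfolding q_def by (rule norm_powr_line_derivs(3)[OF e nz[OF that]])
  have D2: "((\<lambda>t. - a / 2 * q t powr (- a / 2 - 1) * (2 * (z \<bullet> e) + 2 * t)) has_real_derivative p'' t) (at t)"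
    if "\<bar>t\<bar> \<le> h" for t unfolding q_def p''_def by (rule norm_powr_line_derivs(4)[OF e nz[OF that]])
  obtain t1 t2 where t: "\<bar>t1\<bar> \<le> h" "\<bar>t2\<bar> \<le> h"
    and eq: "q h powr (- a / 2) + q (- h) powr (- a / 2) - 2 * q 0 powr (- a / 2) = h\<^sup>2 * ((p'' t1 + p'' t2) / 2)"
    by (rule second_difference[OF D1 D2 h]) (assumption, assumption, (rule that; assumption))
  have b: "\<bar>p'' t\<bar> \<le> a * (a + 3) * \<rho> powr (- (a + 2))" if "\<bar>t\<bar> \<le> h" for t
    unfolding p''_def q_def by (rule norm_powr_second_deriv_bound[OF e a \<rho> away[OF that]])
  have n: "norm (z + t *\<^sub>R e) powr (- a) = q t powr (- a / 2)" if "\<bar>t\<bar> \<le> h" for t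
    unfolding q_def by (rule norm_powr_line_derivs(1)[OF e nz[OF that]])
  have "norm (z + h *\<^sub>R e) powr (- a) + norm (z - h *\<^sub>R e) powr (- a) - 2 * norm z powr (- a)
      = h\<^sup>2 * ((p'' t1 + p'' t2) / 2)"
    using n[of h] n[of "- h"] n[of 0] h eq by simp
  also have "\<bar>\<dots>\<bar> = h\<^sup>2 * \<bar>(p'' t1 + p'' t2) / 2\<bar>" by (simp add: abs_mult)
  also have "\<dots> \<le> h\<^sup>2 * (a * (a + 3) * \<rho> powr (- (a + 2)))"
    using b[OF t(1)] b[OF t(2)] by (intro mult_left_mono) (auto simp: abs_le_iff)
  finally show ?thesis .
qed

text \<open>Summed over an orthonormal basis, these limits become the Laplacian of \<open>|z|\<close> to the power
  \<open>-a\<close>, namely \<open>a (a + 2 - N)\<close> times \<open>|z|\<close> to the power \<open>-a - 2\<close>.\<close>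

lemma norm_powr_second_difference_tendsto:
  fixes z e :: "'a::real_inner"
  assumes e: "norm e = 1" and z: "z \<noteq> 0"
    and h: "\<And>n. h n > 0" "h \<longlonglongrightarrow> 0"
  shows "(\<lambda>n. (norm (z + h n *\<^sub>R e) powr (- a) + norm (z - h n *\<^sub>R e) powr (- a) - 2 * norm z powr (- a)) / (h n)\<^sup>2)
    \<longlonglongrightarrow> a * (a + 2) * norm z powr (- (a + 4)) * (z \<bullet> e)\<^sup>2 - a * norm z powr (- (a + 2))"
proof -
  define q where "q t = z \<bullet> z + 2 * t * (z \<bullet> e) + t\<^sup>2" for t
  define p'' where "p'' t = a * (a + 2) * q t powr (- a / 2 - 2) * (z \<bullet> e + t)\<^sup>2 - a * q t powr (- a / 2 - 1)" for t
  have q0: "q 0 > 0" using z by (simp add: q_def)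
  have pw: "q 0 powr (- b / 2) = norm z powr (- b)" for b
    unfolding q_def using norm_powr_line_derivs(1)[OF e, of z 0 b] z by simp
  have "isCont q 0" unfolding q_def by (intro continuous_intros)
  then have cont: "isCont p'' 0" unfolding p''_def using q0 by (intro continuous_intros) auto
  have p0: "p'' 0 = a * (a + 2) * norm z powr (- (a + 4)) * (z \<bullet> e)\<^sup>2 - a * norm z powr (- (a + 2))"
  proof -
    have "- a / 2 - 2 = - (a + 4) / 2" "- a / 2 - 1 = - (a + 2) / 2" by (simp_all add: field_simps)
    then show ?thesis by (simp only: p''_def pw add_0_right)
  qed
  let ?Q = "\<lambda>n. (norm (z + h n *\<^sub>R e) powr (- a) + norm (z - h n *\<^sub>R e) powr (- a) - 2 * norm z powr (- a)) / (h n)\<^sup>2"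
  have nz: "z + t *\<^sub>R e \<noteq> 0" if "\<bar>t\<bar> \<le> norm z / 2" for t
  proof
    assume "z + t *\<^sub>R e = 0"
    then have "z = - (t *\<^sub>R e)" by (simp add: eq_neg_iff_add_eq_0)
    then have "norm z = \<bar>t\<bar>" using e by (metis norm_minus_cancel norm_scaleR mult.right_neutral)
    then show False using that z by simp
  qed
  have ex: "\<exists>t. \<bar>fst t\<bar> \<le> h n \<and> \<bar>snd t\<bar> \<le> h n \<and> ?Q n = (p'' (fst t) + p'' (snd t)) / 2" if hn: "h n \<le> norm z / 2" for n
  proof -
    have nz': "z + t *\<^sub>R e \<noteq> 0" if "\<bar>t\<bar> \<le> h n" for t using nz that hn by simp
    have D1: "((\<lambda>t. q t powr (- a / 2)) has_real_derivative (- a / 2 * q t powr (- a / 2 - 1) * (2 * (z \<bullet> e) + 2 * t))) (at t)"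
      if "\<bar>t\<bar> \<le> h n" for t unfolding q_def by (rule norm_powr_line_derivs(3)[OF e nz'[OF that]])
    have D2: "((\<lambda>t. - a / 2 * q t powr (- a / 2 - 1) * (2 * (z \<bullet> e) + 2 * t)) has_real_derivative p'' t) (at t)"
      if "\<bar>t\<bar> \<le> h n" for t unfolding q_def p''_def by (rule norm_powr_line_derivs(4)[OF e nz'[OF that]])
    obtain t1 t2 where t: "\<bar>t1\<bar> \<le> h n" "\<bar>t2\<bar> \<le> h n"
      and eq: "q (h n) powr (- a / 2) + q (- h n) powr (- a / 2) - 2 * q 0 powr (- a / 2) = (h n)\<^sup>2 * ((p'' t1 + p'' t2) / 2)"
      by (rule second_difference[OF D1 D2 h(1)]) (assumption, assumption, (rule that; assumption))
    have nn: "norm (z + t *\<^sub>R e) powr (- a) = q t powr (- a / 2)" if "\<bar>t\<bar> \<le> h n" for t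
      unfolding q_def by (rule norm_powr_line_derivs(1)[OF e nz'[OF that]])
    have "?Q n = (p'' t1 + p'' t2) / 2"
      using nn[of "h n"] nn[of "- h n"] nn[of 0] h(1)[of n] eq by simp
    then show ?thesis using t by (intro exI[of _ "(t1, t2)"]) simp
  qed
  have "\<forall>\<^sub>F n in sequentially. h n < norm z / 2" using h(2) z by (intro order_tendstoD(2)) auto
  then obtain N where N: "\<And>n. n \<ge> N \<Longrightarrow> h n \<le> norm z / 2"
    by (auto simp: eventually_sequentially intro: less_imp_le)
  then obtain t where t: "\<And>n. n \<ge> N \<Longrightarrow> \<bar>fst (t n)\<bar> \<le> h n \<and> \<bar>snd (t n)\<bar> \<le> h n \<and> ?Q n = (p'' (fst (t n)) + p'' (snd (t n))) / 2"
    using ex by metis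
  have ev: "\<forall>\<^sub>F n in sequentially. n \<ge> N" by (rule eventually_ge_at_top)
  have "(\<lambda>n. fst (t n)) \<longlonglongrightarrow> 0"
    by (rule Lim_null_comparison[OF eventually_mono[OF ev] h(2)]) (simp add: t)
  moreover have "(\<lambda>n. snd (t n)) \<longlonglongrightarrow> 0"
    by (rule Lim_null_comparison[OF eventually_mono[OF ev] h(2)]) (simp add: t)
  ultimately have "(\<lambda>n. (p'' (fst (t n)) + p'' (snd (t n))) / 2) \<longlonglongrightarrow> (p'' 0 + p'' 0) / 2"
    using isCont_tendsto_compose[OF cont] by (intro tendsto_intros) auto
  then have "(\<lambda>n. (p'' (fst (t n)) + p'' (snd (t n))) / 2) \<longlonglongrightarrow> p'' 0" by simp
  then have "?Q \<longlonglongrightarrow> p'' 0"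
    by (rule Lim_transform_eventually) (rule eventually_mono[OF ev], simp add: t)
  then show ?thesis by (simp only: p0)
qed

section \<open>Unique continuation for Riesz potentials\<close>

text \<open>Closes both density arguments below, where uniform approximation up to \<open>e\<close> costs \<open>e\<close> times an
  \<open>L\<^sup>1\<close> norm \<open>C\<close>.\<close>

lemma eq_0_if_abs_le_all_multiples:
  fixes I C :: real
  assumes "\<And>e. e > 0 \<Longrightarrow> \<bar>I\<bar> \<le> e * C" "C \<ge> 0"
  shows "I = 0"
proof (rule ccontr)
  assume "I \<noteq> 0"
  then have "\<bar>I\<bar> \<le> \<bar>I\<bar> / (C + 1) * C" using assms(2) by (intro assms(1)) simp
  then have "\<bar>I\<bar> * (C + 1) \<le> \<bar>I\<bar> * C" using assms(2) by (simp add: field_simps)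
  then show False using \<open>I \<noteq> 0\<close> by (simp add: algebra_simps)
qed

text \<open>For \<open>R = |y - x0|\<close> with \<open>y\<close> outside the ball of radius \<open>2 r\<close> about \<open>x0\<close>: points of the ball of radius
  \<open>r\<close> have distance at least \<open>R / 2\<close> from \<open>y\<close>, so this compares kernels centred at different points.\<close>

lemma half_powr_comparison:
  fixes R r a b :: real
  assumes "r > 0" "2 * r \<le> R" "a \<le> b"
  shows "(R / 2) powr (- b) \<le> 2 powr b * (2 * r) powr (a - b) * R powr (- a)"
proof -
  have R: "R > 0" using assms by simp
  have "(R / 2) powr (- b) = 2 powr b * R powr (- b)"
    using R by (simp add: powr_divide powr_minus_divide)
  also have "R powr (- b) = R powr (a - b) * R powr (- a)" by (simp add: powr_add[symmetric])
  also have "R powr (a - b) \<le> (2 * r) powr (a - b)" using assms by (intro powr_mono2') auto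
  finally show ?thesis using R by (simp add: mult.assoc mult_left_mono mult_right_mono)
qed

text \<open>A source \<open>g\<close> that is absent from the ball of radius \<open>2 r\<close> about \<open>x0\<close>, to be observed from the ball
  of radius \<open>r\<close>, where its potentials are smooth. Integrability against the kernel centred at \<open>x0\<close>
  gives integrability against all steeper kernels centred at observation points.\<close>

locale far_source =
  fixes g :: "'a::euclidean_space \<Rightarrow> real" and x0 :: 'a and r a :: real
  assumes r: "r > 0" and a: "a > 0"
    and g_measurable: "g \<in> borel_measurable lebesgue"
    and g_far: "dist y x0 < 2 * r \<Longrightarrow> g y = 0"
    and g_integrable: "integrable lebesgue (\<lambda>y. g y * norm (y - x0) powr (- a))"
begin

lemma half_dist_le:
  assumes "g y \<noteq> 0" "dist x x0 \<le> r"
  shows "norm (y - x0) / 2 \<le> norm (x - y)" "2 * r \<le> norm (y - x0)"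
proof -
  show *: "2 * r \<le> norm (y - x0)" using g_far[of y] assms(1) by (force simp: dist_norm)
  have "norm (y - x0) \<le> norm (y - x) + norm (x - x0)" using norm_triangle_ineq[of "y - x" "x - x0"] by simp
  then show "norm (y - x0) / 2 \<le> norm (x - y)" using * assms(2) by (simp add: dist_norm norm_minus_commute)
qed

lemma kernel_measurable: "(\<lambda>y. norm (x - y) powr c) \<in> borel_measurable lebesgue" for x :: 'a
  by (intro lebesgue_measurable_borel) measurable

lemma kernel_bound:
  assumes x: "dist x x0 \<le> r" and b: "a \<le> b"
  shows "\<bar>g y * norm (x - y) powr (- b)\<bar> \<le> 2 powr b * (2 * r) powr (a - b) * \<bar>g y * norm (y - x0) powr (- a)\<bar>"
proof (cases "g y = 0")
  case False
  note h = half_dist_le[OF False x]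
  have "norm (x - y) powr (- b) \<le> (norm (y - x0) / 2) powr (- b)"
    using h r a b by (intro powr_mono2') auto
  also have "\<dots> \<le> 2 powr b * (2 * r) powr (a - b) * norm (y - x0) powr (- a)" by (rule half_powr_comparison[OF r h(2) b])
  finally have "\<bar>g y\<bar> * norm (x - y) powr (- b) \<le> \<bar>g y\<bar> * (2 powr b * (2 * r) powr (a - b) * norm (y - x0) powr (- a))"
    by (intro mult_left_mono) auto
  then show ?thesis by (simp add: abs_mult mult.commute mult.left_commute)
qed simp

lemma integrable_kernel:
  assumes x: "dist x x0 \<le> r" and b: "a \<le> b"
  shows "integrable lebesgue (\<lambda>y. g y * norm (x - y) powr (- b))"
proof (rule Bochner_Integration.integrable_bound)
  let ?c = "2 powr b * (2 * r) powr (a - b)"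
  show "integrable lebesgue (\<lambda>y. ?c * \<bar>g y * norm (y - x0) powr (- a)\<bar>)" using g_integrable by simp
  show "(\<lambda>y. g y * norm (x - y) powr (- b)) \<in> borel_measurable lebesgue"
    by (intro borel_measurable_times g_measurable kernel_measurable)
  show "AE y in lebesgue. norm (g y * norm (x - y) powr (- b)) \<le> norm (?c * \<bar>g y * norm (y - x0) powr (- a)\<bar>)"
    using kernel_bound[OF x b] by (intro AE_I2) (metis abs_ge_self order_trans real_norm_def)
qed

lemma potential_continuous:
  assumes x: "dist x x0 < r"
  shows "isCont (\<lambda>x. \<integral>y. g y * norm (x - y) powr (- a) \<partial>lebesgue) x"
  unfolding continuous_at_sequentially o_def
proof (intro allI impI)
  fix X :: "nat \<Rightarrow> 'a" assume X: "X \<longlonglongrightarrow> x"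
  have "(\<lambda>n. dist (X n) x0) \<longlonglongrightarrow> dist x x0" by (intro tendsto_intros X)
  then have "\<forall>\<^sub>F n in sequentially. dist (X n) x0 < r" using x by (rule order_tendstoD(2))
  then obtain N where N: "\<And>n. n \<ge> N \<Longrightarrow> dist (X n) x0 < r" by (auto simp: eventually_sequentially)
  have XN: "(\<lambda>n. X (n + N)) \<longlonglongrightarrow> x" using X by (rule LIMSEQ_ignore_initial_segment)
  have "(\<lambda>n. \<integral>y. g y * norm (X (n + N) - y) powr (- a) \<partial>lebesgue) \<longlonglongrightarrow> (\<integral>y. g y * norm (x - y) powr (- a) \<partial>lebesgue)"
  proof (rule integral_dominated_convergence)
    show "(\<lambda>y. g y * norm (z - y) powr (- a)) \<in> borel_measurable lebesgue" for z
      by (intro borel_measurable_times g_measurable kernel_measurable)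
    then show "(\<lambda>y. g y * norm (X (n + N) - y) powr (- a)) \<in> borel_measurable lebesgue" for n .
    show "integrable lebesgue (\<lambda>y. 2 powr a * (2 * r) powr (a - a) * \<bar>g y * norm (y - x0) powr (- a)\<bar>)"
      by (intro integrable_mult_right integrable_abs g_integrable)
    show "AE y in lebesgue. norm (g y * norm (X (n + N) - y) powr (- a)) \<le> 2 powr a * (2 * r) powr (a - a) * \<bar>g y * norm (y - x0) powr (- a)\<bar>" for n
      unfolding real_norm_def using N[of "n + N"] by (intro AE_I2 kernel_bound) auto
    show "AE y in lebesgue. (\<lambda>n. g y * norm (X (n + N) - y) powr (- a)) \<longlonglongrightarrow> g y * norm (x - y) powr (- a)"
    proof (rule AE_I2)
      fix y
      show "(\<lambda>n. g y * norm (X (n + N) - y) powr (- a)) \<longlonglongrightarrow> g y * norm (x - y) powr (- a)"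
      proof (cases "g y = 0")
        case False
        then have "norm (x - y) \<noteq> 0" using half_dist_le[OF False less_imp_le[OF x]] r by auto
        then show ?thesis by (intro tendsto_intros XN) simp
      qed simp
    qed
  qed
  then show "(\<lambda>n. \<integral>y. g y * norm (X n - y) powr (- a) \<partial>lebesgue) \<longlonglongrightarrow> (\<integral>y. g y * norm (x - y) powr (- a) \<partial>lebesgue)"
    by (rule LIMSEQ_offset)
qed

text \<open>The Laplacian of a potential that vanishes on a ball vanishes there as well, and the Laplacian raises
  the exponent \<open>b\<close> to \<open>b + 2\<close> at the cost of the factor \<open>b (b + 2 - N)\<close>. Differentiation under the
  integral is done by second difference quotients, which are integrals of zero potentials.\<close>

lemma laplacian_step:
  assumes zero: "\<And>x. dist x x0 < r \<Longrightarrow> (\<integral>y. g y * norm (x - y) powr (- b) \<partial>lebesgue) = 0"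
    and b: "a \<le> b" "b + 2 \<noteq> real DIM('a)" and x: "dist x x0 < r"
  shows "(\<integral>y. g y * norm (x - y) powr (- (b + 2)) \<partial>lebesgue) = 0"
proof -
  \<comment> \<open>Steps so small that all points \<open>x + t e\<close> with \<open>\<bar>t\<bar> \<le> h n\<close> stay in the observation ball.\<close>
  define h where "h n = (r - dist x x0) / 2 * (1 / real (Suc n))" for n
  have h0: "h n > 0" for n using x by (simp add: h_def)
  have h_le: "h n \<le> (r - dist x x0) / 2" for n
    using x unfolding h_def by (intro mult_left_le) auto
  have h_lim: "h \<longlonglongrightarrow> 0"
    unfolding h_def by (rule tendsto_eq_rhs[OF tendsto_mult[OF tendsto_const LIMSEQ_Suc[OF lim_1_over_n]]]) simp
  have near: "dist (x + t *\<^sub>R e) x0 < r" if "norm e = 1" "\<bar>t\<bar> \<le> h n" for t n and e :: 'a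
  proof -
    have "norm ((x - x0) + t *\<^sub>R e) \<le> norm (x - x0) + \<bar>t\<bar>" using norm_triangle_ineq[of "x - x0" "t *\<^sub>R e"] that by simp
    also have "\<dots> \<le> dist x x0 + (r - dist x x0) / 2" using that(2) h_le[of n] by (simp add: dist_norm)
    also have "\<dots> < r" using x by (simp add: field_simps)
    finally show ?thesis by (simp add: dist_norm algebra_simps)
  qed
  define Q where "Q n e y = (norm (x - y + h n *\<^sub>R e) powr (- b) + norm (x - y - h n *\<^sub>R e) powr (- b)
      - 2 * norm (x - y) powr (- b)) / (h n)\<^sup>2" for n and e y :: 'a
  define T where "T n y = (\<Sum>e\<in>Basis. Q n e y)" for n y
  define K where "K = real DIM('a) * (b * (b + 3) * (2 powr (b + 2) * (2 * r) powr (a - (b + 2))))"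
  have Qint: "integrable lebesgue (\<lambda>y. g y * Q n e y)" "(\<integral>y. g y * Q n e y \<partial>lebesgue) = 0" if e: "e \<in> Basis" for n e
  proof -
    have e1: "norm e = 1" using e by simp
    have d: "dist (x + h n *\<^sub>R e) x0 < r" "dist (x - h n *\<^sub>R e) x0 < r"
      using near[OF e1, of "h n" n] near[OF e1, of "- h n" n] h0[of n] by auto
    note i = integrable_kernel[OF less_imp_le[OF d(1)] b(1)] integrable_kernel[OF less_imp_le[OF d(2)] b(1)]
      integrable_kernel[OF less_imp_le[OF x] b(1)]
    have eq: "(\<lambda>y. g y * Q n e y) = (\<lambda>y. (g y * norm (x + h n *\<^sub>R e - y) powr (- b) + g y * norm (x - h n *\<^sub>R e - y) powr (- b)
        - 2 * (g y * norm (x - y) powr (- b))) / (h n)\<^sup>2)"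
    proof
      fix y
      have "x - y + h n *\<^sub>R e = x + h n *\<^sub>R e - y" "x - y - h n *\<^sub>R e = x - h n *\<^sub>R e - y" by simp_all
      then show "g y * Q n e y = (g y * norm (x + h n *\<^sub>R e - y) powr (- b) + g y * norm (x - h n *\<^sub>R e - y) powr (- b)
        - 2 * (g y * norm (x - y) powr (- b))) / (h n)\<^sup>2"
        unfolding Q_def by (simp only: times_divide_eq_right) (simp add: algebra_simps)
    qed
    show "integrable lebesgue (\<lambda>y. g y * Q n e y)" unfolding eq using i by simp
    show "(\<integral>y. g y * Q n e y \<partial>lebesgue) = 0" unfolding eq using i zero[OF d(1)] zero[OF d(2)] zero[OF x] by simp
  qed
  have Tint: "(\<integral>y. g y * T n y \<partial>lebesgue) = 0" for n
    unfolding T_def sum_distrib_left using Qint by (subst Bochner_Integration.integral_sum) auto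
  have bound: "norm (g y * T n y) \<le> K * \<bar>g y * norm (y - x0) powr (- a)\<bar>" for n y
  proof (cases "g y = 0")
    case False
    define \<rho> where "\<rho> = norm (y - x0) / 2"
    have \<rho>: "\<rho> > 0" "2 * r \<le> norm (y - x0)" using half_dist_le(2)[OF False, of x] x r by (auto simp: \<rho>_def)
    have "\<bar>Q n e y\<bar> \<le> b * (b + 3) * \<rho> powr (- (b + 2))" if e: "e \<in> Basis" for e
    proof -
      have e1: "norm e = 1" using e by simp
      have "\<rho> \<le> norm (x - y + t *\<^sub>R e)" if "\<bar>t\<bar> \<le> h n" for t
        using half_dist_le(1)[OF False less_imp_le[OF near[OF e1 that]]] by (simp add: \<rho>_def algebra_simps)
      from norm_powr_second_difference_bound[OF e1 _ \<rho>(1) h0 this, of b] a b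
      have "\<bar>Q n e y\<bar> * (h n)\<^sup>2 \<le> (h n)\<^sup>2 * (b * (b + 3) * \<rho> powr (- (b + 2)))"
        using h0[of n] by (simp add: Q_def abs_mult)
      then show ?thesis using h0[of n] by (simp add: mult.commute)
    qed
    then have "\<bar>T n y\<bar> \<le> (\<Sum>e\<in>(Basis::'a set). b * (b + 3) * \<rho> powr (- (b + 2)))"
      unfolding T_def by (intro order_trans[OF sum_abs] sum_mono)
    also have "\<dots> = real DIM('a) * (b * (b + 3) * \<rho> powr (- (b + 2)))" by simp
    also have "\<dots> \<le> real DIM('a) * (b * (b + 3) * (2 powr (b + 2) * (2 * r) powr (a - (b + 2)) * norm (y - x0) powr (- a)))"
      unfolding \<rho>_def using a b by (intro mult_left_mono half_powr_comparison r \<rho>) auto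
    finally have "\<bar>T n y\<bar> \<le> K * norm (y - x0) powr (- a)" by (simp add: K_def mult.assoc)
    from mult_left_mono[OF this abs_ge_zero[of "g y"]]
    show ?thesis by (simp add: abs_mult mult.left_commute)
  qed simp
  define c where "c = b * (b + 2 - real DIM('a))"
  have lim: "(\<lambda>n. g y * T n y) \<longlonglongrightarrow> g y * (c * norm (x - y) powr (- (b + 2)))" for y
  proof (cases "g y = 0")
    case False
    define z where "z = x - y"
    have z: "z \<noteq> 0" using half_dist_le[OF False less_imp_le[OF x]] r by (auto simp: z_def)
    have "(\<lambda>n. T n y) \<longlonglongrightarrow> (\<Sum>e\<in>Basis. b * (b + 2) * norm z powr (- (b + 4)) * (z \<bullet> e)\<^sup>2 - b * norm z powr (- (b + 2)))"
      unfolding T_def Q_def z_def[symmetric]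
      by (intro tendsto_sum norm_powr_second_difference_tendsto z h0 h_lim) simp
    also have "(\<Sum>e\<in>Basis. b * (b + 2) * norm z powr (- (b + 4)) * (z \<bullet> e)\<^sup>2 - b * norm z powr (- (b + 2)))
        = b * (b + 2) * norm z powr (- (b + 4)) * (\<Sum>e\<in>Basis. (z \<bullet> e)\<^sup>2) - real DIM('a) * (b * norm z powr (- (b + 2)))"
      by (simp add: sum_subtractf sum_distrib_left)
    also have "(\<Sum>e\<in>Basis. (z \<bullet> e)\<^sup>2) = z \<bullet> z"
      by (subst euclidean_inner) (simp add: power2_eq_square)
    also have "\<dots> = norm z powr 2" using z by (simp add: powr_numeral dot_square_norm)
    also have "b * (b + 2) * norm z powr (- (b + 4)) * norm z powr 2 = b * (b + 2) * norm z powr (- (b + 2))"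
    proof -
      have "norm z powr (- (b + 4)) * norm z powr 2 = norm z powr (- (b + 2))"
        by (subst powr_add[symmetric], rule arg_cong[where f = "\<lambda>c. norm z powr c"]) simp
      then show ?thesis by (simp only: mult.assoc)
    qed
    finally have "(\<lambda>n. T n y) \<longlonglongrightarrow> c * norm z powr (- (b + 2))" by (simp add: c_def algebra_simps)
    then show ?thesis unfolding z_def by (intro tendsto_mult tendsto_const)
  qed simp
  have "(\<lambda>n. \<integral>y. g y * T n y \<partial>lebesgue) \<longlonglongrightarrow> (\<integral>y. g y * (c * norm (x - y) powr (- (b + 2))) \<partial>lebesgue)"
  proof (rule integral_dominated_convergence)
    show "(\<lambda>y. g y * (c * norm (x - y) powr (- (b + 2)))) \<in> borel_measurable lebesgue"
      by (intro borel_measurable_times g_measurable kernel_measurable borel_measurable_const)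
    show "(\<lambda>y. g y * T n y) \<in> borel_measurable lebesgue" for n
      unfolding T_def sum_distrib_left using Qint(1) by (intro borel_measurable_sum borel_measurable_integrable)
    show "integrable lebesgue (\<lambda>y. K * \<bar>g y * norm (y - x0) powr (- a)\<bar>)" using g_integrable by simp
    show "AE y in lebesgue. (\<lambda>n. g y * T n y) \<longlonglongrightarrow> g y * (c * norm (x - y) powr (- (b + 2)))" using lim by simp
    show "AE y in lebesgue. norm (g y * T n y) \<le> K * \<bar>g y * norm (y - x0) powr (- a)\<bar>" for n using bound by simp
  qed
  then have "(\<integral>y. g y * (c * norm (x - y) powr (- (b + 2))) \<partial>lebesgue) = 0"
    by (simp add: Tint LIMSEQ_const_iff)
  moreover have "(\<integral>y. g y * (c * norm (x - y) powr (- (b + 2))) \<partial>lebesgue) = c * (\<integral>y. g y * norm (x - y) powr (- (b + 2)) \<partial>lebesgue)"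
    by (simp add: mult.left_commute[of _ c])
  moreover have "c \<noteq> 0" using a b by (simp add: c_def)
  ultimately show ?thesis by simp
qed

lemma kernel_moments_eq_0:
  assumes zero: "\<And>x. dist x x0 < r \<Longrightarrow> (\<integral>y. g y * norm (x - y) powr (- a) \<partial>lebesgue) = 0"
    and dim: "a + 2 > real DIM('a)" and x: "dist x x0 < r"
  shows "(\<integral>y. g y * norm (x - y) powr (- (a + 2 * real k)) \<partial>lebesgue) = 0"
  using x
proof (induction k arbitrary: x)
  case 0
  then show ?case using zero by simp
next
  case (Suc k)
  have "(\<integral>y. g y * norm (x - y) powr (- (a + 2 * real k + 2)) \<partial>lebesgue) = 0"
    using Suc dim by (intro laplacian_step) auto
  then show ?case by (simp add: algebra_simps)
qed

text \<open>The powers \<open>(1 / |x - y|\<^sup>2)\<^sup>k\<close> have zero integral against the source times the kernel. By the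
  Weierstrass theorem so has every continuous function of \<open>1 / |x - y|\<^sup>2\<close>, a variable that ranges
  over the compact interval from \<open>0\<close> to \<open>1 / r\<^sup>2\<close>.\<close>

lemma radial_integrals_eq_0:
  assumes zero: "\<And>x. dist x x0 < r \<Longrightarrow> (\<integral>y. g y * norm (x - y) powr (- a) \<partial>lebesgue) = 0"
    and dim: "a + 2 > real DIM('a)" and x: "dist x x0 < r"
    and \<psi>: "continuous_on {0..1 / r\<^sup>2} \<psi>" "\<psi> \<in> borel_measurable borel"
  shows "integrable lebesgue (\<lambda>y. g y * norm (x - y) powr (- a) * \<psi> (1 / norm (x - y) ^ 2))" (is ?int)
    and "(\<integral>y. g y * norm (x - y) powr (- a) * \<psi> (1 / norm (x - y) ^ 2) \<partial>lebesgue) = 0" (is ?zero)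
proof -
  define k where "k y = g y * norm (x - y) powr (- a)" for y
  define t where "t y = 1 / norm (x - y) ^ 2" for y
  have k: "integrable lebesgue k" unfolding k_def by (rule integrable_kernel) (use x in auto)
  have t_range: "t y \<in> {0..1 / r\<^sup>2}" if "k y \<noteq> 0" for y
  proof -
    have "g y \<noteq> 0" using that by (auto simp: k_def)
    from half_dist_le[OF this, of x] x have "r \<le> norm (x - y)" by simp
    then have "r\<^sup>2 \<le> norm (x - y) ^ 2" using r by (intro power_mono) auto
    then have "1 / norm (x - y) ^ 2 \<le> 1 / r\<^sup>2" using r by (intro frac_le) auto
    then show ?thesis by (simp add: t_def)
  qed
  have tm: "t \<in> borel_measurable borel" unfolding t_def by measurable
  have \<psi>t: "(\<lambda>y. \<psi> (t y)) \<in> borel_measurable lebesgue"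
    by (rule lebesgue_measurable_borel) (rule measurable_compose[OF tm \<psi>(2)])
  have poly: "integrable lebesgue (\<lambda>y. k y * (\<Sum>i\<le>n. c i * t y ^ i)) \<and> (\<integral>y. k y * (\<Sum>i\<le>n. c i * t y ^ i) \<partial>lebesgue) = 0" for c and n :: nat
  proof -
    have eq: "k y * (c i * t y ^ i) = c i * (g y * norm (x - y) powr (- (a + 2 * real i)))" for y i
    proof (cases "g y = 0")
      case False
      then have p: "norm (x - y) > 0" using half_dist_le[OF False, of x] x r by auto
      have "norm (x - y) powr (- (a + 2 * real i)) = norm (x - y) powr (- a) * norm (x - y) powr (- (2 * real i))"
        by (simp add: powr_add[symmetric])
      also have "norm (x - y) powr (- (2 * real i)) = t y ^ i"
        using p powr_realpow[OF p, of "2 * i"] by (simp add: t_def powr_minus power_mult power_one_over divide_inverse power_inverse)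
      finally show ?thesis by (simp add: k_def)
    qed (simp add: k_def)
    have "integrable lebesgue (\<lambda>y. g y * norm (x - y) powr (- (a + 2 * real i)))" for i
      by (rule integrable_kernel) (use x in auto)
    then show ?thesis
      unfolding sum_distrib_left eq using kernel_moments_eq_0[OF zero dim x]
      by (simp add: Bochner_Integration.integral_sum)
  qed
  have "bounded (\<psi> ` {0..1 / r\<^sup>2})"
    by (intro compact_imp_bounded compact_continuous_image \<psi>) auto
  then obtain M where M': "\<forall>s\<in>{0..1 / r\<^sup>2}. \<bar>\<psi> s\<bar> \<le> M" by (auto simp: bounded_iff)
  note M = M'[rule_format]
  have \<psi>_int: "integrable lebesgue (\<lambda>y. k y * \<psi> (t y))"
  proof (rule Bochner_Integration.integrable_bound)
    show "integrable lebesgue (\<lambda>y. M * k y)" using k by simp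
    show "(\<lambda>y. k y * \<psi> (t y)) \<in> borel_measurable lebesgue"
      using k by (intro borel_measurable_times \<psi>t) auto
    have "\<bar>k y\<bar> * \<bar>\<psi> (t y)\<bar> \<le> \<bar>M\<bar> * \<bar>k y\<bar>" for y
    proof (cases "k y = 0")
      case False
      then show ?thesis using M[OF t_range[OF False]] by (simp add: mult.commute)
    qed simp
    then show "AE y in lebesgue. norm (k y * \<psi> (t y)) \<le> norm (M * k y)" by (simp add: abs_mult)
  qed
  have "\<bar>\<integral>y. k y * \<psi> (t y) \<partial>lebesgue\<bar> \<le> e * (\<integral>y. \<bar>k y\<bar> \<partial>lebesgue)" if e: "e > 0" for e
  proof -
    obtain p where p: "real_polynomial_function p" "\<And>s. s \<in> {0..1 / r\<^sup>2} \<Longrightarrow> \<bar>\<psi> s - p s\<bar> < e"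
      by (rule Stone_Weierstrass_real_polynomial_function[OF _ \<psi>(1) e]) auto
    obtain c n where c: "p = (\<lambda>s. \<Sum>i\<le>n. c i * s ^ i)" using p(1) real_polynomial_function_iff_sum by blast
    have "(\<integral>y. k y * \<psi> (t y) \<partial>lebesgue) = (\<integral>y. k y * \<psi> (t y) - k y * p (t y) \<partial>lebesgue)"
      using poly[of c n] \<psi>_int unfolding c by simp
    also have "\<bar>\<dots>\<bar> \<le> (\<integral>y. \<bar>k y * \<psi> (t y) - k y * p (t y)\<bar> \<partial>lebesgue)"
      by (rule integral_abs_bound)
    also have "\<dots> \<le> (\<integral>y. e * \<bar>k y\<bar> \<partial>lebesgue)"
    proof (rule integral_mono)
      show "integrable lebesgue (\<lambda>y. \<bar>k y * \<psi> (t y) - k y * p (t y)\<bar>)"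
        using poly[of c n] \<psi>_int unfolding c by simp
      show "integrable lebesgue (\<lambda>y. e * \<bar>k y\<bar>)" using k by simp
      show "\<bar>k y * \<psi> (t y) - k y * p (t y)\<bar> \<le> e * \<bar>k y\<bar>" for y
      proof (cases "k y = 0")
        case False
        have "\<bar>k y * \<psi> (t y) - k y * p (t y)\<bar> = \<bar>k y\<bar> * \<bar>\<psi> (t y) - p (t y)\<bar>"
          by (simp only: right_diff_distrib[symmetric] abs_mult)
        also have "\<dots> \<le> \<bar>k y\<bar> * e" using p(2)[OF t_range[OF False]] by (intro mult_left_mono) auto
        finally show ?thesis by (simp add: mult.commute)
      qed simp
    qed
    also have "\<dots> = e * (\<integral>y. \<bar>k y\<bar> \<partial>lebesgue)" by simp
    finally show ?thesis .
  qed
  note small = this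
  have "(\<integral>y. k y * \<psi> (t y) \<partial>lebesgue) = 0"
    by (rule eq_0_if_abs_le_all_multiples[OF small]) (simp_all add: integral_nonneg_AE)
  then show ?zero by (simp add: k_def t_def)
  show ?int using \<psi>_int by (simp add: k_def t_def)
qed

end

text \<open>At \<open>t = 1 / |x - y|\<^sup>2\<close> this profile times the kernel is the Gaussian
  \<open>exp (- l |x - y|\<^sup>2)\<close>.\<close>

lemma gaussian_profile_continuous:
  fixes a l :: real
  assumes a: "a > 0" and l: "l > 0"
  shows "continuous_on {0..} (\<lambda>t. t powr (- a / 2) * exp (- l / t))"
proof (rule continuous_on_eq_continuous_within[THEN iffD2], intro ballI)
  fix t :: real assume t: "t \<in> {0..}"
  show "continuous (at t within {0..}) (\<lambda>t. t powr (- a / 2) * exp (- l / t))"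
  proof (cases "t = 0")
    case False
    then have "isCont (\<lambda>t. t powr (- a / 2) * exp (- l / t)) t"
      using t by (intro continuous_intros) auto
    then show ?thesis by (rule continuous_at_imp_continuous_at_within)
  next
    case True
    obtain m :: nat where m: "a / 2 + 1 \<le> real m" using real_arch_simple by blast
    \<comment> \<open>For \<open>s = 1 / t\<close> large, \<open>exp (l s) \<ge> (l s / m)^m\<close> beats the power \<open>s powr (a / 2)\<close>.\<close>
    have bound: "t powr (- a / 2) * exp (- l / t) \<le> (real m / l) ^ m * t" if t: "0 < t" "t \<le> 1" for t
    proof -
      have m0: "real m > 0" using m a by linarith
      have "l / (real m * t) \<le> exp (l / (real m * t))"
        using exp_ge_add_one_self[of "l / (real m * t)"] by linarith
      then have "(l / (real m * t)) ^ m \<le> exp (l / (real m * t)) ^ m"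
        using t l m0 by (intro power_mono) auto
      also have "\<dots> = exp (l / t)" using t m0 by (simp add: exp_of_nat_mult[symmetric])
      finally have "inverse (exp (l / t)) \<le> inverse ((l / (real m * t)) ^ m)"
        using t l m0 by (intro le_imp_inverse_le) auto
      moreover have "inverse ((l / (real m * t)) ^ m) = (real m / l) ^ m * t ^ m"
        by (simp add: power_mult_distrib[symmetric] power_inverse[symmetric])
      ultimately have "exp (- l / t) \<le> (real m / l) ^ m * t ^ m" by (simp add: exp_minus)
      then have "t powr (- a / 2) * exp (- l / t) \<le> t powr (- a / 2) * ((real m / l) ^ m * t ^ m)"
        by (intro mult_left_mono) auto
      also have "\<dots> = (real m / l) ^ m * (t powr (- a / 2) * t powr real m)"
        using t by (simp add: powr_realpow)
      also have "t powr (- a / 2) * t powr real m = t powr (real m - a / 2)"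
        using powr_add[of t "- a / 2" "real m"] by simp
      also have "\<dots> \<le> t powr 1" using t m by (intro powr_mono') auto
      finally show ?thesis using t l by (simp add: mult_left_mono)
    qed
    have "((\<lambda>t. t powr (- a / 2) * exp (- l / t)) \<longlongrightarrow> 0) (at 0 within {0..})"
    proof (rule Lim_null_comparison)
      have "\<forall>\<^sub>F t in at (0::real) within {0..}. t \<in> {0<..} \<and> t < 1"
        by (auto simp: eventually_at dist_real_def intro!: exI[of _ 1])
      then show "\<forall>\<^sub>F t in at 0 within {0..}. norm (t powr (- a / 2) * exp (- l / t)) \<le> (real m / l) ^ m * t"
        by eventually_elim (use bound in auto)
      show "((\<lambda>t. (real m / l) ^ m * t) \<longlongrightarrow> 0) (at 0 within {0..})"
        by (rule tendsto_eq_rhs[OF tendsto_mult[OF tendsto_const tendsto_ident_at]]) simp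
    qed
    then show ?thesis unfolding True continuous_within by simp
  qed
qed

text \<open>The Gaussian \<open>exp (w \<bullet> Y - l |Y|\<^sup>2)\<close> as a function of the inverted point \<open>\<eta> = Y / |Y|\<^sup>2\<close>. The point
  \<open>\<eta> = 0\<close> stands for \<open>Y\<close> at infinity, where a Gaussian has the value \<open>0\<close>. The parameters \<open>l = 0\<close>,
  \<open>w = 0\<close> give the constant \<open>1\<close> even at \<open>\<eta> = 0\<close>, because the exponent is then \<open>0 / 0 = 0\<close>.\<close>

definition inverted_gaussian :: "real \<Rightarrow> 'a::real_inner \<Rightarrow> 'a \<Rightarrow> real" where
  "inverted_gaussian l w \<eta> = (if \<eta> = 0 \<and> l > 0 then 0 else exp ((w \<bullet> \<eta> - l) / (norm \<eta>)\<^sup>2))"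

text \<open>Either the constant function or a Gaussian whose centre \<open>w / (2 l)\<close> has norm below \<open>r\<close>. This
  condition is additive in \<open>(l, w)\<close>, hence stable under products of Gaussians.\<close>

definition gaussian_parameter :: "real \<Rightarrow> real \<Rightarrow> 'a::real_normed_vector \<Rightarrow> bool" where
  "gaussian_parameter r l w \<longleftrightarrow> l = 0 \<and> w = 0 \<or> l > 0 \<and> norm w < 2 * l * r"

inductive_set gaussian_ring :: "real \<Rightarrow> ('a::real_inner \<Rightarrow> real) set" for r where
  gaussian: "gaussian_parameter r l w \<Longrightarrow> inverted_gaussian l w \<in> gaussian_ring r"
| add: "f \<in> gaussian_ring r \<Longrightarrow> g \<in> gaussian_ring r \<Longrightarrow> (\<lambda>x. f x + g x) \<in> gaussian_ring r"
| scale: "f \<in> gaussian_ring r \<Longrightarrow> (\<lambda>x. c * f x) \<in> gaussian_ring r"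

lemma inverted_gaussian_mult:
  assumes "gaussian_parameter r l w" "gaussian_parameter r l' w'" "r > 0"
  shows "(\<lambda>\<eta>. inverted_gaussian l w \<eta> * inverted_gaussian l' w' \<eta>) = inverted_gaussian (l + l') (w + w')"
    and "gaussian_parameter r (l + l') (w + w')"
proof -
  show "(\<lambda>\<eta>. inverted_gaussian l w \<eta> * inverted_gaussian l' w' \<eta>) = inverted_gaussian (l + l') (w + w')"
  proof
    fix \<eta>
    have "l \<ge> 0" "l' \<ge> 0" using assms by (auto simp: gaussian_parameter_def)
    then show "inverted_gaussian l w \<eta> * inverted_gaussian l' w' \<eta> = inverted_gaussian (l + l') (w + w') \<eta>"
      by (auto simp: inverted_gaussian_def exp_add[symmetric] add_divide_distrib[symmetric] inner_add_left algebra_simps)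
  qed
  show "gaussian_parameter r (l + l') (w + w')"
    using assms norm_triangle_ineq[of w w'] by (auto simp: gaussian_parameter_def algebra_simps)
qed

lemma gaussian_ring_mult:
  assumes r: "r > 0" and f: "f \<in> gaussian_ring r" and g: "g \<in> gaussian_ring r"
  shows "(\<lambda>x. f x * g x) \<in> gaussian_ring r"
  using f
proof induction
  case (gaussian l w)
  show ?case using g
  proof induction
    case (gaussian l' w')
    then show ?case
      using inverted_gaussian_mult[OF \<open>gaussian_parameter r l w\<close> gaussian r] by (simp add: gaussian_ring.gaussian)
  next
    case (add f g)
    then show ?case using gaussian_ring.add by (simp add: distrib_left)
  next
    case (scale f c)
    then show ?case using gaussian_ring.scale[OF scale.IH, of c] by (simp add: mult.left_commute)
  qed
next
  case (add f g)
  then show ?case using gaussian_ring.add by (simp add: distrib_right)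
next
  case (scale f c)
  then show ?case using gaussian_ring.scale[OF scale.IH, of c] by (simp add: mult.assoc)
qed

text \<open>On the ball of radius \<open>1 / (2 r)\<close> the condition \<open>|w| < 2 l r\<close> keeps \<open>w \<bullet> \<eta> - l\<close> below a negative
  constant \<open>-c\<close>, so the function is at most \<open>exp (- c / |\<eta>|\<^sup>2) \<le> |\<eta>|\<^sup>2 / c\<close>.\<close>

lemma inverted_gaussian_continuous:
  fixes w :: "'a::real_inner"
  assumes r: "r > 0" and p: "gaussian_parameter r l w"
  shows "continuous_on (cball 0 (1 / (2 * r))) (inverted_gaussian l w)"
proof (cases "l = 0")
  case True
  then show ?thesis using p by (simp add: gaussian_parameter_def inverted_gaussian_def[abs_def])
next
  case False
  then have l: "l > 0" "norm w < 2 * l * r" using p by (auto simp: gaussian_parameter_def)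
  define c where "c = l - norm w / (2 * r)"
  have c: "c > 0" using l r by (simp add: c_def field_simps)
  show ?thesis
  proof (rule continuous_on_eq_continuous_within[THEN iffD2], intro ballI)
    fix \<eta> :: 'a assume \<eta>: "\<eta> \<in> cball 0 (1 / (2 * r))"
    show "continuous (at \<eta> within cball 0 (1 / (2 * r))) (inverted_gaussian l w)"
    proof (cases "\<eta> = 0")
      case False
      have "isCont (\<lambda>\<eta>. exp ((w \<bullet> \<eta> - l) / (norm \<eta>)\<^sup>2)) \<eta>"
        using False by (intro continuous_intros) auto
      moreover have "\<forall>\<^sub>F x in nhds \<eta>. inverted_gaussian l w x = exp ((w \<bullet> x - l) / (norm x)\<^sup>2)"
        using t1_space_nhds[OF False] by eventually_elim (simp add: inverted_gaussian_def)
      ultimately have "isCont (inverted_gaussian l w) \<eta>" by (subst isCont_cong)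
      then show ?thesis by (rule continuous_at_imp_continuous_at_within)
    next
      case True
      have bound: "inverted_gaussian l w x \<le> (norm x)\<^sup>2 / c" if x: "x \<in> cball 0 (1 / (2 * r))" "x \<noteq> 0" for x
      proof -
        have "w \<bullet> x \<le> norm w * norm x" by (rule norm_cauchy_schwarz)
        also have "\<dots> \<le> norm w * (1 / (2 * r))" using x by (intro mult_left_mono) auto
        finally have "(w \<bullet> x - l) / (norm x)\<^sup>2 \<le> (- c) / (norm x)\<^sup>2" by (intro divide_right_mono) (auto simp: c_def)
        then have "inverted_gaussian l w x \<le> exp (- (c / (norm x)\<^sup>2))" using x by (simp add: inverted_gaussian_def)
        also have "\<dots> = 1 / exp (c / (norm x)\<^sup>2)" by (simp add: exp_minus divide_inverse)
        also have "\<dots> \<le> 1 / (c / (norm x)\<^sup>2)"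
        proof (rule divide_left_mono)
          show "c / (norm x)\<^sup>2 \<le> exp (c / (norm x)\<^sup>2)" using exp_ge_add_one_self[of "c / (norm x)\<^sup>2"] by linarith
        qed (use c x in auto)
        finally show ?thesis by simp
      qed
      have "(inverted_gaussian l w \<longlongrightarrow> 0) (at 0 within cball 0 (1 / (2 * r)))"
      proof (rule Lim_null_comparison)
        show "\<forall>\<^sub>F x in at 0 within cball 0 (1 / (2 * r)). norm (inverted_gaussian l w x) \<le> (norm x)\<^sup>2 / c"
          unfolding eventually_at_filter
          using bound by (intro always_eventually) (auto simp: inverted_gaussian_def)
        have "((\<lambda>x::'a. (norm x)\<^sup>2 / c) \<longlongrightarrow> (norm (0::'a))\<^sup>2 / c) (at 0 within cball 0 (1 / (2 * r)))"
          using c by (intro tendsto_intros) auto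
        then show "((\<lambda>x::'a. (norm x)\<^sup>2 / c) \<longlongrightarrow> 0) (at 0 within cball 0 (1 / (2 * r)))" by simp
      qed
      then show ?thesis using l by (simp add: True continuous_within inverted_gaussian_def)
    qed
  qed
qed

text \<open>Points of different norm are separated by the centred Gaussian. Points \<open>x \<noteq> y\<close> of equal norm are
  separated by a Gaussian shifted in the direction \<open>x - y\<close>.\<close>

lemma gaussian_ring_function_ring:
  fixes r :: real
  assumes r: "r > 0"
  shows "function_ring_on (gaussian_ring r :: ('a::euclidean_space \<Rightarrow> real) set) (cball 0 (1 / (2 * r)))"
proof
  show "continuous_on (cball 0 (1 / (2 * r))) f" if "f \<in> gaussian_ring r" for f :: "'a \<Rightarrow> real"
    using that by induction (auto intro: inverted_gaussian_continuous[OF r] continuous_intros)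
  show "(\<lambda>_. c) \<in> gaussian_ring r" for c
    using gaussian_ring.scale[OF gaussian_ring.gaussian[of r 0 0], of c]
    by (simp add: gaussian_parameter_def inverted_gaussian_def)
  fix x y :: 'a assume "x \<noteq> y"
  show "\<exists>f\<in>gaussian_ring r. f x \<noteq> f y"
  proof (rule ccontr)
    assume neg: "\<not> ?thesis"
    have eq: "inverted_gaussian 1 w x = inverted_gaussian 1 w y" if "norm w < 2 * r" for w
      using neg gaussian_ring.gaussian[of r 1 w] that by (auto simp: gaussian_parameter_def)
    have nz: "x \<noteq> 0" "y \<noteq> 0"
      using eq[of 0] r \<open>x \<noteq> y\<close> by (auto simp: inverted_gaussian_def split: if_splits)
    have "norm x = norm y"
      using eq[of 0] r nz by (simp add: inverted_gaussian_def)
    define w where "w = (r / norm (x - y)) *\<^sub>R (x - y)"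
    have "norm w = r" using \<open>x \<noteq> y\<close> r by (simp add: w_def)
    then have "inverted_gaussian 1 w x = inverted_gaussian 1 w y" using r by (intro eq) simp
    then have "w \<bullet> x = w \<bullet> y" using nz \<open>norm x = norm y\<close> by (simp add: inverted_gaussian_def)
    then have "w \<bullet> (x - y) = 0" by (simp add: inner_diff_right)
    then have "r * norm (x - y) = 0" using \<open>x \<noteq> y\<close> by (simp add: w_def power2_norm_eq_inner[symmetric] power2_eq_square)
    then show False using r \<open>x \<noteq> y\<close> by simp
  qed
qed (auto intro: gaussian_ring.add gaussian_ring_mult[OF r])

context far_source begin

lemma gaussian_integrals_eq_0:
  assumes zero: "\<And>x. dist x x0 < r \<Longrightarrow> (\<integral>y. g y * norm (x - y) powr (- a) \<partial>lebesgue) = 0"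
    and dim: "a + 2 > real DIM('a)" and x: "dist x x0 < r" and l: "l > 0"
  shows "integrable lebesgue (\<lambda>y. g y * exp (- l * norm (x - y) ^ 2))"
    and "(\<integral>y. g y * exp (- l * norm (x - y) ^ 2) \<partial>lebesgue) = 0"
proof -
  let ?\<psi> = "\<lambda>t. t powr (- a / 2) * exp (- l / t)"
  have cont: "continuous_on {0..1 / r\<^sup>2} ?\<psi>"
    by (rule continuous_on_subset[OF gaussian_profile_continuous[OF a l]]) auto
  have meas: "?\<psi> \<in> borel_measurable borel" by measurable
  have eq: "g y * norm (x - y) powr (- a) * ?\<psi> (1 / norm (x - y) ^ 2) = g y * exp (- l * norm (x - y) ^ 2)" for y
  proof (cases "g y = 0")
    case False
    then have p: "norm (x - y) > 0" using half_dist_le[OF False, of x] x r by auto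
    have "norm (x - y) powr (- 2) = 1 / norm (x - y) powr 2" by (rule powr_minus_divide)
    then have "1 / norm (x - y) ^ 2 = norm (x - y) powr (- 2)" by simp
    then have "(1 / norm (x - y) ^ 2) powr (- a / 2) = (norm (x - y) powr (- 2)) powr (- a / 2)"
      by (rule arg_cong)
    also have "\<dots> = norm (x - y) powr (- 2 * (- a / 2))" by (rule powr_powr)
    also have "\<dots> = norm (x - y) powr a" by simp
    finally have "norm (x - y) powr (- a) * (1 / norm (x - y) ^ 2) powr (- a / 2) = 1"
      using p by (simp add: powr_minus)
    moreover have "g y * norm (x - y) powr (- a) * ?\<psi> (1 / norm (x - y) ^ 2)
        = g y * (norm (x - y) powr (- a) * (1 / norm (x - y) ^ 2) powr (- a / 2)) * exp (- l / (1 / norm (x - y) ^ 2))"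
      by (simp only: mult.assoc)
    ultimately show ?thesis by simp
  qed simp
  show "integrable lebesgue (\<lambda>y. g y * exp (- l * norm (x - y) ^ 2))"
    using radial_integrals_eq_0(1)[OF zero dim x cont meas] unfolding eq .
  show "(\<integral>y. g y * exp (- l * norm (x - y) ^ 2) \<partial>lebesgue) = 0"
    using radial_integrals_eq_0(2)[OF zero dim x cont meas] unfolding eq .
qed

text \<open>The weight \<open>exp (- |y - x0|\<^sup>2)\<close> makes the source a finite measure and shifts the parameter \<open>l\<close> by
  one, so that even the constant function of the ring becomes a genuine Gaussian centred in the
  observation ball.\<close>

lemma gaussian_ring_integrals_eq_0:
  assumes zero: "\<And>x. dist x x0 < r \<Longrightarrow> (\<integral>y. g y * norm (x - y) powr (- a) \<partial>lebesgue) = 0"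
    and dim: "a + 2 > real DIM('a)" and h: "h \<in> gaussian_ring r"
  defines "f \<equiv> \<lambda>y. g y * exp (- (norm (y - x0) ^ 2))" and "\<eta> \<equiv> \<lambda>y. (y - x0) /\<^sub>R (norm (y - x0) ^ 2)"
  shows "integrable lebesgue (\<lambda>y. f y * h (\<eta> y)) \<and> (\<integral>y. f y * h (\<eta> y) \<partial>lebesgue) = 0"
  using h
proof induction
  case (gaussian l w)
  have l: "l \<ge> 0" and w: "norm w < 2 * (l + 1) * r"
    using gaussian r by (auto simp: gaussian_parameter_def algebra_simps)
  \<comment> \<open>Completing the square: the weighted Gaussian is centred at \<open>x0 + v\<close>.\<close>
  define v where "v = w /\<^sub>R (2 * (l + 1))"
  have v: "w = (2 * (l + 1)) *\<^sub>R v" using l by (simp add: v_def)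
  have "norm v < r" using w l by (simp add: v_def field_simps)
  then have x: "dist (x0 + v) x0 < r" by (simp add: dist_norm)
  have eq: "f y * inverted_gaussian l w (\<eta> y) = exp ((l + 1) * norm v ^ 2) * (g y * exp (- (l + 1) * norm (x0 + v - y) ^ 2))" for y
  proof (cases "g y = 0")
    case False
    define Y where "Y = y - x0"
    have Y: "Y \<noteq> 0" using half_dist_le(2)[OF False, of x0] r by (auto simp: Y_def)
    have \<eta>: "\<eta> y = Y /\<^sub>R (norm Y ^ 2)" by (simp add: \<eta>_def Y_def)
    have "norm (\<eta> y) ^ 2 = 1 / norm Y ^ 2" using Y by (simp add: \<eta> power2_eq_square field_simps)
    moreover have "w \<bullet> \<eta> y = (w \<bullet> Y) / norm Y ^ 2" by (simp add: \<eta> divide_inverse)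
    ultimately have "(w \<bullet> \<eta> y - l) / norm (\<eta> y) ^ 2 = w \<bullet> Y - l * norm Y ^ 2"
      using Y by (simp add: left_diff_distrib)
    then have G: "inverted_gaussian l w (\<eta> y) = exp (w \<bullet> Y - l * norm Y ^ 2)"
      using Y by (simp add: inverted_gaussian_def \<eta>)
    have "norm (x0 + v - y) ^ 2 = norm (v - Y) ^ 2" by (simp add: Y_def algebra_simps)
    also have "\<dots> = norm v ^ 2 - 2 * (v \<bullet> Y) + norm Y ^ 2"
      unfolding power2_norm_eq_inner by (simp add: inner_diff_left inner_diff_right inner_commute)
    finally have n: "norm (x0 + v - y) ^ 2 = norm v ^ 2 - 2 * (v \<bullet> Y) + norm Y ^ 2" .
    have "w \<bullet> Y = 2 * (l + 1) * (v \<bullet> Y)" unfolding v by simp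
    then have "- (norm Y ^ 2) + (w \<bullet> Y - l * norm Y ^ 2) = (l + 1) * norm v ^ 2 + - (l + 1) * norm (x0 + v - y) ^ 2"
      unfolding n by (simp add: algebra_simps)
    then have "exp (- (norm Y ^ 2)) * exp (w \<bullet> Y - l * norm Y ^ 2)
        = exp ((l + 1) * norm v ^ 2) * exp (- (l + 1) * norm (x0 + v - y) ^ 2)"
      unfolding exp_add[symmetric] by (rule arg_cong)
    then show ?thesis unfolding G f_def Y_def[symmetric] by (simp add: mult.assoc mult.left_commute)
  qed (simp add: f_def)
  have l1: "l + 1 > 0" using l by simp
  show ?case
    unfolding eq using gaussian_integrals_eq_0[OF zero dim x l1] by simp
next
  case (add h k)
  then show ?case by (simp add: distrib_left)
next
  case (scale h c)
  then show ?case by (simp add: mult.left_commute[of _ c])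
qed

text \<open>Unique continuation. The inversion maps the support of the source into the compact ball of radius
  \<open>1 / (2 r)\<close>, and a test function with bounded support becomes continuous there when it is extended by
  \<open>0\<close> at the origin. The Stone--Weierstrass theorem approximates it by the ring of Gaussians.\<close>

lemma AE_eq_0_if_potential_eq_0:
  assumes zero: "\<And>x. dist x x0 < r \<Longrightarrow> (\<integral>y. g y * norm (x - y) powr (- a) \<partial>lebesgue) = 0"
    and dim: "a + 2 > real DIM('a)"
  shows "AE y in lebesgue. g y = 0"
proof -
  define f where "f y = g y * exp (- (norm (y - x0) ^ 2))" for y
  define \<eta> where "\<eta> y = (y - x0) /\<^sub>R (norm (y - x0) ^ 2)" for y
  have ring: "integrable lebesgue (\<lambda>y. f y * k (\<eta> y)) \<and> (\<integral>y. f y * k (\<eta> y) \<partial>lebesgue) = 0"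
    if "k \<in> gaussian_ring r" for k
    unfolding f_def \<eta>_def by (rule gaussian_ring_integrals_eq_0[OF zero dim that])
  have f: "integrable lebesgue f"
    using gaussian_integrals_eq_0(1)[OF zero dim, of x0 1] r by (simp add: f_def[abs_def] norm_minus_commute)
  let ?K = "cball 0 (1 / (2 * r)) :: 'a set"
  have \<eta>: "\<eta> y \<in> ?K" "\<eta> y \<noteq> 0" "x0 + \<eta> y /\<^sub>R (norm (\<eta> y) ^ 2) = y" if "f y \<noteq> 0" for y
  proof -
    have "2 * r \<le> norm (y - x0)" using that half_dist_le(2)[of y x0] r by (simp add: f_def)
    moreover from this have "y - x0 \<noteq> 0" using r by auto
    moreover have n: "norm (\<eta> y) = 1 / norm (y - x0)"
    proof -
      have "norm (\<eta> y) = inverse (norm (y - x0) ^ 2) * norm (y - x0)" by (simp add: \<eta>_def)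
      then show ?thesis using \<open>y - x0 \<noteq> 0\<close> by (simp add: power2_eq_square divide_inverse)
    qed
    ultimately show "\<eta> y \<in> ?K" "\<eta> y \<noteq> 0" using r by (auto simp: frac_le \<eta>_def)
    have "\<eta> y /\<^sub>R (norm (\<eta> y) ^ 2) = y - x0"
      unfolding n using \<open>y - x0 \<noteq> 0\<close> by (simp add: \<eta>_def power_divide)
    then show "x0 + \<eta> y /\<^sub>R (norm (\<eta> y) ^ 2) = y" by simp
  qed
  interpret R: function_ring_on "gaussian_ring r :: ('a \<Rightarrow> real) set" ?K
    by (rule gaussian_ring_function_ring[OF r])
  have "AE y in lebesgue. f y = 0"
  proof (rule AE_eq_0_if_test_integrals_eq_0[OF f])
    fix H :: "'a \<Rightarrow> real" and L \<rho>
    assume lip: "L-lipschitz_on UNIV H" and H1: "\<And>y. \<bar>H y\<bar> \<le> 1" and supp: "\<And>y. H y \<noteq> 0 \<Longrightarrow> norm y \<le> \<rho>"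
    define h where "h u = (if u = 0 then 0 else H (x0 + u /\<^sub>R (norm u ^ 2)))" for u
    have H: "continuous_on UNIV H" by (rule lipschitz_on_continuous_on[OF lip])
    have fh: "f y * h (\<eta> y) = f y * H y" for y using \<eta>[of y] by (cases "f y = 0") (auto simp: h_def)
    have cont: "isCont h u" for u
    proof (cases "u = 0")
      case False
      have "isCont (\<lambda>u. H (x0 + u /\<^sub>R (norm u ^ 2))) u"
      proof (rule isCont_o2[where f = "\<lambda>u. x0 + u /\<^sub>R (norm u ^ 2)" and g = H])
        show "isCont (\<lambda>u. x0 + u /\<^sub>R (norm u ^ 2)) u"
          using False by (intro continuous_intros) simp
        show "isCont H (x0 + u /\<^sub>R (norm u ^ 2))" using H by (simp add: continuous_on_eq_continuous_at)
      qed
      moreover have "\<forall>\<^sub>F x in nhds u. h x = H (x0 + x /\<^sub>R (norm x ^ 2))"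
        using t1_space_nhds[OF False] by (rule eventually_mono) (simp only: h_def if_False)
      ultimately show ?thesis by (subst isCont_cong)
    next
      case True
      define d where "d = 1 / (\<bar>\<rho>\<bar> + norm x0 + 1)"
      have d: "d > 0" by (simp add: d_def add_nonneg_pos)
      have "h x = 0" if x: "norm x < d" "x \<noteq> 0" for x
      proof (rule ccontr)
        assume "h x \<noteq> 0"
        then have "norm (x0 + x /\<^sub>R (norm x ^ 2)) \<le> \<rho>" using supp x by (auto simp: h_def)
        moreover have "norm (x /\<^sub>R (norm x ^ 2)) \<le> norm (x0 + x /\<^sub>R (norm x ^ 2)) + norm x0"
          using norm_triangle_ineq4[of "x0 + x /\<^sub>R (norm x ^ 2)" x0] by simp
        moreover have "norm (x /\<^sub>R (norm x ^ 2)) = 1 / norm x" using x by (simp add: power2_eq_square field_simps)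
        moreover have "1 / d < 1 / norm x" using x d by (simp add: field_simps)
        ultimately show False by (simp add: d_def)
      qed
      then have "\<forall>\<^sub>F x in nhds 0. h x = 0"
        using d unfolding eventually_nhds_metric by (intro exI[of _ d]) (auto simp: h_def dist_norm)
      then have "isCont h 0 = isCont (\<lambda>x. 0 :: real) (0::'a)" by (rule isCont_cong)
      then show ?thesis using True by simp
    qed
    then have h: "continuous_on ?K h" by (simp add: continuous_at_imp_continuous_on)
    have Hm: "H \<in> borel_measurable lebesgue"
      using H by (intro lebesgue_measurable_borel borel_measurable_continuous_onI)
    have fH: "integrable lebesgue (\<lambda>y. f y * H y)" by (rule integrable_mult_bounded[OF f Hm H1])
    have small: "\<bar>\<integral>y. f y * H y \<partial>lebesgue\<bar> \<le> e * (\<integral>y. \<bar>f y\<bar> \<partial>lebesgue)" if e: "e > 0" for e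
    proof -
      obtain k where k: "k \<in> gaussian_ring r" and kh: "\<And>u. u \<in> ?K \<Longrightarrow> \<bar>h u - k u\<bar> < e"
        using R.Stone_Weierstrass_basic[OF h e] by blast
      have "(\<integral>y. f y * H y \<partial>lebesgue) = (\<integral>y. f y * H y - f y * k (\<eta> y) \<partial>lebesgue)"
        using ring[OF k] fH by simp
      also have "\<bar>\<dots>\<bar> \<le> (\<integral>y. \<bar>f y * H y - f y * k (\<eta> y)\<bar> \<partial>lebesgue)" by (rule integral_abs_bound)
      also have "\<dots> \<le> (\<integral>y. e * \<bar>f y\<bar> \<partial>lebesgue)"
      proof (rule integral_mono)
        show "integrable lebesgue (\<lambda>y. \<bar>f y * H y - f y * k (\<eta> y)\<bar>)" using ring[OF k] fH by simp
        show "integrable lebesgue (\<lambda>y. e * \<bar>f y\<bar>)" using f by simp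
        show "\<bar>f y * H y - f y * k (\<eta> y)\<bar> \<le> e * \<bar>f y\<bar>" for y
        proof (cases "f y = 0")
          case False
          have "\<bar>f y * H y - f y * k (\<eta> y)\<bar> = \<bar>f y\<bar> * \<bar>h (\<eta> y) - k (\<eta> y)\<bar>"
            unfolding fh[symmetric] by (simp only: right_diff_distrib[symmetric] abs_mult)
          also have "\<dots> \<le> \<bar>f y\<bar> * e" using kh[OF \<eta>(1)[OF False]] by (intro mult_left_mono) auto
          finally show ?thesis by (simp add: mult.commute)
        qed simp
      qed
      also have "\<dots> = e * (\<integral>y. \<bar>f y\<bar> \<partial>lebesgue)" by simp
      finally show ?thesis .
    qed
    show "(\<integral>y. f y * H y \<partial>lebesgue) = 0"
      by (rule eq_0_if_abs_le_all_multiples[OF small]) (simp_all add: integral_nonneg_AE)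
  qed
  then show ?thesis by eventually_elim (simp add: f_def)
qed

end

section \<open>Integrability of the fractional kernel\<close>

text \<open>Shells accumulating at the origin and at infinity.\<close>

lemma dyadic_shell:
  fixes t :: real
  assumes "t > 0"
  obtains k :: nat where "t \<le> 1" "(1/2) ^ Suc k < t" "t \<le> (1/2) ^ k"
  | k :: nat where "1 < t" "2 ^ k \<le> t" "t \<le> 2 ^ Suc k"
proof (cases "t \<le> 1")
  case True
  obtain n where n: "(1/2) ^ n < t" using real_arch_pow_inv[OF assms, of "1/2"] by auto
  define m where "m = (LEAST n. (1/2) ^ n < t)"
  have m: "(1/2) ^ m < t" unfolding m_def by (rule LeastI[of _ n]) (rule n)
  then obtain k where k: "m = Suc k" using True by (cases m) auto
  have "\<not> (1/2) ^ k < t" using not_less_Least[of k "\<lambda>n. (1/2) ^ n < t"] k by (simp add: m_def)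
  then show ?thesis using that(1)[of k] True m k by simp
next
  case False
  obtain n where n: "t < 2 ^ n" using real_arch_pow[of 2 t] by auto
  define m where "m = (LEAST n. t < 2 ^ n)"
  have m: "t < 2 ^ m" unfolding m_def by (rule LeastI[of _ n]) (rule n)
  then obtain k where k: "m = Suc k" using False by (cases m) auto
  have "\<not> t < 2 ^ k" using not_less_Least[of k "\<lambda>n. t < 2 ^ n"] k by (simp add: m_def)
  then show ?thesis using that(2)[of k] False m k by simp
qed

text \<open>On the shell of radius \<open>2\<^sup>-\<^sup>k\<close> the integral is of the order \<open>2\<close> to the power \<open>-(2 - 2 s) k\<close>, on
  that of radius \<open>2\<^sup>k\<close> of the order \<open>2\<close> to the power \<open>-2 s k\<close>; both series are geometric since
  \<open>0 < s < 1\<close>.\<close>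

lemma fractional_kernel_nn_integral_finite:
  fixes s :: real
  assumes s: "0 < s" "s < 1"
  shows "(\<integral>\<^sup>+h. ennreal (min 1 ((norm h)\<^sup>2) * norm h powr (- (real DIM('a) + 2 * s))) \<partial>(lborel :: 'a::euclidean_space measure)) < \<infinity>"
proof -
  define a where "a = real DIM('a) + 2 * s"
  define V where "V = unit_ball_vol (real DIM('a))"
  have V: "V \<ge> 0" by (simp add: V_def)
  define b1 where "b1 k = (1/4) ^ k * ((1/2) ^ Suc k) powr (- a)" for k :: nat
  define b2 where "b2 k = (2 ^ k) powr (- a)" for k :: nat
  have b: "b1 k \<ge> 0" "b2 k \<ge> 0" for k by (auto simp: b1_def b2_def)
  have a: "a > 0" using s by (simp add: a_def add_nonneg_pos)
  define B where "B k h = ennreal (b1 k) * indicator (cball (0::'a) ((1/2) ^ k)) h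
      + ennreal (b2 k) * indicator (cball (0::'a) (2 ^ Suc k)) h" for k h
  have le: "ennreal (min 1 ((norm h)\<^sup>2) * norm h powr (- a)) \<le> (\<Sum>k. B k h)" for h
  proof (cases "h = 0")
    case False
    have "\<exists>k. ennreal (min 1 ((norm h)\<^sup>2) * norm h powr (- a)) \<le> B k h"
    proof (rule dyadic_shell[of "norm h"])
      fix k assume k: "norm h \<le> 1" "(1/2) ^ Suc k < norm h" "norm h \<le> (1/2) ^ k"
      have "(norm h)\<^sup>2 \<le> ((1/2) ^ k)\<^sup>2" using k by (intro power_mono) auto
      also have "\<dots> = (1/4) ^ k" by (simp add: power2_eq_square power_mult_distrib[symmetric])
      finally have "min 1 ((norm h)\<^sup>2) * norm h powr (- a) \<le> b1 k"
        unfolding b1_def using k a by (intro mult_mono powr_mono2') auto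
      then have "ennreal (min 1 ((norm h)\<^sup>2) * norm h powr (- a)) \<le> ennreal (b1 k)" by (rule ennreal_leI)
      also have "\<dots> \<le> B k h" using k by (simp add: B_def)
      finally show ?thesis by blast
    next
      fix k assume k: "1 < norm h" "2 ^ k \<le> norm h" "norm h \<le> 2 ^ Suc k"
      have "min 1 ((norm h)\<^sup>2) * norm h powr (- a) \<le> 1 * b2 k"
        unfolding b2_def using k a by (intro mult_mono powr_mono2') auto
      then have "ennreal (min 1 ((norm h)\<^sup>2) * norm h powr (- a)) \<le> ennreal (b2 k)" by (intro ennreal_leI) simp
      also have "\<dots> \<le> B k h" using k by (simp add: B_def)
      finally show ?thesis by blast
    qed (use False in simp)
    then obtain k where "ennreal (min 1 ((norm h)\<^sup>2) * norm h powr (- a)) \<le> B k h" by blast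
    also have "\<dots> \<le> (\<Sum>k. B k h)" by (rule sum_le_suminf[of _ "{k}", simplified]) auto
    finally show ?thesis .
  qed simp
  have [measurable]: "cball (0::'a) c \<in> sets borel" for c by simp
  have Bm[measurable]: "B k \<in> borel_measurable borel" for k unfolding B_def by measurable
  have two: "(2::real) ^ k = 2 powr real k" "(1/2::real) ^ k = 2 powr (- real k)" "(1/4::real) ^ k = 2 powr (- 2 * real k)" for k
  proof -
    show *: "(2::real) ^ k = 2 powr real k" for k by (simp add: powr_realpow)
    have "(1/2::real) ^ k = inverse (2 ^ k)" by (simp add: power_one_over inverse_eq_divide)
    also have "\<dots> = 2 powr (- real k)" unfolding * by (rule powr_minus[symmetric])
    finally show h: "(1/2::real) ^ k = 2 powr (- real k)" .
    have "(1/4::real) ^ k = (1/2) ^ k * (1/2) ^ k" by (simp add: power_mult_distrib[symmetric])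
    also have "\<dots> = 2 powr (- 2 * real k)" unfolding h by (simp add: powr_add[symmetric])
    finally show "(1/4::real) ^ k = 2 powr (- 2 * real k)" .
  qed
  have pk: "(2::real) powr (c * real k) = (2 powr c) ^ k" for c and k :: nat
    by (subst powr_powr[symmetric]) (rule powr_realpow, simp)
  define q1 where "q1 = (2::real) powr (- (2 - 2 * s))"
  define q2 where "q2 = (2::real) powr (- (2 * s))"
  have q: "0 \<le> q1" "q1 < 1" "0 \<le> q2" "q2 < 1"
    using s powr_less_mono[of "- (2 - 2 * s)" 0 "2::real"] powr_less_mono[of "- (2 * s)" 0 "2::real"] by (auto simp: q1_def q2_def)
  have int: "(\<integral>\<^sup>+h. B k h \<partial>lborel) = ennreal (V * 2 powr a * q1 ^ k + V * 2 ^ DIM('a) * q2 ^ k)" for k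
  proof -
    have "(\<integral>\<^sup>+h. B k h \<partial>lborel) = ennreal (b1 k) * emeasure lborel (cball (0::'a) ((1/2) ^ k))
        + ennreal (b2 k) * emeasure lborel (cball (0::'a) (2 ^ Suc k))"
      unfolding B_def by (subst nn_integral_add) (auto simp: nn_integral_cmult_indicator)
    also have "\<dots> = ennreal (b1 k * (V * ((1/2) ^ k) ^ DIM('a)) + b2 k * (V * (2 ^ Suc k) ^ DIM('a)))"
      using b V by (simp add: emeasure_cball V_def[symmetric] ennreal_mult[symmetric] ennreal_plus[symmetric] del: ennreal_plus power_Suc)
    also have "b1 k * (V * ((1/2) ^ k) ^ DIM('a)) = V * 2 powr a * q1 ^ k"
    proof -
      have "b1 k * ((1/2) ^ k) ^ DIM('a) = 2 powr (- 2 * real k) * 2 powr (- real (Suc k) * - a) * 2 powr (- real k * real DIM('a))"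
        unfolding b1_def two by (simp add: powr_powr powr_realpow[symmetric])
      also have "\<dots> = 2 powr a * 2 powr (- (2 - 2 * s) * real k)"
        unfolding powr_add[symmetric] a_def by (rule arg_cong[where f = "\<lambda>c. 2 powr c"]) (simp add: algebra_simps)
      also have "2 powr (- (2 - 2 * s) * real k) = q1 ^ k" unfolding q1_def by (rule pk)
      finally show ?thesis by (simp add: mult.left_commute mult.commute)
    qed
    also have "b2 k * (V * (2 ^ Suc k) ^ DIM('a)) = V * 2 ^ DIM('a) * q2 ^ k"
    proof -
      have "b2 k * (2 ^ Suc k) ^ DIM('a) = 2 powr (real k * - a) * 2 powr (real (Suc k) * real DIM('a))"
        unfolding b2_def two by (simp add: powr_powr powr_realpow[symmetric])
      also have "\<dots> = 2 powr real DIM('a) * 2 powr (- (2 * s) * real k)"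
        unfolding powr_add[symmetric] a_def by (rule arg_cong[where f = "\<lambda>c. 2 powr c"]) (simp add: algebra_simps)
      also have "2 powr (- (2 * s) * real k) = q2 ^ k" unfolding q2_def by (rule pk)
      also have "(2::real) powr real DIM('a) = 2 ^ DIM('a)" by (rule powr_realpow) simp
      finally show ?thesis by (simp add: mult.left_commute mult.commute)
    qed
    finally show ?thesis .
  qed
  have "(\<integral>\<^sup>+h. ennreal (min 1 ((norm h)\<^sup>2) * norm h powr (- a)) \<partial>(lborel :: 'a measure)) \<le> (\<integral>\<^sup>+h. (\<Sum>k. B k h) \<partial>lborel)"
    by (intro nn_integral_mono le)
  also have "\<dots> = (\<Sum>k. \<integral>\<^sup>+h. B k h \<partial>lborel)" by (rule nn_integral_suminf) simp
  also have "\<dots> = (\<Sum>k. ennreal (V * 2 powr a * q1 ^ k + V * 2 ^ DIM('a) * q2 ^ k))" by (simp only: int)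
  also have "\<dots> < \<infinity>"
  proof (subst suminf_ennreal2)
    show "summable (\<lambda>k. V * 2 powr a * q1 ^ k + V * 2 ^ DIM('a) * q2 ^ k)"
      using q by (intro summable_add summable_mult summable_geometric) auto
    show "0 \<le> V * 2 powr a * q1 ^ k + V * 2 ^ DIM('a) * q2 ^ k" for k using q V by simp
  qed simp
  finally show ?thesis by (simp add: a_def)
qed

lemma nn_integral_lborel_translate:
  fixes f :: "'a::euclidean_space \<Rightarrow> ennreal"
  assumes f: "f \<in> borel_measurable borel"
  shows "(\<integral>\<^sup>+y. f (y - x) \<partial>lborel) = (\<integral>\<^sup>+y. f y \<partial>lborel)"
proof -
  have "(\<integral>\<^sup>+y. f y \<partial>lborel) = (\<integral>\<^sup>+y. f y \<partial>distr lborel borel ((+) (- x)))" by (simp only: lborel_distr_plus)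
  also have "\<dots> = (\<integral>\<^sup>+y. f (- x + y) \<partial>lborel)" by (rule nn_integral_distr) (use f in auto)
  finally show ?thesis by simp
qed

section \<open>The energy space of the Robin problem\<close>

lemma sigma_finite_lebesgue: "sigma_finite_measure (lebesgue :: 'a::euclidean_space measure)"
proof
  let ?A = "range (\<lambda>n::nat. cball (0::'a) (real n))"
  have "\<Union>?A = UNIV" using real_arch_simple by fastforce
  then show "\<exists>A :: 'a set set. countable A \<and> A \<subseteq> sets lebesgue \<and> \<Union>A = space lebesgue \<and> (\<forall>a\<in>A. emeasure lebesgue a \<noteq> \<infinity>)"
    by (intro exI[of _ ?A]) (auto simp: emeasure_cball emeasure_completion main_part_sets)
qed

interpretation lebesgue: sigma_finite_measure "lebesgue :: 'a::euclidean_space measure"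
  by (rule sigma_finite_lebesgue)

interpretation lebesgue_pair: pair_sigma_finite "lebesgue :: 'a::euclidean_space measure" "lebesgue :: 'a measure" ..

lemma AE_pair_lebesgue_components:
  fixes P :: "'a::euclidean_space \<Rightarrow> bool"
  assumes "AE x in lebesgue. P x"
  shows "AE p in lebesgue \<Otimes>\<^sub>M lebesgue. P (fst p) \<and> P (snd p)"
proof -
  obtain N where N: "{x. \<not> P x} \<subseteq> N" "N \<in> sets lebesgue" "emeasure lebesgue N = 0"
    using assms by (auto simp: eventually_ae_filter null_sets_def)
  let ?M = "lebesgue \<Otimes>\<^sub>M lebesgue :: ('a \<times> 'a) measure"
  have U: "UNIV \<in> sets (lebesgue :: 'a measure)" using sets.top[of "lebesgue :: 'a measure"] by simp
  have "N \<times> UNIV \<in> null_sets ?M" "UNIV \<times> N \<in> null_sets ?M"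
    using N U by (auto simp: null_sets_def lebesgue.emeasure_pair_measure_Times)
  then have "N \<times> UNIV \<union> UNIV \<times> N \<in> null_sets ?M" by (rule null_sets.Un)
  moreover have "{p \<in> space ?M. \<not> (P (fst p) \<and> P (snd p))} \<subseteq> N \<times> UNIV \<union> UNIV \<times> N" using N(1) by auto
  ultimately show ?thesis by (rule AE_I')
qed

text \<open>The exponent \<open>a\<close> of the kernel is a parameter, tied to the dimension by an equation, because it
  depends on the dimension only through a type.\<close>

locale robin_problem =
  fixes \<Omega> :: "(real ^ 'n) set" and \<kappa> :: "real ^ 'n \<Rightarrow> real" and s a :: real
  assumes a_def: "a = real CARD('n) + 2 * s"
    and s: "0 < s" "s < 1"
    and \<Omega>: "open \<Omega>" "bounded \<Omega>" "\<Omega> \<noteq> {}"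
    and \<kappa>_integrable: "integrable (lebesgue_on (- \<Omega>)) \<kappa>"
    and \<kappa>_bounded: "\<exists>B. AE x in lebesgue_on (- \<Omega>). \<bar>\<kappa> x\<bar> \<le> B"
    and \<kappa>_pos: "AE x in lebesgue_on (- \<Omega>). \<kappa> x > 0"
begin

abbreviation \<mu> :: "(real ^ 'n) measure" where "\<mu> \<equiv> robin_measure \<Omega> \<kappa>"

text \<open>With the kernel built into a measure on pairs, the double integrals of the problem are the squared
  norm and the inner product of \<open>L\<^sup>2(gagliardo)\<close>, evaluated at difference functions. The Hilbert
  space structure of \<open>W\<close> is then inherited from \<open>L\<^sup>2\<close> spaces.\<close>

definition gagliardo :: "((real ^ 'n) \<times> (real ^ 'n)) measure" where
  "gagliardo = density (lebesgue \<Otimes>\<^sub>M lebesgue)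
     (\<lambda>p. ennreal (indicator (cross_region \<Omega>) p / norm (fst p - snd p) powr a))"

definition difference :: "(real ^ 'n \<Rightarrow> real) \<Rightarrow> (real ^ 'n) \<times> (real ^ 'n) \<Rightarrow> real" where
  "difference u p = u (fst p) - u (snd p)"

text \<open>The extension of \<open>\<kappa>\<close> by zero, as a density with respect to Lebesgue measure on the whole space.\<close>

definition weight :: "real ^ 'n \<Rightarrow> ennreal" where
  "weight x = ennreal (if x \<in> \<Omega> then 0 else \<kappa> x)"

lemma \<Omega>_sets [measurable]: "\<Omega> \<in> sets lebesgue" "- \<Omega> \<in> sets lebesgue" "\<Omega> \<in> sets borel"
  using \<Omega>(1) by auto

lemma cross_region_sets [measurable]: "cross_region \<Omega> \<in> sets (lebesgue \<Otimes>\<^sub>M lebesgue)"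
  unfolding cross_region_def by (intro sets.Un pair_measureI \<Omega>_sets)

lemma a_pos: "a > 0" using s by (simp add: a_def)

lemma borel_pair_measurable_lebesgue:
  fixes f :: "(real ^ 'n) \<times> (real ^ 'n) \<Rightarrow> real"
  assumes "f \<in> borel_measurable (borel \<Otimes>\<^sub>M borel)"
  shows "f \<in> borel_measurable (lebesgue \<Otimes>\<^sub>M lebesgue)"
proof -
  have "(\<lambda>p. (fst p, snd p)) \<in> (lebesgue :: (real ^ 'n) measure) \<Otimes>\<^sub>M (lebesgue :: (real ^ 'n) measure) \<rightarrow>\<^sub>M borel \<Otimes>\<^sub>M borel"
    by (intro measurable_Pair measurable_compose[OF measurable_fst] measurable_compose[OF measurable_snd] lebesgue_measurable_borel measurable_ident_sets refl)
  from measurable_compose[OF this assms] show ?thesis by simp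
qed

lemma kernel_measurable [measurable]:
  "(\<lambda>p. indicator (cross_region \<Omega>) p / norm (fst p - snd p) powr a) \<in> borel_measurable (lebesgue \<Otimes>\<^sub>M lebesgue)"
proof -
  have "(\<lambda>p::(real ^ 'n) \<times> (real ^ 'n). norm (fst p - snd p) powr a) \<in> borel_measurable (borel \<Otimes>\<^sub>M borel)"
    by measurable
  then have "(\<lambda>p::(real ^ 'n) \<times> (real ^ 'n). norm (fst p - snd p) powr a) \<in> borel_measurable (lebesgue \<Otimes>\<^sub>M lebesgue)"
    by (rule borel_pair_measurable_lebesgue)
  then show ?thesis by measurable
qed

lemma weight_measurable [measurable]: "weight \<in> borel_measurable lebesgue"
proof -
  have "\<kappa> \<in> borel_measurable (lebesgue_on (- \<Omega>))" using \<kappa>_integrable by auto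
  then have "(\<lambda>x. if x \<in> - \<Omega> then \<kappa> x else 0) \<in> borel_measurable lebesgue"
    by (subst borel_measurable_if) (rule \<Omega>_sets)
  moreover have "(\<lambda>x. if x \<in> - \<Omega> then \<kappa> x else 0) = (\<lambda>x. if x \<in> \<Omega> then 0 else \<kappa> x)" by auto
  ultimately have "(\<lambda>x. if x \<in> \<Omega> then 0 else \<kappa> x) \<in> borel_measurable lebesgue" by simp
  then show ?thesis unfolding weight_def by measurable
qed

lemma measurable_lebesgue_imp:
  assumes "u \<in> borel_measurable lebesgue"
  shows "u \<in> borel_measurable (lebesgue_on \<Omega>)" "u \<in> borel_measurable \<mu>" "difference u \<in> borel_measurable gagliardo"
    "difference u \<in> borel_measurable (lebesgue \<Otimes>\<^sub>M lebesgue)"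
proof -
  show "u \<in> borel_measurable (lebesgue_on \<Omega>)" using assms by (rule measurable_restrict_space1)
  show "u \<in> borel_measurable \<mu>" unfolding robin_measure_def measurable_density_eq1
    using assms by (simp add: measurable_restrict_space1)
  show "difference u \<in> borel_measurable (lebesgue \<Otimes>\<^sub>M lebesgue)"
    unfolding difference_def using assms by measurable
  then show "difference u \<in> borel_measurable gagliardo" unfolding gagliardo_def by simp
qed

lemma nn_integral_\<mu>:
  assumes "f \<in> borel_measurable lebesgue"
  shows "(\<integral>\<^sup>+x. f x \<partial>\<mu>) = (\<integral>\<^sup>+x. weight x * f x \<partial>lebesgue)"
proof -
  have k: "(\<lambda>x. ennreal (\<kappa> x)) \<in> borel_measurable (lebesgue_on (- \<Omega>))" using \<kappa>_integrable by auto
  have "(\<integral>\<^sup>+x. f x \<partial>\<mu>) = (\<integral>\<^sup>+x. ennreal (\<kappa> x) * f x \<partial>lebesgue_on (- \<Omega>))"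
    unfolding robin_measure_def by (rule nn_integral_density[OF k measurable_restrict_space1[OF assms]])
  also have "\<dots> = (\<integral>\<^sup>+x. ennreal (\<kappa> x) * f x * indicator (- \<Omega>) x \<partial>lebesgue)"
    by (rule nn_integral_restrict_space) simp
  also have "\<dots> = (\<integral>\<^sup>+x. weight x * f x \<partial>lebesgue)"
    by (intro nn_integral_cong) (auto simp: weight_def)
  finally show ?thesis .
qed

lemma nn_integral_gagliardo:
  assumes "f \<in> borel_measurable (lebesgue \<Otimes>\<^sub>M lebesgue)"
  shows "(\<integral>\<^sup>+p. f p \<partial>gagliardo)
    = (\<integral>\<^sup>+x. \<integral>\<^sup>+y. ennreal (indicator (cross_region \<Omega>) (x, y) / norm (x - y) powr a) * f (x, y) \<partial>lebesgue \<partial>lebesgue)"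
proof -
  have "(\<integral>\<^sup>+p. f p \<partial>gagliardo)
      = (\<integral>\<^sup>+p. ennreal (indicator (cross_region \<Omega>) p / norm (fst p - snd p) powr a) * f p \<partial>(lebesgue \<Otimes>\<^sub>M lebesgue))"
    unfolding gagliardo_def using assms by (intro nn_integral_density) measurable
  also have "\<dots> = (\<integral>\<^sup>+x. \<integral>\<^sup>+y. ennreal (indicator (cross_region \<Omega>) (x, y) / norm (x - y) powr a) * f (x, y) \<partial>lebesgue \<partial>lebesgue)"
    using assms by (subst lebesgue.nn_integral_fst[symmetric]) auto
  finally show ?thesis .
qed

lemma robin_sobolev_iff:
  "u \<in> robin_sobolev \<Omega> \<kappa> s \<longleftrightarrow>
     u \<in> borel_measurable lebesgue \<and> u \<in> L2 (lebesgue_on \<Omega>) \<and> u \<in> L2 \<mu> \<and> difference u \<in> L2 gagliardo"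
proof (cases "u \<in> borel_measurable lebesgue")
  case True
  note m = measurable_lebesgue_imp[OF True]
  have "(\<integral>\<^sup>+p. ennreal ((difference u p)\<^sup>2) \<partial>gagliardo)
      = (\<integral>\<^sup>+p. ennreal (indicator (cross_region \<Omega>) p / norm (fst p - snd p) powr a) * ennreal ((difference u p)\<^sup>2) \<partial>(lebesgue \<Otimes>\<^sub>M lebesgue))"
    unfolding gagliardo_def using m(4) by (intro nn_integral_density) measurable
  also have "\<dots> = (\<integral>\<^sup>+p. (case p of (x, y) \<Rightarrow> ennreal (\<bar>u x - u y\<bar>\<^sup>2 / norm (x - y) powr a)) * indicator (cross_region \<Omega>) p \<partial>(lebesgue \<Otimes>\<^sub>M lebesgue))"
    by (intro nn_integral_cong) (auto simp: difference_def ennreal_mult[symmetric] split: split_indicator prod.split)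
  finally show ?thesis
    unfolding robin_sobolev_def robin_sobolev_norm_sq_def a_def[symmetric] L2_iff_nn_integral using True m(1-3) by (auto simp: less_top)
qed (simp add: robin_sobolev_def)

lemma frac_form_eq:
  assumes "u \<in> borel_measurable lebesgue" "v \<in> borel_measurable lebesgue"
  shows "frac_form \<Omega> s u v = frac_const CARD('n) s / 2 * (\<integral>p. difference u p * difference v p \<partial>gagliardo)"
proof -
  note m = measurable_lebesgue_imp(4)[OF assms(1)] measurable_lebesgue_imp(4)[OF assms(2)]
  have "(\<integral>p. difference u p * difference v p \<partial>gagliardo)
      = (\<integral>p. (indicator (cross_region \<Omega>) p / norm (fst p - snd p) powr a) *\<^sub>R (difference u p * difference v p) \<partial>(lebesgue \<Otimes>\<^sub>M lebesgue))"
    unfolding gagliardo_def by (rule integral_density) (use m in \<open>auto intro!: kernel_measurable\<close>)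
  also have "\<dots> = (LINT (x, y):cross_region \<Omega>|lebesgue \<Otimes>\<^sub>M lebesgue. (u x - u y) * (v x - v y) / norm (x - y) powr a)"
    unfolding set_lebesgue_integral_def
    by (intro Bochner_Integration.integral_cong) (auto simp: difference_def split: split_indicator)
  finally show ?thesis by (simp add: frac_form_def a_def)
qed

lemma frac_const_pos: "frac_const CARD('n) s > 0"
  unfolding frac_const_def using s by (intro divide_pos_pos mult_pos_pos Gamma_real_pos) auto

end

context robin_problem begin

lemma AE_lebesgue_imp:
  assumes "AE x in lebesgue. P x"
  shows "AE x in lebesgue_on \<Omega>. P x" "AE x in \<mu>. P x"
    "AE p in gagliardo. P (fst p) \<and> P (snd p)"
proof -
  show "AE x in lebesgue_on \<Omega>. P x" using assms by (subst AE_restrict_space_iff) auto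
  have "AE x in lebesgue_on (- \<Omega>). P x" using assms by (subst AE_restrict_space_iff) auto
  moreover have "(\<lambda>x. ennreal (\<kappa> x)) \<in> borel_measurable (lebesgue_on (- \<Omega>))" using \<kappa>_integrable by auto
  ultimately show "AE x in \<mu>. P x" unfolding robin_measure_def by (subst AE_density) auto
  show "AE p in gagliardo. P (fst p) \<and> P (snd p)"
    unfolding gagliardo_def using AE_pair_lebesgue_components[OF assms] by (subst AE_density) auto
qed

lemma weight_pos: "AE x in lebesgue. x \<notin> \<Omega> \<longrightarrow> 0 < weight x"
proof -
  have "AE x in lebesgue. x \<in> - \<Omega> \<longrightarrow> \<kappa> x > 0"
    using \<kappa>_pos by (subst (asm) AE_restrict_space_iff) auto
  then show ?thesis by eventually_elim (auto simp: weight_def)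
qed

lemma weight_bounded: obtains b where "b > 0" "AE x in lebesgue. weight x \<le> ennreal b"
proof -
  obtain b where "AE x in lebesgue_on (- \<Omega>). \<bar>\<kappa> x\<bar> \<le> b" using \<kappa>_bounded by blast
  then have "AE x in lebesgue. x \<in> - \<Omega> \<longrightarrow> \<bar>\<kappa> x\<bar> \<le> b"
    by (subst (asm) AE_restrict_space_iff) auto
  then have "AE x in lebesgue. weight x \<le> ennreal (max b 1)"
    by eventually_elim (auto simp: weight_def intro!: ennreal_leI)
  then show ?thesis by (rule that[rotated]) simp
qed

lemma finite_measure_\<Omega>: "emeasure lebesgue \<Omega> < \<infinity>"
  using emeasure_bounded_finite[OF \<Omega>(2)] \<Omega>(1) by (simp add: emeasure_completion main_part_sets)

text \<open>For \<open>x\<close> in \<open>\<Omega>\<close> and \<open>y\<close> in a ball \<open>A\<close> outside \<open>\<Omega>\<close> one has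
  \<open>u(x)\<^sup>2 \<le> 2 (u(x) - u(y))\<^sup>2 + 2 u(y)\<^sup>2\<close>. Multiply by \<open>\<kappa>(y)\<close> and integrate over \<open>\<Omega> \<times> A\<close>: since \<open>|x - y|\<close>
  is bounded by some \<open>D\<close> and \<open>\<kappa>\<close> is bounded by some \<open>b\<close>, the first term is controlled by the Gagliardo
  seminorm. The factor \<open>\<mu>(A)\<close> on the left is positive because \<open>\<kappa> > 0\<close> almost everywhere.\<close>

lemma Poincare_inequality:
  obtains c :: real where "c > 0"
    "\<And>u. u \<in> borel_measurable lebesgue \<Longrightarrow>
      (\<integral>\<^sup>+x. ennreal ((u x)\<^sup>2) \<partial>lebesgue_on \<Omega>)
      \<le> ennreal c * ((\<integral>\<^sup>+p. ennreal ((difference u p)\<^sup>2) \<partial>gagliardo) + (\<integral>\<^sup>+x. ennreal ((u x)\<^sup>2) \<partial>\<mu>))"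
proof -
  obtain R where R: "R > 0" "\<Omega> \<subseteq> ball 0 R" using bounded_subset_ballD[OF \<Omega>(2), of 0] by blast
  obtain e :: "real ^ 'n" where e: "norm e = 1" using vector_choose_size[of 1] by auto
  define A where "A = ball ((R + 1) *\<^sub>R e) 1"
  define D where "D = 2 * R + 2"
  have A: "norm y > R" "norm y < R + 2" if "y \<in> A" for y
  proof -
    have "norm (y - (R + 1) *\<^sub>R e) < 1" using that by (simp add: A_def dist_norm norm_minus_commute)
    moreover have "norm ((R + 1) *\<^sub>R e) = R + 1" using e R by simp
    ultimately show "norm y > R" "norm y < R + 2"
      using norm_triangle_ineq2[of "(R + 1) *\<^sub>R e" y] norm_triangle_ineq2[of y "(R + 1) *\<^sub>R e"]
      by (auto simp: norm_minus_commute)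
  qed
  have A\<Omega>: "y \<notin> \<Omega>" if "y \<in> A" for y using A(1)[OF that] R(2) by auto
  have dist: "0 < norm (x - y)" "norm (x - y) \<le> D" if "x \<in> \<Omega>" "y \<in> A" for x y
  proof -
    have "norm x < R" using that R by auto
    then show "norm (x - y) \<le> D" using A(2)[OF that(2)] norm_triangle_ineq4[of x y] by (simp add: D_def)
    show "0 < norm (x - y)" using A\<Omega>[OF that(2)] that(1) by auto
  qed
  have A_sets[measurable]: "A \<in> sets lebesgue" by (simp add: A_def)
  obtain b where b: "b > 0" "AE x in lebesgue. weight x \<le> ennreal b" by (rule weight_bounded)
  define mA where "mA = (\<integral>\<^sup>+y. weight y * indicator A y \<partial>lebesgue)"
  have eA: "emeasure lebesgue A = ennreal (unit_ball_vol (real CARD('n)))"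
    by (simp add: A_def emeasure_completion main_part_sets emeasure_ball)
  have "mA \<noteq> 0"
  proof
    assume "mA = 0"
    then have "AE y in lebesgue. weight y * indicator A y = 0"
      unfolding mA_def by (subst (asm) nn_integral_0_iff_AE) measurable
    with weight_pos have "AE y in lebesgue. y \<notin> A"
      by eventually_elim (use A\<Omega> in \<open>auto split: split_indicator_asm\<close>)
    then have "emeasure lebesgue A = 0" by (subst (asm) AE_iff_measurable[OF A_sets]) auto
    then have "unit_ball_vol (real CARD('n)) \<le> 0" unfolding eA by (simp only: ennreal_eq_0_iff)
    moreover have "0 < unit_ball_vol (real CARD('n))" by (rule unit_ball_vol_pos) simp
    ultimately show False by linarith
  qed
  moreover have "mA < \<infinity>"
  proof -
    have "mA \<le> (\<integral>\<^sup>+y. ennreal b * indicator A y \<partial>lebesgue)"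
      unfolding mA_def by (intro nn_integral_mono_AE eventually_mono[OF b(2)]) (rule mult_right_mono, auto)
    also have "\<dots> = ennreal b * emeasure lebesgue A" by (simp add: nn_integral_cmult_indicator)
    also have "\<dots> < \<infinity>" unfolding eA by (simp add: ennreal_mult_less_top)
    finally show ?thesis .
  qed
  ultimately obtain m where m: "m > 0" "mA = ennreal m"
    by (cases mA) (auto simp: ennreal_eq_0_iff less_le)
  obtain w where w: "w \<ge> 0" "emeasure lebesgue \<Omega> = ennreal w"
    using finite_measure_\<Omega> by (cases "emeasure lebesgue \<Omega>") auto
  define K where "K = 2 * b * D powr a"
  have D: "D > 0" using R by (simp add: D_def)
  have K: "K > 0" using b D by (simp add: K_def)
  have main: "(\<integral>\<^sup>+x. ennreal ((u x)\<^sup>2) \<partial>lebesgue_on \<Omega>)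
      \<le> ennreal ((K + 2 * w) / m) * ((\<integral>\<^sup>+p. ennreal ((difference u p)\<^sup>2) \<partial>gagliardo) + (\<integral>\<^sup>+x. ennreal ((u x)\<^sup>2) \<partial>\<mu>))"
    if u[measurable]: "u \<in> borel_measurable lebesgue" for u
  proof -
    define G where "G x = (\<integral>\<^sup>+y. ennreal (indicator (cross_region \<Omega>) (x, y) / norm (x - y) powr a)
        * ennreal ((difference u (x, y))\<^sup>2) \<partial>lebesgue)" for x
    define U where "U = (\<integral>\<^sup>+x. ennreal ((u x)\<^sup>2) \<partial>\<mu>)"
    have U: "U = (\<integral>\<^sup>+y. weight y * ennreal ((u y)\<^sup>2) \<partial>lebesgue)" unfolding U_def by (rule nn_integral_\<mu>) measurable
    have meas: "(\<lambda>p. ennreal (indicator (cross_region \<Omega>) p / norm (fst p - snd p) powr a)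
        * ennreal ((difference u p)\<^sup>2)) \<in> borel_measurable (lebesgue \<Otimes>\<^sub>M lebesgue)"
      using measurable_lebesgue_imp(4)[OF u] by measurable
    have meas1: "(\<lambda>y. ennreal (indicator (cross_region \<Omega>) (x, y) / norm (x - y) powr a)
        * ennreal ((difference u (x, y))\<^sup>2)) \<in> borel_measurable lebesgue" for x
      using measurable_compose[OF measurable_Pair1'[of x lebesgue lebesgue] meas] by simp
    have Gm: "G \<in> borel_measurable lebesgue"
      using lebesgue.borel_measurable_nn_integral_fst[OF meas] by (simp add: G_def[abs_def])
    have inner: "ennreal ((u x)\<^sup>2) * mA \<le> ennreal K * G x + 2 * U" if x: "x \<in> \<Omega>" for x
    proof -
      have "ennreal ((u x)\<^sup>2) * mA = (\<integral>\<^sup>+y. ennreal ((u x)\<^sup>2) * (weight y * indicator A y) \<partial>lebesgue)"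
        unfolding mA_def by (rule nn_integral_cmult[symmetric]) measurable
      also have "\<dots> \<le> (\<integral>\<^sup>+y. ennreal K * (ennreal (indicator (cross_region \<Omega>) (x, y) / norm (x - y) powr a)
          * ennreal ((difference u (x, y))\<^sup>2)) + 2 * (weight y * ennreal ((u y)\<^sup>2)) \<partial>lebesgue)"
      proof (rule nn_integral_mono_AE)
        show "AE y in lebesgue. ennreal ((u x)\<^sup>2) * (weight y * indicator A y)
            \<le> ennreal K * (ennreal (indicator (cross_region \<Omega>) (x, y) / norm (x - y) powr a)
          * ennreal ((difference u (x, y))\<^sup>2)) + 2 * (weight y * ennreal ((u y)\<^sup>2))"
          using b(2)
        proof eventually_elim
          case (elim y)
          show ?case
          proof (cases "y \<in> A")
            case True
            define n where "n = norm (x - y)"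
            have n: "0 < n" "n \<le> D" using dist[OF x True] by (auto simp: n_def)
            obtain k where k: "0 \<le> k" "weight y = ennreal k" "k \<le> b"
              using elim b(1) by (cases "weight y") (auto simp: top_unique)
            have cross: "indicator (cross_region \<Omega>) (x, y) = (1::real)"
              using x A\<Omega>[OF True] by (simp add: cross_region_def)
            have "(u x)\<^sup>2 \<le> 2 * (u x - u y)\<^sup>2 + 2 * (u y)\<^sup>2"
              using sum_squares_bound[of "u x - u y" "u y"] by (simp add: power2_eq_square algebra_simps)
            then have "(u x)\<^sup>2 * k \<le> (2 * (u x - u y)\<^sup>2 + 2 * (u y)\<^sup>2) * k" using k by (intro mult_right_mono) auto
            also have "\<dots> = 2 * (u x - u y)\<^sup>2 * k + 2 * (k * (u y)\<^sup>2)" by (simp add: algebra_simps)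
            also have "2 * (u x - u y)\<^sup>2 * k \<le> 2 * (u x - u y)\<^sup>2 * (b * (D powr a / n powr a))"
            proof (intro mult_left_mono)
              have "n powr a \<le> D powr a" using n a_pos by (intro powr_mono2) auto
              then have "1 \<le> D powr a / n powr a" using n by simp
              then have "k * 1 \<le> b * (D powr a / n powr a)" using k b by (intro mult_mono) auto
              then show "k \<le> b * (D powr a / n powr a)" by simp
            qed auto
            also have "\<dots> = K * (1 / n powr a * (u x - u y)\<^sup>2)" by (simp add: K_def)
            finally have "ennreal ((u x)\<^sup>2 * k) \<le> ennreal (K * (1 / n powr a * (u x - u y)\<^sup>2) + 2 * (k * (u y)\<^sup>2))"
              by (intro ennreal_leI) simp
            also have "\<dots> = ennreal (K * (1 / n powr a * (u x - u y)\<^sup>2)) + ennreal (2 * (k * (u y)\<^sup>2))"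
              by (rule ennreal_plus) (use k K in auto)
            also have "ennreal (K * (1 / n powr a * (u x - u y)\<^sup>2)) = ennreal K * ennreal (1 / n powr a * (u x - u y)\<^sup>2)"
              by (rule ennreal_mult) (use K in auto)
            also have "ennreal (1 / n powr a * (u x - u y)\<^sup>2) = ennreal (1 / n powr a) * ennreal ((u x - u y)\<^sup>2)"
              by (rule ennreal_mult) auto
            also have "ennreal (2 * (k * (u y)\<^sup>2)) = 2 * ennreal (k * (u y)\<^sup>2)"
              using ennreal_mult[of 2 "k * (u y)\<^sup>2"] k by simp
            also have "ennreal (k * (u y)\<^sup>2) = ennreal k * ennreal ((u y)\<^sup>2)" by (rule ennreal_mult) (use k in auto)
            also have "ennreal ((u x)\<^sup>2 * k) = ennreal ((u x)\<^sup>2) * ennreal k" by (rule ennreal_mult) (use k in auto)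
            finally show ?thesis
              using True by (simp add: cross difference_def n_def[symmetric] k(2))
          qed simp
        qed
      qed
      also have "\<dots> = ennreal K * G x + 2 * U"
        unfolding G_def U using meas1 by (subst nn_integral_add) (auto simp: nn_integral_cmult)
      finally show ?thesis .
    qed
    have "mA * (\<integral>\<^sup>+x. ennreal ((u x)\<^sup>2) \<partial>lebesgue_on \<Omega>) = (\<integral>\<^sup>+x. ennreal ((u x)\<^sup>2) * mA * indicator \<Omega> x \<partial>lebesgue)"
    proof -
      have "(\<integral>\<^sup>+x. ennreal ((u x)\<^sup>2) * mA * indicator \<Omega> x \<partial>lebesgue) = (\<integral>\<^sup>+x. ennreal ((u x)\<^sup>2) * mA \<partial>lebesgue_on \<Omega>)"
        by (rule nn_integral_restrict_space[symmetric]) simp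
      also have "\<dots> = (\<integral>\<^sup>+x. ennreal ((u x)\<^sup>2) \<partial>lebesgue_on \<Omega>) * mA"
        by (rule nn_integral_multc) (use measurable_lebesgue_imp(1)[OF u] in measurable)
      finally show ?thesis by (simp add: mult.commute)
    qed
    also have "\<dots> \<le> (\<integral>\<^sup>+x. ennreal K * G x + 2 * U * indicator \<Omega> x \<partial>lebesgue)"
    proof (rule nn_integral_mono)
      fix x show "ennreal ((u x)\<^sup>2) * mA * indicator \<Omega> x \<le> ennreal K * G x + 2 * U * indicator \<Omega> x"
        using inner[of x] by (cases "x \<in> \<Omega>") auto
    qed
    also have "\<dots> = ennreal K * (\<integral>\<^sup>+x. G x \<partial>lebesgue) + 2 * U * emeasure lebesgue \<Omega>"
      using Gm by (subst nn_integral_add) (auto simp: nn_integral_cmult nn_integral_cmult_indicator)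
    also have "(\<integral>\<^sup>+x. G x \<partial>lebesgue) = (\<integral>\<^sup>+p. ennreal ((difference u p)\<^sup>2) \<partial>gagliardo)"
      unfolding G_def using measurable_lebesgue_imp(4)[OF u] by (intro nn_integral_gagliardo[symmetric]) measurable
    also have "ennreal K * (\<integral>\<^sup>+p. ennreal ((difference u p)\<^sup>2) \<partial>gagliardo) + 2 * U * emeasure lebesgue \<Omega>
        \<le> ennreal (K + 2 * w) * ((\<integral>\<^sup>+p. ennreal ((difference u p)\<^sup>2) \<partial>gagliardo) + U)"
    proof -
      have "2 * U * emeasure lebesgue \<Omega> = ennreal (2 * w) * U"
        using w by (simp add: ennreal_mult mult.commute mult.left_commute)
      moreover have "ennreal K \<le> ennreal (K + 2 * w)" "ennreal (2 * w) \<le> ennreal (K + 2 * w)"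
        using w K by (auto intro: ennreal_leI)
      ultimately show ?thesis unfolding distrib_left by (auto intro!: add_mono mult_right_mono)
    qed
    finally have "ennreal (1 / m) * (ennreal m * (\<integral>\<^sup>+x. ennreal ((u x)\<^sup>2) \<partial>lebesgue_on \<Omega>))
        \<le> ennreal (1 / m) * (ennreal (K + 2 * w) * ((\<integral>\<^sup>+p. ennreal ((difference u p)\<^sup>2) \<partial>gagliardo) + U))"
      unfolding m(2) by (rule mult_left_mono) simp
    moreover have "ennreal (1 / m) * ennreal m = 1" using m by (simp add: ennreal_mult[symmetric])
    moreover have "ennreal (1 / m) * ennreal (K + 2 * w) = ennreal ((K + 2 * w) / m)"
      using m w K ennreal_mult[of "1 / m" "K + 2 * w"] by simp
    ultimately show ?thesis unfolding U_def mult.assoc[symmetric] by simp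
  qed
  show ?thesis by (rule that[OF _ main]) (use m K w in auto)
qed

end

context robin_problem begin

abbreviation W :: "(real ^ 'n \<Rightarrow> real) set" where "W \<equiv> robin_sobolev \<Omega> \<kappa> s"

definition energy :: "(real ^ 'n \<Rightarrow> real) \<Rightarrow> (real ^ 'n \<Rightarrow> real) \<Rightarrow> real" where
  "energy u v = frac_form \<Omega> s u v + (\<integral>x. u x * v x \<partial>\<mu>)"

lemma W_D:
  assumes "u \<in> W"
  shows "u \<in> borel_measurable lebesgue" "u \<in> L2 (lebesgue_on \<Omega>)" "u \<in> L2 \<mu>" "difference u \<in> L2 gagliardo"
  using assms by (auto simp: robin_sobolev_iff)

lemma energy_eq:
  assumes "u \<in> W" "v \<in> W"
  shows "energy u v = frac_const CARD('n) s / 2 * (\<integral>p. difference u p * difference v p \<partial>gagliardo) + (\<integral>x. u x * v x \<partial>\<mu>)"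
  using frac_form_eq[OF W_D(1)[OF assms(1)] W_D(1)[OF assms(2)]] by (simp add: energy_def)

lemma difference_lincomb:
  "difference (\<lambda>x. c * u x + d * v x) = (\<lambda>p. c * difference u p + d * difference v p)"
  by (auto simp: difference_def algebra_simps)

lemma difference_diff: "difference (\<lambda>x. u x - v x) = (\<lambda>p. difference u p - difference v p)"
  by (auto simp: difference_def)

lemma W_lincomb:
  assumes "u \<in> W" "v \<in> W"
  shows "(\<lambda>x. c * u x + d * v x) \<in> W"
  unfolding robin_sobolev_iff difference_lincomb
  using W_D[OF assms(1)] W_D[OF assms(2)] by (auto intro!: L2_lincomb)

lemma W_diff: "u \<in> W \<Longrightarrow> v \<in> W \<Longrightarrow> (\<lambda>x. u x - v x) \<in> W"
  using W_lincomb[of u v 1 "-1"] by simp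

lemma W_I:
  assumes u: "u \<in> borel_measurable lebesgue"
    and "(\<integral>\<^sup>+p. ennreal ((difference u p)\<^sup>2) \<partial>gagliardo) < \<infinity>" "(\<integral>\<^sup>+x. ennreal ((u x)\<^sup>2) \<partial>\<mu>) < \<infinity>"
  shows "u \<in> W"
proof -
  obtain c where "(\<integral>\<^sup>+x. ennreal ((u x)\<^sup>2) \<partial>lebesgue_on \<Omega>)
      \<le> ennreal c * ((\<integral>\<^sup>+p. ennreal ((difference u p)\<^sup>2) \<partial>gagliardo) + (\<integral>\<^sup>+x. ennreal ((u x)\<^sup>2) \<partial>\<mu>))"
    using Poincare_inequality u by metis
  also have "\<dots> < \<infinity>" using assms(2,3) by (simp add: ennreal_mult_less_top)
  finally show ?thesis
    using assms measurable_lebesgue_imp[OF u] by (auto simp: robin_sobolev_iff intro!: L2_I)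
qed

lemma energy_bounds:
  assumes u: "u \<in> W" and e: "energy u u \<le> e"
  shows "(\<integral>\<^sup>+p. ennreal ((difference u p)\<^sup>2) \<partial>gagliardo) \<le> ennreal (2 / frac_const CARD('n) s * e)"
    and "(\<integral>\<^sup>+x. ennreal ((u x)\<^sup>2) \<partial>\<mu>) \<le> ennreal e"
proof -
  note C = frac_const_pos
  have n: "0 \<le> (\<integral>p. difference u p * difference u p \<partial>gagliardo)" "0 \<le> (\<integral>x. u x * u x \<partial>\<mu>)"
    by (auto intro!: integral_nonneg_AE)
  then have "0 \<le> frac_const CARD('n) s / 2 * (\<integral>p. difference u p * difference u p \<partial>gagliardo)" using C by simp
  then have "(\<integral>x. u x * u x \<partial>\<mu>) \<le> e" "frac_const CARD('n) s / 2 * (\<integral>p. difference u p * difference u p \<partial>gagliardo) \<le> e"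
    using e n unfolding energy_eq[OF u u] by linarith+
  moreover from this(2) have "(\<integral>p. difference u p * difference u p \<partial>gagliardo) \<le> 2 / frac_const CARD('n) s * e"
    using C by (simp add: field_simps)
  ultimately show "(\<integral>\<^sup>+p. ennreal ((difference u p)\<^sup>2) \<partial>gagliardo) \<le> ennreal (2 / frac_const CARD('n) s * e)"
    "(\<integral>\<^sup>+x. ennreal ((u x)\<^sup>2) \<partial>\<mu>) \<le> ennreal e"
    unfolding L2_nn_integral[OF W_D(4)[OF u]] L2_nn_integral[OF W_D(3)[OF u]] by (auto intro: ennreal_leI)
qed

lemma energy_le:
  assumes u: "u \<in> W" and e: "e \<ge> 0" "(\<integral>\<^sup>+p. ennreal ((difference u p)\<^sup>2) \<partial>gagliardo) \<le> ennreal e"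
    "(\<integral>\<^sup>+x. ennreal ((u x)\<^sup>2) \<partial>\<mu>) \<le> ennreal e"
  shows "energy u u \<le> (frac_const CARD('n) s / 2 + 1) * e"
proof -
  have "(\<integral>p. difference u p * difference u p \<partial>gagliardo) \<le> e" "(\<integral>x. u x * u x \<partial>\<mu>) \<le> e"
    using e unfolding L2_nn_integral[OF W_D(4)[OF u]] L2_nn_integral[OF W_D(3)[OF u]] by auto
  then have "frac_const CARD('n) s / 2 * (\<integral>p. difference u p * difference u p \<partial>gagliardo) + (\<integral>x. u x * u x \<partial>\<mu>)
      \<le> frac_const CARD('n) s / 2 * e + e" using frac_const_pos by (intro add_mono mult_left_mono) auto
  then show ?thesis unfolding energy_eq[OF u u] by (simp add: algebra_simps)
qed

text \<open>Merging the two measures lets a single subsequence converge almost everywhere, in \<open>\<Omega>\<close> and in its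
  complement.\<close>

lemma nn_integral_\<Omega>_plus_\<mu>:
  assumes f[measurable]: "f \<in> borel_measurable lebesgue"
  shows "(\<integral>\<^sup>+x. f x \<partial>density lebesgue (\<lambda>x. indicator \<Omega> x + weight x)) = (\<integral>\<^sup>+x. f x \<partial>lebesgue_on \<Omega>) + (\<integral>\<^sup>+x. f x \<partial>\<mu>)"
proof -
  have "(\<integral>\<^sup>+x. f x \<partial>density lebesgue (\<lambda>x. indicator \<Omega> x + weight x)) = (\<integral>\<^sup>+x. (indicator \<Omega> x + weight x) * f x \<partial>lebesgue)"
    by (rule nn_integral_density) measurable
  also have "\<dots> = (\<integral>\<^sup>+x. f x * indicator \<Omega> x + weight x * f x \<partial>lebesgue)"
    by (intro nn_integral_cong) (simp only: distrib_right mult.commute[of "indicator \<Omega> _"])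
  also have "\<dots> = (\<integral>\<^sup>+x. f x * indicator \<Omega> x \<partial>lebesgue) + (\<integral>\<^sup>+x. weight x * f x \<partial>lebesgue)"
    by (rule nn_integral_add) measurable
  also have "(\<integral>\<^sup>+x. f x * indicator \<Omega> x \<partial>lebesgue) = (\<integral>\<^sup>+x. f x \<partial>lebesgue_on \<Omega>)"
    by (subst nn_integral_restrict_space) auto
  finally show ?thesis by (simp add: nn_integral_\<mu>[OF f])
qed

text \<open>A Cauchy sequence in energy is Cauchy in \<open>L\<^sup>2(\<mu>)\<close>, and by the Poincare inequality in \<open>L\<^sup>2(\<Omega>)\<close>. Both
  spaces together are one \<open>L\<^sup>2\<close> space, for a measure with positive density on the whole space, so a
  subsequence converges almost everywhere, and Fatou's lemma bounds the energy distance to its limit.\<close>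

lemma energy_complete:
  assumes F: "\<And>n. F n \<in> W"
    and Cauchy: "\<And>e. e > 0 \<Longrightarrow> \<exists>N. \<forall>m\<ge>N. \<forall>n\<ge>N. energy (\<lambda>x. F m x - F n x) (\<lambda>x. F m x - F n x) < e"
  shows "\<exists>f\<in>W. (\<lambda>n. energy (\<lambda>x. F n x - f x) (\<lambda>x. F n x - f x)) \<longlonglongrightarrow> 0"
proof -
  let ?C = "frac_const CARD('n) s"
  note C = frac_const_pos
  obtain c where c: "c > 0" and Poin: "\<And>u. u \<in> borel_measurable lebesgue \<Longrightarrow>
      (\<integral>\<^sup>+x. ennreal ((u x)\<^sup>2) \<partial>lebesgue_on \<Omega>)
      \<le> ennreal c * ((\<integral>\<^sup>+p. ennreal ((difference u p)\<^sup>2) \<partial>gagliardo) + (\<integral>\<^sup>+x. ennreal ((u x)\<^sup>2) \<partial>\<mu>))"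
    using Poincare_inequality by metis
  define M where "M = density lebesgue (\<lambda>x. indicator \<Omega> x + weight x)"
  define K where "K = c * (2 / ?C + 1) + 2 / ?C + 1"
  have K: "K > 0" using c C by (simp add: K_def add_pos_pos)
  note Fm = W_D(1)[OF F]
  have dm: "(\<lambda>x. F m x - F n x) \<in> borel_measurable lebesgue" for m n using Fm by (intro borel_measurable_diff)
  have parts: "\<exists>N. \<forall>m\<ge>N. \<forall>n\<ge>N. (\<integral>\<^sup>+x. ennreal ((F m x - F n x)\<^sup>2) \<partial>M) \<le> ennreal e
      \<and> (\<integral>\<^sup>+p. ennreal ((difference (F m) p - difference (F n) p)\<^sup>2) \<partial>gagliardo) \<le> ennreal e
      \<and> (\<integral>\<^sup>+x. ennreal ((F m x - F n x)\<^sup>2) \<partial>\<mu>) \<le> ennreal e" if e: "e > 0" for e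
  proof -
    obtain N where N: "\<And>m n. m \<ge> N \<Longrightarrow> n \<ge> N \<Longrightarrow> energy (\<lambda>x. F m x - F n x) (\<lambda>x. F m x - F n x) < e / K"
      using Cauchy[of "e / K"] e K by auto
    have "(\<integral>\<^sup>+x. ennreal ((F m x - F n x)\<^sup>2) \<partial>M) \<le> ennreal e
      \<and> (\<integral>\<^sup>+p. ennreal ((difference (F m) p - difference (F n) p)\<^sup>2) \<partial>gagliardo) \<le> ennreal e
      \<and> (\<integral>\<^sup>+x. ennreal ((F m x - F n x)\<^sup>2) \<partial>\<mu>) \<le> ennreal e" if "m \<ge> N" "n \<ge> N" for m n
    proof -
      define G where "G = (\<integral>\<^sup>+p. ennreal ((difference (F m) p - difference (F n) p)\<^sup>2) \<partial>gagliardo)"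
      define U where "U = (\<integral>\<^sup>+x. ennreal ((F m x - F n x)\<^sup>2) \<partial>\<mu>)"
      have GU: "G \<le> ennreal (2 / ?C * (e / K))" "U \<le> ennreal (e / K)"
        using energy_bounds[OF W_diff[OF F F] less_imp_le[OF N[OF that]]] by (simp_all add: G_def U_def difference_diff)
      have "(\<integral>\<^sup>+x. ennreal ((F m x - F n x)\<^sup>2) \<partial>M) = (\<integral>\<^sup>+x. ennreal ((F m x - F n x)\<^sup>2) \<partial>lebesgue_on \<Omega>) + U"
        unfolding M_def U_def using dm by (intro nn_integral_\<Omega>_plus_\<mu>) simp
      also have "(\<integral>\<^sup>+x. ennreal ((F m x - F n x)\<^sup>2) \<partial>lebesgue_on \<Omega>) \<le> ennreal c * (G + U)"
        using Poin[OF dm, of m n] by (simp add: G_def U_def difference_diff)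
      finally have "(\<integral>\<^sup>+x. ennreal ((F m x - F n x)\<^sup>2) \<partial>M) \<le> ennreal c * (G + U) + U" by (simp add: add_right_mono)
      also have "\<dots> \<le> ennreal c * (ennreal (2 / ?C * (e / K)) + ennreal (e / K)) + ennreal (e / K)"
        using GU by (intro add_mono mult_left_mono) auto
      also have "\<dots> = ennreal (c * (2 / ?C * (e / K) + e / K) + e / K)"
        using c C e K by (simp add: ennreal_mult[symmetric] ennreal_plus[symmetric] del: ennreal_plus)
      also have "\<dots> \<le> ennreal e"
      proof (rule ennreal_leI)
        have "c * (2 / ?C * (e / K) + e / K) + e / K = (c * (2 / ?C + 1) + 1) * (e / K)" by (simp add: algebra_simps)
        also have "\<dots> \<le> K * (e / K)" using C e K by (intro mult_right_mono) (auto simp: K_def)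
        finally show "c * (2 / ?C * (e / K) + e / K) + e / K \<le> e" using K by simp
      qed
      finally have 1: "(\<integral>\<^sup>+x. ennreal ((F m x - F n x)\<^sup>2) \<partial>M) \<le> ennreal e" .
      have K1: "2 / ?C \<le> K" "1 \<le> K" using c C by (auto simp: K_def)
      have "2 / ?C * (e / K) \<le> K * (e / K)" "1 * (e / K) \<le> K * (e / K)"
        using K1 e K by (intro mult_right_mono; simp)+
      then have "2 / ?C * (e / K) \<le> e" "e / K \<le> e" using K by auto
      then have "G \<le> ennreal e" "U \<le> ennreal e" using GU by (meson ennreal_leI order_trans)+
      with 1 show ?thesis by (simp add: G_def U_def)
    qed
    then show ?thesis by blast
  qed
  have sets_M: "sets M = sets lebesgue" by (simp add: M_def)
  have measM: "borel_measurable M = borel_measurable lebesgue" by (rule measurable_cong_sets) (simp_all add: sets_M)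
  have CauchyM: "\<exists>N. \<forall>m\<ge>N. \<forall>n\<ge>N. (\<integral>\<^sup>+x. ennreal ((F m x - F n x)\<^sup>2) \<partial>M) \<le> ennreal e" if "e > 0" for e
    using parts[OF that] by blast
  have FM: "F n \<in> borel_measurable M" for n unfolding measM by (rule Fm)
  obtain r f where r: "strict_mono (r :: nat \<Rightarrow> nat)" and fM: "f \<in> borel_measurable M"
    and limM: "AE x in M. (\<lambda>k. F (r k) x) \<longlonglongrightarrow> f x"
    by (rule L2_Cauchy_AE_subsequence[OF FM CauchyM]) (assumption, (rule that; assumption))
  have f: "f \<in> borel_measurable lebesgue" using fM by (simp add: measM)
  have lim: "AE x in lebesgue. (\<lambda>k. F (r k) x) \<longlonglongrightarrow> f x"
  proof -
    have "AE x in lebesgue. 0 < indicator \<Omega> x + weight x \<longrightarrow> (\<lambda>k. F (r k) x) \<longlonglongrightarrow> f x"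
      using limM unfolding M_def by (subst (asm) AE_density) measurable
    with weight_pos show ?thesis
      by eventually_elim (auto split: split_indicator_asm)
  qed
  note lims = AE_lebesgue_imp(2)[OF lim] AE_lebesgue_imp(3)[OF lim]
  have close: "\<exists>N. \<forall>n\<ge>N. (\<integral>\<^sup>+p. ennreal ((difference (\<lambda>x. F n x - f x) p)\<^sup>2) \<partial>gagliardo) \<le> ennreal e
      \<and> (\<integral>\<^sup>+x. ennreal ((F n x - f x)\<^sup>2) \<partial>\<mu>) \<le> ennreal e" if e: "e > 0" for e
  proof -
    obtain N where N: "\<And>m n. m \<ge> N \<Longrightarrow> n \<ge> N \<Longrightarrow>
        (\<integral>\<^sup>+p. ennreal ((difference (F m) p - difference (F n) p)\<^sup>2) \<partial>gagliardo) \<le> ennreal e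
      \<and> (\<integral>\<^sup>+x. ennreal ((F m x - F n x)\<^sup>2) \<partial>\<mu>) \<le> ennreal e"
      using parts[OF e] by blast
    have ev: "\<forall>\<^sub>F k in sequentially. r k \<ge> N"
      using seq_suble[OF r] by (intro eventually_sequentiallyI[of N]) (auto intro: order_trans)
    have "(\<integral>\<^sup>+p. ennreal ((difference (\<lambda>x. F n x - f x) p)\<^sup>2) \<partial>gagliardo) \<le> ennreal e
      \<and> (\<integral>\<^sup>+x. ennreal ((F n x - f x)\<^sup>2) \<partial>\<mu>) \<le> ennreal e" if n: "n \<ge> N" for n
    proof
      show "(\<integral>\<^sup>+p. ennreal ((difference (\<lambda>x. F n x - f x) p)\<^sup>2) \<partial>gagliardo) \<le> ennreal e"
        unfolding difference_diff
      proof (rule nn_integral_square_le_of_limit[where G = "\<lambda>k p. difference (F n) p - difference (F (r k)) p"])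
        show "(\<lambda>p. difference (F n) p - difference (F (r k)) p) \<in> borel_measurable gagliardo" for k
          using measurable_lebesgue_imp(3)[OF Fm] by (intro borel_measurable_diff)
        show "AE p in gagliardo. (\<lambda>k. difference (F n) p - difference (F (r k)) p) \<longlonglongrightarrow> difference (F n) p - difference f p"
          using lims(2) by eventually_elim (auto simp: difference_def intro!: tendsto_intros)
        show "\<forall>\<^sub>F k in sequentially. (\<integral>\<^sup>+p. ennreal ((difference (F n) p - difference (F (r k)) p)\<^sup>2) \<partial>gagliardo) \<le> ennreal e"
          using ev by (rule eventually_mono) (use N n in blast)
      qed
      show "(\<integral>\<^sup>+x. ennreal ((F n x - f x)\<^sup>2) \<partial>\<mu>) \<le> ennreal e"
      proof (rule nn_integral_square_le_of_limit[where G = "\<lambda>k x. F n x - F (r k) x"])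
        show "(\<lambda>x. F n x - F (r k) x) \<in> borel_measurable \<mu>" for k
          using measurable_lebesgue_imp(2)[OF Fm] by (intro borel_measurable_diff)
        show "AE x in \<mu>. (\<lambda>k. F n x - F (r k) x) \<longlonglongrightarrow> F n x - f x"
          using lims(1) by eventually_elim (auto intro!: tendsto_intros)
        show "\<forall>\<^sub>F k in sequentially. (\<integral>\<^sup>+x. ennreal ((F n x - F (r k) x)\<^sup>2) \<partial>\<mu>) \<le> ennreal e"
          using ev by (rule eventually_mono) (use N n in blast)
      qed
    qed
    then show ?thesis by blast
  qed
  obtain N where N: "(\<integral>\<^sup>+p. ennreal ((difference (\<lambda>x. F N x - f x) p)\<^sup>2) \<partial>gagliardo) \<le> ennreal 1"
    "(\<integral>\<^sup>+x. ennreal ((F N x - f x)\<^sup>2) \<partial>\<mu>) \<le> ennreal 1" using close[of 1] by auto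
  have "(\<lambda>x. F N x - f x) \<in> W"
    using N Fm f by (intro W_I borel_measurable_diff) (auto intro: le_less_trans)
  from W_diff[OF F this, of N] have fW: "f \<in> W" by simp
  have "(\<lambda>n. energy (\<lambda>x. F n x - f x) (\<lambda>x. F n x - f x)) \<longlonglongrightarrow> 0"
  proof (rule LIMSEQ_I)
    fix e :: real assume e: "e > 0"
    let ?D = "?C / 2 + 1"
    have D: "?D > 0" using C by simp
    have e': "e / (2 * ?D) > 0" using e D by (intro divide_pos_pos) auto
    obtain N where N: "\<And>n. n \<ge> N \<Longrightarrow> (\<integral>\<^sup>+p. ennreal ((difference (\<lambda>x. F n x - f x) p)\<^sup>2) \<partial>gagliardo) \<le> ennreal (e / (2 * ?D))
      \<and> (\<integral>\<^sup>+x. ennreal ((F n x - f x)\<^sup>2) \<partial>\<mu>) \<le> ennreal (e / (2 * ?D))"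
      using close[OF e'] by blast
    have "norm (energy (\<lambda>x. F n x - f x) (\<lambda>x. F n x - f x) - 0) < e" if "n \<ge> N" for n
    proof -
      note d = W_diff[OF F fW, of n]
      have "energy (\<lambda>x. F n x - f x) (\<lambda>x. F n x - f x) \<le> ?D * (e / (2 * ?D))"
        using e' N[OF that] by (intro energy_le[OF d]) auto
      also have "\<dots> = e / 2" using D by (simp only: times_divide_eq_right) (simp add: divide_simps)
      finally have "energy (\<lambda>x. F n x - f x) (\<lambda>x. F n x - f x) \<le> e / 2" .
      moreover have "0 \<le> energy (\<lambda>x. F n x - f x) (\<lambda>x. F n x - f x)"
        unfolding energy_eq[OF d d] using C by (intro add_nonneg_nonneg mult_nonneg_nonneg integral_nonneg_AE) auto
      ultimately show ?thesis using e by simp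
    qed
    then show "\<exists>N. \<forall>n\<ge>N. norm (energy (\<lambda>x. F n x - f x) (\<lambda>x. F n x - f x) - 0) < e" by blast
  qed
  with fW show ?thesis by blast
qed

lemma semi_hilbert_energy: "semi_hilbert W energy"
proof
  interpret G: semi_hilbert "L2 gagliardo" "\<lambda>f g. \<integral>p. f p * g p \<partial>gagliardo" by (rule semi_hilbert_L2)
  interpret U: semi_hilbert "L2 \<mu>" "\<lambda>f g. \<integral>x. f x * g x \<partial>\<mu>" by (rule semi_hilbert_L2)
  show "(\<lambda>x. 0) \<in> W" by (rule W_I) (simp_all add: difference_def)
  show "(\<lambda>x. c * f x + d * g x) \<in> W" if "f \<in> W" "g \<in> W" for f g c d using that by (rule W_lincomb)
  show "energy f g = energy g f" if "f \<in> W" "g \<in> W" for f g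
    using that by (simp add: energy_eq mult.commute)
  show "energy (\<lambda>x. c * f x + d * g x) h = c * energy f h + d * energy g h" if "f \<in> W" "g \<in> W" "h \<in> W" for f g h c d
    unfolding energy_eq[OF W_lincomb[OF that(1,2)] that(3)] energy_eq[OF that(1,3)] energy_eq[OF that(2,3)] difference_lincomb
      G.linear[OF W_D(4)[OF that(1)] W_D(4)[OF that(2)] W_D(4)[OF that(3)]]
      U.linear[OF W_D(3)[OF that(1)] W_D(3)[OF that(2)] W_D(3)[OF that(3)]]
    by (simp add: algebra_simps)
  show "0 \<le> energy f f" if "f \<in> W" for f
    unfolding energy_eq[OF that that] using frac_const_pos
    by (intro add_nonneg_nonneg mult_nonneg_nonneg integral_nonneg_AE) auto
qed (rule energy_complete)

end

section \<open>Weak solutions\<close>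

context robin_problem begin

abbreviation Z :: "(real ^ 'n \<Rightarrow> real) set" where "Z \<equiv> L2 \<mu>"

lemma \<mu>_norm_le_energy:
  assumes "u \<in> W"
  shows "(\<integral>x. u x * u x \<partial>\<mu>) \<le> energy u u"
proof -
  have "0 \<le> (\<integral>p. difference u p * difference u p \<partial>gagliardo)" by (auto intro!: integral_nonneg_AE)
  then have "0 \<le> frac_const CARD('n) s / 2 * (\<integral>p. difference u p * difference u p \<partial>gagliardo)"
    using frac_const_pos by simp
  then show ?thesis by (simp add: energy_eq[OF assms assms])
qed

lemma weak_solution_iff:
  "robin_weak_solution \<Omega> \<kappa> s z u \<longleftrightarrow> u \<in> W \<and> (\<forall>v\<in>W. energy u v = (\<integral>x. z x * v x \<partial>\<mu>))"
  by (simp add: robin_weak_solution_def energy_def)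

text \<open>The state equation asks for the Riesz representative, with respect to the energy, of the functional
  \<open>v \<mapsto> \<integral> z v d\<mu>\<close>.\<close>

lemma weak_solution_exists:
  assumes z: "z \<in> Z"
  shows "\<exists>u. robin_weak_solution \<Omega> \<kappa> s z u"
proof -
  interpret U: semi_hilbert Z "\<lambda>f g. \<integral>x. f x * g x \<partial>\<mu>" by (rule semi_hilbert_L2)
  interpret E: semi_hilbert W energy by (rule semi_hilbert_energy)
  have "\<exists>u\<in>W. \<forall>v\<in>W. energy u v = (\<integral>x. z x * v x \<partial>\<mu>)"
  proof (rule E.Riesz_representation)
    show "(\<integral>x. z x * (c * v x + d * v' x) \<partial>\<mu>) = c * (\<integral>x. z x * v x \<partial>\<mu>) + d * (\<integral>x. z x * v' x \<partial>\<mu>)"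
      if "v \<in> W" "v' \<in> W" for v v' c d
      by (rule U.linear_right[OF W_D(3)[OF that(1)] W_D(3)[OF that(2)] z])
    show "\<bar>\<integral>x. z x * v x \<partial>\<mu>\<bar> \<le> sqrt (\<integral>x. z x * z x \<partial>\<mu>) * sqrt (energy v v)" if v: "v \<in> W" for v
    proof -
      have "\<bar>\<integral>x. z x * v x \<partial>\<mu>\<bar> \<le> sqrt (\<integral>x. z x * z x \<partial>\<mu>) * sqrt (\<integral>x. v x * v x \<partial>\<mu>)"
        by (rule U.Cauchy_Schwarz_abs[OF z W_D(3)[OF v]])
      also have "\<dots> \<le> sqrt (\<integral>x. z x * z x \<partial>\<mu>) * sqrt (energy v v)"
        using \<mu>_norm_le_energy[OF v] U.nonneg[OF z] by (intro mult_left_mono) auto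
      finally show ?thesis .
    qed
  qed
  then show ?thesis by (auto simp: weak_solution_iff)
qed

lemma robin_state_solution: "z \<in> Z \<Longrightarrow> robin_weak_solution \<Omega> \<kappa> s z (robin_state \<Omega> \<kappa> s z)"
  unfolding robin_state_def using weak_solution_exists[of z] by (rule someI_ex)

lemma weak_solution_lincomb:
  assumes "z \<in> Z" "z' \<in> Z" "robin_weak_solution \<Omega> \<kappa> s z u" "robin_weak_solution \<Omega> \<kappa> s z' u'"
  shows "robin_weak_solution \<Omega> \<kappa> s (\<lambda>x. c * z x + d * z' x) (\<lambda>x. c * u x + d * u' x)"
proof -
  interpret U: semi_hilbert Z "\<lambda>f g. \<integral>x. f x * g x \<partial>\<mu>" by (rule semi_hilbert_L2)
  interpret E: semi_hilbert W energy by (rule semi_hilbert_energy)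
  have u: "u \<in> W" "u' \<in> W" using assms by (auto simp: weak_solution_iff)
  show ?thesis
    unfolding weak_solution_iff
  proof (intro conjI ballI)
    show "(\<lambda>x. c * u x + d * u' x) \<in> W" by (rule E.lincomb_mem[OF u])
    fix v assume v: "v \<in> W"
    have "energy (\<lambda>x. c * u x + d * u' x) v = c * energy u v + d * energy u' v" by (rule E.linear[OF u v])
    also have "\<dots> = c * (\<integral>x. z x * v x \<partial>\<mu>) + d * (\<integral>x. z' x * v x \<partial>\<mu>)"
      using assms v by (simp add: weak_solution_iff)
    also have "\<dots> = (\<integral>x. (c * z x + d * z' x) * v x \<partial>\<mu>)"
      by (rule U.linear[OF assms(1,2) W_D(3)[OF v], symmetric])
    finally show "energy (\<lambda>x. c * u x + d * u' x) v = (\<integral>x. (c * z x + d * z' x) * v x \<partial>\<mu>)" .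
  qed
qed

lemma weak_solution_unique:
  assumes z: "z \<in> Z" and u: "robin_weak_solution \<Omega> \<kappa> s z u" "robin_weak_solution \<Omega> \<kappa> s z u'"
  shows "AE x in lebesgue_on \<Omega>. u x = u' x"
proof -
  define d where "d x = u x - u' x" for x
  have "robin_weak_solution \<Omega> \<kappa> s (\<lambda>x. 1 * z x + (-1) * z x) (\<lambda>x. 1 * u x + (-1) * u' x)"
    by (rule weak_solution_lincomb[OF z z u])
  then have d: "robin_weak_solution \<Omega> \<kappa> s (\<lambda>x. 0) d" by (simp add: d_def[abs_def])
  then have dW: "d \<in> W" and "energy d d = 0" by (auto simp: weak_solution_iff)
  then have zero: "(\<integral>\<^sup>+p. ennreal ((difference d p)\<^sup>2) \<partial>gagliardo) = 0" "(\<integral>\<^sup>+x. ennreal ((d x)\<^sup>2) \<partial>\<mu>) = 0"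
    using energy_bounds[OF dW, of 0] by simp_all
  obtain c where "(\<integral>\<^sup>+x. ennreal ((d x)\<^sup>2) \<partial>lebesgue_on \<Omega>)
      \<le> ennreal c * ((\<integral>\<^sup>+p. ennreal ((difference d p)\<^sup>2) \<partial>gagliardo) + (\<integral>\<^sup>+x. ennreal ((d x)\<^sup>2) \<partial>\<mu>))"
    using Poincare_inequality W_D(1)[OF dW] by metis
  then have "(\<integral>\<^sup>+x. ennreal ((d x)\<^sup>2) \<partial>lebesgue_on \<Omega>) = 0" unfolding zero by simp
  moreover have "(\<lambda>x. ennreal ((d x)\<^sup>2)) \<in> borel_measurable (lebesgue_on \<Omega>)"
    using L2_measurable[OF W_D(2)[OF dW]] by measurable
  ultimately have "AE x in lebesgue_on \<Omega>. ennreal ((d x)\<^sup>2) = 0" by (simp add: nn_integral_0_iff_AE)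
  then show ?thesis by eventually_elim (simp add: d_def ennreal_eq_0_iff)
qed

text \<open>Testing the state equation with the adjoint state \<open>w\<close> of \<open>\<phi>\<close> gives
  \<open>\<integral>\<^sub>\<Omega> u \<phi> = energy w u = energy u w = \<integral> z w d\<mu>\<close>, and the right-hand side converges.\<close>

lemma weak_solution_weakly_continuous:
  assumes z: "\<And>n. z n \<in> Z" "z0 \<in> Z" and lim: "L2_weak_tendsto \<mu> z z0"
    and u: "\<And>n. robin_weak_solution \<Omega> \<kappa> s (z n) (u n)" "robin_weak_solution \<Omega> \<kappa> s z0 u0"
  shows "L2_weak_tendsto (lebesgue_on \<Omega>) u u0"
  unfolding L2_weak_tendsto_def
proof
  interpret O: semi_hilbert "L2 (lebesgue_on \<Omega>)" "\<lambda>f g. \<integral>x. f x * g x \<partial>lebesgue_on \<Omega>" by (rule semi_hilbert_L2)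
  interpret E: semi_hilbert W energy by (rule semi_hilbert_energy)
  fix \<phi> assume \<phi>: "\<phi> \<in> L2 (lebesgue_on \<Omega>)"
  let ?C = "frac_const CARD('n) s"
  obtain c where c: "c > 0" and Poin: "\<And>u. u \<in> borel_measurable lebesgue \<Longrightarrow>
      (\<integral>\<^sup>+x. ennreal ((u x)\<^sup>2) \<partial>lebesgue_on \<Omega>)
      \<le> ennreal c * ((\<integral>\<^sup>+p. ennreal ((difference u p)\<^sup>2) \<partial>gagliardo) + (\<integral>\<^sup>+x. ennreal ((u x)\<^sup>2) \<partial>\<mu>))"
    using Poincare_inequality by metis
  define K where "K = c * (2 / ?C + 1)"
  have K: "K \<ge> 0" using c frac_const_pos by (simp add: K_def)
  have O_le: "(\<integral>x. v x * v x \<partial>lebesgue_on \<Omega>) \<le> K * energy v v" if v: "v \<in> W" for v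
  proof -
    define e where "e = energy v v"
    have e: "e \<ge> 0" unfolding e_def by (rule E.nonneg[OF v])
    have "ennreal (\<integral>x. v x * v x \<partial>lebesgue_on \<Omega>) \<le> ennreal c * ((\<integral>\<^sup>+p. ennreal ((difference v p)\<^sup>2) \<partial>gagliardo) + (\<integral>\<^sup>+x. ennreal ((v x)\<^sup>2) \<partial>\<mu>))"
      using Poin[OF W_D(1)[OF v]] unfolding L2_nn_integral[OF W_D(2)[OF v]] .
    also have "\<dots> \<le> ennreal c * (ennreal (2 / ?C * e) + ennreal e)"
      using energy_bounds[OF v, of e] by (intro mult_left_mono add_mono) (auto simp: e_def)
    also have "ennreal (2 / ?C * e) + ennreal e = ennreal (2 / ?C * e + e)"
      by (rule ennreal_plus[symmetric]) (use e frac_const_pos in auto)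
    also have "ennreal c * ennreal (2 / ?C * e + e) = ennreal (c * (2 / ?C * e + e))"
      by (rule ennreal_mult[symmetric]) (use c e frac_const_pos in auto)
    also have "c * (2 / ?C * e + e) = K * e" by (simp add: K_def algebra_simps)
    finally show ?thesis using K e by (simp add: e_def[symmetric])
  qed
  have "\<exists>w\<in>W. \<forall>v\<in>W. energy w v = (\<integral>x. \<phi> x * v x \<partial>lebesgue_on \<Omega>)"
  proof (rule E.Riesz_representation)
    show "(\<integral>x. \<phi> x * (c * v x + d * v' x) \<partial>lebesgue_on \<Omega>)
        = c * (\<integral>x. \<phi> x * v x \<partial>lebesgue_on \<Omega>) + d * (\<integral>x. \<phi> x * v' x \<partial>lebesgue_on \<Omega>)"
      if "v \<in> W" "v' \<in> W" for v v' c d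
      by (rule O.linear_right[OF W_D(2)[OF that(1)] W_D(2)[OF that(2)] \<phi>])
    show "\<bar>\<integral>x. \<phi> x * v x \<partial>lebesgue_on \<Omega>\<bar> \<le> sqrt (\<integral>x. \<phi> x * \<phi> x \<partial>lebesgue_on \<Omega>) * sqrt K * sqrt (energy v v)" if v: "v \<in> W" for v
    proof -
      have "\<bar>\<integral>x. \<phi> x * v x \<partial>lebesgue_on \<Omega>\<bar>
          \<le> sqrt (\<integral>x. \<phi> x * \<phi> x \<partial>lebesgue_on \<Omega>) * sqrt (\<integral>x. v x * v x \<partial>lebesgue_on \<Omega>)"
        by (rule O.Cauchy_Schwarz_abs[OF \<phi> W_D(2)[OF v]])
      also have "\<dots> \<le> sqrt (\<integral>x. \<phi> x * \<phi> x \<partial>lebesgue_on \<Omega>) * sqrt (K * energy v v)"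
        using O_le[OF v] O.nonneg[OF \<phi>] by (intro mult_left_mono real_sqrt_le_mono real_sqrt_ge_zero)
      finally show ?thesis by (simp add: real_sqrt_mult mult.assoc)
    qed
  qed
  then obtain w where w: "w \<in> W" and wv: "\<And>v. v \<in> W \<Longrightarrow> energy w v = (\<integral>x. \<phi> x * v x \<partial>lebesgue_on \<Omega>)"
    by blast
  have eq: "(\<integral>x. u' x * \<phi> x \<partial>lebesgue_on \<Omega>) = (\<integral>x. z' x * w x \<partial>\<mu>)" if "robin_weak_solution \<Omega> \<kappa> s z' u'" for z' u'
  proof -
    have u': "u' \<in> W" using that by (simp add: weak_solution_iff)
    have "(\<integral>x. u' x * \<phi> x \<partial>lebesgue_on \<Omega>) = energy w u'" using wv[OF u'] by (simp add: mult.commute)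
    also have "\<dots> = energy u' w" by (rule E.sym[OF w u'])
    also have "\<dots> = (\<integral>x. z' x * w x \<partial>\<mu>)" using that w by (simp add: weak_solution_iff)
    finally show ?thesis .
  qed
  show "(\<lambda>n. \<integral>x. u n x * \<phi> x \<partial>lebesgue_on \<Omega>) \<longlonglongrightarrow> (\<integral>x. u0 x * \<phi> x \<partial>lebesgue_on \<Omega>)"
    unfolding eq[OF u(1)] eq[OF u(2)] using lim W_D(3)[OF w] by (simp add: L2_weak_tendsto_def)
qed

end

section \<open>Injectivity of the control-to-state map\<close>

context robin_problem begin

lemma nn_integral_lebesgue_kernel:
  "(\<integral>\<^sup>+y. ennreal (min 1 ((norm (x - y))\<^sup>2) * norm (x - y) powr (- a)) \<partial>lebesgue)
    = (\<integral>\<^sup>+h. ennreal (min 1 ((norm h)\<^sup>2) * norm h powr (- a)) \<partial>(lborel :: (real ^ 'n) measure))" for x :: "real ^ 'n"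
proof -
  have "(\<integral>\<^sup>+y. ennreal (min 1 ((norm (x - y))\<^sup>2) * norm (x - y) powr (- a)) \<partial>lebesgue)
      = (\<integral>\<^sup>+y. ennreal (min 1 ((norm (y - x))\<^sup>2) * norm (y - x) powr (- a)) \<partial>lborel)"
    by (simp add: nn_integral_completion norm_minus_commute)
  also have "\<dots> = (\<integral>\<^sup>+h. ennreal (min 1 ((norm h)\<^sup>2) * norm h powr (- a)) \<partial>(lborel :: (real ^ 'n) measure))"
    by (rule nn_integral_lborel_translate) measurable
  finally show ?thesis .
qed

lemma finite_\<mu>: "emeasure \<mu> (space \<mu>) < \<infinity>"
proof -
  have "emeasure \<mu> (space \<mu>) = (\<integral>\<^sup>+x. 1 \<partial>\<mu>)" by simp
  also have "\<dots> = (\<integral>\<^sup>+x. ennreal (\<kappa> x) \<partial>lebesgue_on (- \<Omega>))"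
    unfolding robin_measure_def using \<kappa>_integrable by (subst nn_integral_density) auto
  also have "\<dots> < \<infinity>" using \<kappa>_integrable by (simp add: real_integrable_def less_top)
  finally show ?thesis .
qed

text \<open>Differences of \<open>v\<close> satisfy \<open>(v x - v y)\<^sup>2 \<le> C min 1 |x - y|\<^sup>2\<close>, so the Gagliardo integral is bounded
  by the integral of the truncated kernel times twice the measure of \<open>\<Omega>\<close>.\<close>

lemma bounded_Lipschitz_in_W:
  assumes lip: "L-lipschitz_on UNIV v" and bd: "\<And>x. \<bar>v x\<bar> \<le> M"
  shows "v \<in> W"
proof (rule W_I)
  show vm: "v \<in> borel_measurable lebesgue"
    by (intro lebesgue_measurable_borel borel_measurable_continuous_onI lipschitz_on_continuous_on[OF lip])
  have M: "M \<ge> 0" using bd[of 0] by linarith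
  have L: "L \<ge> 0" using lip by (rule lipschitz_on_nonneg)
  have "(\<integral>\<^sup>+x. ennreal ((v x)\<^sup>2) \<partial>\<mu>) \<le> (\<integral>\<^sup>+x. ennreal (M\<^sup>2) \<partial>\<mu>)"
    using bd M by (intro nn_integral_mono ennreal_leI) (simp add: abs_le_square_iff[symmetric])
  also have "\<dots> < \<infinity>" using finite_\<mu> by (simp add: ennreal_mult_less_top)
  finally show "(\<integral>\<^sup>+x. ennreal ((v x)\<^sup>2) \<partial>\<mu>) < \<infinity>" .
  define C where "C = max (L\<^sup>2) (4 * M\<^sup>2)"
  have C: "C \<ge> 0" by (simp add: C_def le_max_iff_disj)
  define k where "k h = min 1 ((norm h)\<^sup>2) * norm h powr (- a)" for h :: "real ^ 'n"
  have k: "k h \<ge> 0" for h by (simp add: k_def)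
  define I where "I = (\<integral>\<^sup>+h. ennreal (k h) \<partial>(lborel :: (real ^ 'n) measure))"
  have I: "I < \<infinity>" using fractional_kernel_nn_integral_finite[OF s, where 'a = "real ^ 'n"] by (simp add: I_def k_def a_def)
  have sq: "(v x - v y)\<^sup>2 \<le> C * min 1 ((norm (x - y))\<^sup>2)" for x y
  proof -
    have "\<bar>v x - v y\<bar> \<le> L * norm (x - y)" using lipschitz_onD[OF lip, of x y] by (simp add: dist_norm)
    then have "(v x - v y)\<^sup>2 \<le> (L * norm (x - y))\<^sup>2" by (metis abs_ge_zero power2_abs power_mono)
    also have "\<dots> \<le> C * (norm (x - y))\<^sup>2" unfolding power_mult_distrib C_def by (intro mult_right_mono) auto
    finally have 1: "(v x - v y)\<^sup>2 \<le> C * (norm (x - y))\<^sup>2" .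
    have "\<bar>v x - v y\<bar> \<le> 2 * M" using bd[of x] bd[of y] by linarith
    then have "(v x - v y)\<^sup>2 \<le> (2 * M)\<^sup>2" by (metis abs_ge_zero power2_abs power_mono)
    also have "\<dots> \<le> C" by (simp add: C_def power_mult_distrib)
    finally show ?thesis using 1 by (simp add: min_def)
  qed
  have pw: "ennreal (indicator (cross_region \<Omega>) (x, y) / norm (x - y) powr a) * ennreal ((difference v (x, y))\<^sup>2)
      \<le> ennreal (C * k (x - y)) * (indicator \<Omega> x + indicator \<Omega> y)" for x y
  proof (cases "x \<in> \<Omega> \<or> y \<in> \<Omega>")
    case True
    have "indicator (cross_region \<Omega>) (x, y) / norm (x - y) powr a * (v x - v y)\<^sup>2
        \<le> 1 / norm (x - y) powr a * (C * min 1 ((norm (x - y))\<^sup>2))"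
      by (intro mult_mono sq divide_right_mono) (auto simp: indicator_def)
    also have "\<dots> = C * k (x - y)" by (simp add: k_def powr_minus divide_inverse)
    finally have "ennreal (indicator (cross_region \<Omega>) (x, y) / norm (x - y) powr a * (v x - v y)\<^sup>2) \<le> ennreal (C * k (x - y)) * 1"
      by (simp add: ennreal_leI)
    also have "\<dots> \<le> ennreal (C * k (x - y)) * (indicator \<Omega> x + indicator \<Omega> y)"
      using True by (intro mult_left_mono) (auto simp: indicator_def)
    also have "ennreal (indicator (cross_region \<Omega>) (x, y) / norm (x - y) powr a * (v x - v y)\<^sup>2)
        = ennreal (indicator (cross_region \<Omega>) (x, y) / norm (x - y) powr a) * ennreal ((v x - v y)\<^sup>2)"
      by (rule ennreal_mult) auto
    finally show ?thesis by (simp only: difference_def fst_conv snd_conv)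
  qed (auto simp: cross_region_def)
  have kb: "k \<in> borel_measurable borel" unfolding k_def by measurable
  have kc: "(\<lambda>y. k (x - y)) \<in> borel_measurable borel" "(\<lambda>y. k (y - x)) \<in> borel_measurable borel"
    "(\<lambda>p. k (fst p - snd p)) \<in> borel_measurable (borel \<Otimes>\<^sub>M borel)" for x
    by (rule measurable_compose[OF _ kb], measurable)+
  have kxm: "(\<lambda>y. ennreal (C * k (x - y))) \<in> borel_measurable lebesgue" "(\<lambda>y. ennreal (C * k (y - x))) \<in> borel_measurable lebesgue" for x
    using kc by (intro lebesgue_measurable_borel measurable_compose[OF _ measurable_ennreal] borel_measurable_times; simp)+
  have kint: "(\<integral>\<^sup>+y. ennreal (C * k (x - y)) \<partial>lebesgue) = ennreal C * I" "(\<integral>\<^sup>+y. ennreal (C * k (y - x)) \<partial>lebesgue) = ennreal C * I" for x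
  proof -
    have sym: "k (x - y) = k (y - x)" for x y by (simp add: k_def norm_minus_commute)
    have "(\<integral>\<^sup>+y. ennreal (C * k (x - y)) \<partial>lebesgue) = (\<integral>\<^sup>+y. ennreal C * ennreal (k (x - y)) \<partial>lebesgue)"
      using C k by (simp add: ennreal_mult)
    also have "\<dots> = ennreal C * (\<integral>\<^sup>+y. ennreal (k (x - y)) \<partial>lebesgue)"
      by (intro nn_integral_cmult lebesgue_measurable_borel measurable_compose[OF kc(1) measurable_ennreal])
    also have "(\<integral>\<^sup>+y. ennreal (k (x - y)) \<partial>lebesgue) = I" unfolding I_def k_def by (rule nn_integral_lebesgue_kernel)
    finally show 1: "(\<integral>\<^sup>+y. ennreal (C * k (x - y)) \<partial>lebesgue) = ennreal C * I" .
    then show "(\<integral>\<^sup>+y. ennreal (C * k (y - x)) \<partial>lebesgue) = ennreal C * I" unfolding sym[of _ x] .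
  qed
  have pm: "(\<lambda>p. ennreal (C * k (fst p - snd p))) \<in> borel_measurable (lebesgue \<Otimes>\<^sub>M lebesgue)"
    by (intro measurable_compose[OF borel_pair_measurable_lebesgue measurable_ennreal] borel_measurable_times borel_measurable_const kc)
  have pm': "(\<lambda>(x, y). ennreal (C * k (x - y)) * indicator \<Omega> y) \<in> borel_measurable (lebesgue \<Otimes>\<^sub>M lebesgue)"
    using pm by (simp add: case_prod_beta)
  have half1: "(\<integral>\<^sup>+x. \<integral>\<^sup>+y. ennreal (C * k (x - y)) * indicator \<Omega> x \<partial>lebesgue \<partial>lebesgue) = ennreal C * I * emeasure lebesgue \<Omega>"
    using kxm by (simp add: nn_integral_multc kint nn_integral_cmult_indicator)
  have "(\<integral>\<^sup>+x. \<integral>\<^sup>+y. ennreal (C * k (x - y)) * indicator \<Omega> y \<partial>lebesgue \<partial>lebesgue)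
      = (\<integral>\<^sup>+y. \<integral>\<^sup>+x. ennreal (C * k (x - y)) * indicator \<Omega> y \<partial>lebesgue \<partial>lebesgue)"
    by (rule lebesgue_pair.Fubini'[OF pm', symmetric])
  also have "\<dots> = ennreal C * I * emeasure lebesgue \<Omega>"
    using kxm by (simp add: nn_integral_multc kint nn_integral_cmult_indicator)
  finally have half2: "(\<integral>\<^sup>+x. \<integral>\<^sup>+y. ennreal (C * k (x - y)) * indicator \<Omega> y \<partial>lebesgue \<partial>lebesgue) = ennreal C * I * emeasure lebesgue \<Omega>" .
  have "(\<integral>\<^sup>+p. ennreal ((difference v p)\<^sup>2) \<partial>gagliardo)
      = (\<integral>\<^sup>+x. \<integral>\<^sup>+y. ennreal (indicator (cross_region \<Omega>) (x, y) / norm (x - y) powr a) * ennreal ((difference v (x, y))\<^sup>2) \<partial>lebesgue \<partial>lebesgue)"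
    using measurable_lebesgue_imp(4)[OF vm] by (intro nn_integral_gagliardo) measurable
  also have "\<dots> \<le> (\<integral>\<^sup>+x. \<integral>\<^sup>+y. ennreal (C * k (x - y)) * (indicator \<Omega> x + indicator \<Omega> y) \<partial>lebesgue \<partial>lebesgue)"
    by (intro nn_integral_mono pw)
  also have "\<dots> = (\<integral>\<^sup>+x. (\<integral>\<^sup>+y. ennreal (C * k (x - y)) * indicator \<Omega> x \<partial>lebesgue) + (\<integral>\<^sup>+y. ennreal (C * k (x - y)) * indicator \<Omega> y \<partial>lebesgue) \<partial>lebesgue)"
    unfolding distrib_left using kxm by (intro nn_integral_cong nn_integral_add) auto
  also have "\<dots> = ennreal C * I * emeasure lebesgue \<Omega> + ennreal C * I * emeasure lebesgue \<Omega>"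
  proof (subst nn_integral_add)
    show "(\<lambda>x. \<integral>\<^sup>+y. ennreal (C * k (x - y)) * indicator \<Omega> x \<partial>lebesgue) \<in> borel_measurable lebesgue"
      using kxm by (simp add: nn_integral_multc kint)
    have "(\<lambda>p. ennreal (C * k (fst p - snd p)) * indicator \<Omega> (snd p)) \<in> borel_measurable (lebesgue \<Otimes>\<^sub>M lebesgue)"
      using pm by measurable
    from lebesgue.borel_measurable_nn_integral_fst[OF this]
    show "(\<lambda>x. \<integral>\<^sup>+y. ennreal (C * k (x - y)) * indicator \<Omega> y \<partial>lebesgue) \<in> borel_measurable lebesgue" by simp
  qed (simp only: half1 half2)
  also have "\<dots> < \<infinity>" using I finite_measure_\<Omega> by (simp add: ennreal_mult_less_top)
  finally show "(\<integral>\<^sup>+p. ennreal ((difference v p)\<^sup>2) \<partial>gagliardo) < \<infinity>" .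
qed

end

lemma AE_lebesgue_ball_witness:
  fixes x :: "'a::euclidean_space"
  assumes "AE y in lebesgue. P y" "r > 0"
  obtains y where "dist y x < r" "P y"
proof -
  have "\<exists>y\<in>ball x r. P y"
  proof (rule ccontr)
    assume "\<not> ?thesis"
    then have "AE y in lebesgue. y \<notin> ball x r" using assms(1) by (auto elim!: eventually_mono)
    then have "emeasure lebesgue (ball x r) = 0" by (subst (asm) AE_iff_measurable[of "ball x r"]) auto
    then have "unit_ball_vol (real DIM('a)) * r ^ DIM('a) \<le> 0"
      using assms(2) by (simp add: emeasure_completion main_part_sets emeasure_ball ennreal_eq_0_iff)
    moreover have "0 < unit_ball_vol (real DIM('a)) * r ^ DIM('a)"
      using assms(2) by (intro mult_pos_pos unit_ball_vol_pos) auto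
    ultimately show False by linarith
  qed
  then show ?thesis using that by (auto simp: dist_commute)
qed

context robin_problem begin

text \<open>Finiteness of the Gagliardo seminorm makes \<open>w\<^sup>2\<close> times the kernel centred at almost every point
  integrable; one such centre \<open>x1\<close> is found near \<open>x0\<close>. Away from \<open>x1\<close> the kernel itself is integrable,
  and \<open>|w| \<le> w\<^sup>2 + 1\<close>.\<close>

lemma vanishing_state_weight_integrable:
  assumes w: "w \<in> W" and zero: "AE x in lebesgue. x \<in> \<Omega> \<longrightarrow> w x = 0"
    and r: "r > 0" and ball: "\<And>y. dist y x0 < 2 * r \<Longrightarrow> y \<in> \<Omega>"
  defines "g \<equiv> \<lambda>y. if y \<in> \<Omega> then 0 else w y"
  shows "integrable lebesgue (\<lambda>y. g y * norm (y - x0) powr (- a))"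
proof -
  note wm = W_D(1)[OF w]
  have gm: "g \<in> borel_measurable lebesgue" unfolding g_def using wm by measurable
  define H where "H x = (\<integral>\<^sup>+y. ennreal (indicator (cross_region \<Omega>) (x, y) / norm (x - y) powr a)
        * ennreal ((difference w (x, y))\<^sup>2) \<partial>lebesgue)" for x
  have "(\<integral>\<^sup>+x. H x \<partial>lebesgue) = (\<integral>\<^sup>+p. ennreal ((difference w p)\<^sup>2) \<partial>gagliardo)"
    unfolding H_def using measurable_lebesgue_imp(4)[OF wm] by (intro nn_integral_gagliardo[symmetric]) measurable
  also have "\<dots> < \<infinity>" using W_D(4)[OF w] by (simp add: L2_iff_nn_integral)
  finally have fin: "(\<integral>\<^sup>+x. H x \<partial>lebesgue) \<noteq> \<infinity>" by simp
  have "(\<lambda>p. ennreal (indicator (cross_region \<Omega>) p / norm (fst p - snd p) powr a)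
        * ennreal ((difference w p)\<^sup>2)) \<in> borel_measurable (lebesgue \<Otimes>\<^sub>M lebesgue)"
    using measurable_lebesgue_imp(4)[OF wm] by measurable
  from lebesgue.borel_measurable_nn_integral_fst[OF this]
  have "H \<in> borel_measurable lebesgue" by (simp add: H_def[abs_def])
  from nn_integral_PInf_AE[OF this fin] have "AE x in lebesgue. H x \<noteq> \<infinity>" .
  with zero have "AE x in lebesgue. (x \<in> \<Omega> \<longrightarrow> w x = 0) \<and> H x \<noteq> \<infinity>" by eventually_elim simp
  then obtain x1 where x1: "dist x1 x0 < r" "x1 \<in> \<Omega> \<longrightarrow> w x1 = 0" "H x1 \<noteq> \<infinity>"
    by (rule AE_lebesgue_ball_witness[OF _ r, of _ x0]) blast
  have x1\<Omega>: "x1 \<in> \<Omega>" using x1(1) r by (intro ball) simp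
  define k where "k y = min 1 ((norm (x1 - y))\<^sup>2) * norm (x1 - y) powr (- a)" for y
  have k: "(\<integral>\<^sup>+y. ennreal (k y) \<partial>lebesgue) < \<infinity>"
    unfolding k_def nn_integral_lebesgue_kernel
    using fractional_kernel_nn_integral_finite[OF s, where 'a = "real ^ 'n"] by (simp add: a_def)
  define c where "c = 1 / min 1 (r\<^sup>2)"
  define d where "d = (2 / 3 :: real) powr (- a)"
  have c: "c > 0" using r by (simp add: c_def)
  have d: "d > 0" by (simp add: d_def)
  have pw: "ennreal (norm (g y * norm (y - x0) powr (- a)))
      \<le> ennreal d * (ennreal (indicator (cross_region \<Omega>) (x1, y) / norm (x1 - y) powr a) * ennreal ((difference w (x1, y))\<^sup>2)
        + ennreal c * ennreal (k y))" for y
  proof (cases "g y = 0")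
    case False
    then have y: "y \<notin> \<Omega>" "g y = w y" by (auto simp: g_def split: if_splits)
    define n where "n = norm (x1 - y)"
    have far: "2 * r \<le> norm (y - x0)" using y ball[of y] by (force simp: dist_norm)
    have x1n: "norm (x1 - x0) < r" using x1(1) by (simp add: dist_norm)
    have "norm (y - x0) \<le> norm (y - x1) + norm (x1 - x0)" using norm_triangle_ineq[of "y - x1" "x1 - x0"] by simp
    then have rn: "r \<le> n" using far x1n by (simp add: n_def norm_minus_commute)
    have "n \<le> norm (x1 - x0) + norm (y - x0)" using norm_triangle_ineq4[of "x1 - x0" "y - x0"] by (simp add: n_def)
    then have n2: "2 / 3 * n \<le> norm (y - x0)" using far x1n by simp
    have n0: "n > 0" using rn r by simp
    have "norm (y - x0) powr (- a) \<le> (2 / 3 * n) powr (- a)"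
      using n2 n0 a_pos by (intro powr_mono2') auto
    also have "\<dots> = d * n powr (- a)" unfolding d_def by (rule powr_mult)
    finally have A: "norm (y - x0) powr (- a) \<le> d * n powr (- a)" .
    have B: "\<bar>g y\<bar> \<le> (g y)\<^sup>2 + 1"
    proof -
      have "2 * \<bar>g y\<bar> * 1 \<le> \<bar>g y\<bar>\<^sup>2 + 1\<^sup>2" by (rule sum_squares_bound)
      then show ?thesis by simp
    qed
    have C: "1 \<le> c * min 1 (n\<^sup>2)"
    proof -
      have "r\<^sup>2 \<le> n\<^sup>2" using rn r by (intro power_mono) auto
      then have "min 1 (r\<^sup>2) \<le> min 1 (n\<^sup>2)" by simp
      moreover have "min 1 (r\<^sup>2) > 0" using r by simp
      ultimately show ?thesis by (simp add: c_def)
    qed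
    have "\<bar>g y\<bar> * norm (y - x0) powr (- a) \<le> ((g y)\<^sup>2 + c * min 1 (n\<^sup>2)) * (d * n powr (- a))"
      using A B C by (intro mult_mono) auto
    also have "\<dots> = d * (1 / n powr a * (g y)\<^sup>2 + c * k y)"
      by (simp add: k_def n_def[symmetric] powr_minus divide_inverse algebra_simps)
    finally have "ennreal (norm (g y * norm (y - x0) powr (- a))) \<le> ennreal (d * (1 / n powr a * (g y)\<^sup>2 + c * k y))"
      by (intro ennreal_leI) (simp add: abs_mult)
    also have "\<dots> = ennreal d * (ennreal (1 / n powr a) * ennreal ((g y)\<^sup>2) + ennreal c * ennreal (k y))"
    proof -
      have k0: "k y \<ge> 0" by (simp add: k_def)
      have "ennreal (d * (1 / n powr a * (g y)\<^sup>2 + c * k y)) = ennreal d * ennreal (1 / n powr a * (g y)\<^sup>2 + c * k y)"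
        by (rule ennreal_mult) (use c d k0 in auto)
      also have "ennreal (1 / n powr a * (g y)\<^sup>2 + c * k y) = ennreal (1 / n powr a * (g y)\<^sup>2) + ennreal (c * k y)"
        by (rule ennreal_plus) (use c k0 in auto)
      also have "ennreal (1 / n powr a * (g y)\<^sup>2) = ennreal (1 / n powr a) * ennreal ((g y)\<^sup>2)" by (rule ennreal_mult) auto
      also have "ennreal (c * k y) = ennreal c * ennreal (k y)" by (rule ennreal_mult) (use c k0 in auto)
      finally show ?thesis .
    qed
    also have "ennreal (1 / n powr a) * ennreal ((g y)\<^sup>2)
        = ennreal (indicator (cross_region \<Omega>) (x1, y) / norm (x1 - y) powr a) * ennreal ((difference w (x1, y))\<^sup>2)"
      using x1\<Omega> x1(2) y by (simp add: cross_region_def difference_def n_def)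
    finally show ?thesis .
  qed simp
  have m1: "(\<lambda>y. ennreal (indicator (cross_region \<Omega>) (x1, y) / norm (x1 - y) powr a) * ennreal ((difference w (x1, y))\<^sup>2)) \<in> borel_measurable lebesgue"
  proof -
    have "(\<lambda>p. ennreal (indicator (cross_region \<Omega>) p / norm (fst p - snd p) powr a)
        * ennreal ((difference w p)\<^sup>2)) \<in> borel_measurable (lebesgue \<Otimes>\<^sub>M lebesgue)"
      using measurable_lebesgue_imp(4)[OF wm] by measurable
    from measurable_compose[OF measurable_Pair1'[of x1 lebesgue lebesgue] this] show ?thesis by simp
  qed
  have m2: "(\<lambda>y. ennreal (k y)) \<in> borel_measurable lebesgue"
    unfolding k_def by (intro lebesgue_measurable_borel) measurable
  have "(\<integral>\<^sup>+y. ennreal (norm (g y * norm (y - x0) powr (- a))) \<partial>lebesgue) \<le> (\<integral>\<^sup>+y. ennreal d * (ennreal (indicator (cross_region \<Omega>) (x1, y) / norm (x1 - y) powr a) * ennreal ((difference w (x1, y))\<^sup>2)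
        + ennreal c * ennreal (k y)) \<partial>lebesgue)"
    by (intro nn_integral_mono pw)
  also have "\<dots> = ennreal d * (H x1 + ennreal c * (\<integral>\<^sup>+y. ennreal (k y) \<partial>lebesgue))"
    unfolding H_def using m1 m2 by (simp add: nn_integral_cmult nn_integral_add)
  also have "\<dots> < \<infinity>" using x1(3) k by (simp add: ennreal_mult_less_top less_top)
  finally have fin: "(\<integral>\<^sup>+y. ennreal (norm (g y * norm (y - x0) powr (- a))) \<partial>lebesgue) < \<infinity>" .
  have "(\<lambda>y. norm (y - x0) powr (- a)) \<in> borel_measurable lebesgue"
    by (intro lebesgue_measurable_borel) measurable
  from integrableI_bounded[OF borel_measurable_times[OF gm this] fin] show ?thesis .
qed

text \<open>Only pairs with exactly one point in \<open>\<Omega>\<close> contribute to the form, and the two kinds of pairs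
  contribute equally. Each contribution is, by Fubini, minus the integral of \<open>v\<close> against the potential
  of \<open>w\<close> restricted to the complement of \<open>\<Omega>\<close>.\<close>

lemma potential_of_vanishing_state:
  assumes sol: "robin_weak_solution \<Omega> \<kappa> s z w" and zero: "AE x in lebesgue. x \<in> \<Omega> \<longrightarrow> w x = 0"
    and v: "v \<in> W" "\<And>x. x \<notin> \<Omega> \<Longrightarrow> v x = 0"
  defines "g \<equiv> \<lambda>y. if y \<in> \<Omega> then 0 else w y"
  shows "integrable lebesgue (\<lambda>x. v x * (\<integral>y. g y * norm (x - y) powr (- a) \<partial>lebesgue))" (is ?int)
    and "(\<integral>x. v x * (\<integral>y. g y * norm (x - y) powr (- a) \<partial>lebesgue) \<partial>lebesgue) = 0" (is ?zero)
proof -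
  let ?L = "lebesgue \<Otimes>\<^sub>M lebesgue :: ((real ^ 'n) \<times> (real ^ 'n)) measure"
  have w: "w \<in> W" using sol by (simp add: weak_solution_iff)
  note wm = W_D(1)[OF w] and vm = W_D(1)[OF v(1)]
  have space: "space \<mu> = - \<Omega>" by (simp add: robin_measure_def)
  have "(\<integral>x. z x * v x \<partial>\<mu>) = (\<integral>x. 0 \<partial>\<mu>)" "(\<integral>x. w x * v x \<partial>\<mu>) = (\<integral>x. 0 \<partial>\<mu>)"
    using v(2) by (intro Bochner_Integration.integral_cong; simp add: space)+
  moreover have "energy w v = (\<integral>x. z x * v x \<partial>\<mu>)" using sol v by (simp add: weak_solution_iff)
  ultimately have form0: "(\<integral>p. difference w p * difference v p \<partial>gagliardo) = 0"
    using energy_eq[OF w v(1)] frac_const_pos by simp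
  define T where "T p = v (fst p) * g (snd p) * norm (fst p - snd p) powr (- a)" for p
  define Q where "Q p = (indicator (cross_region \<Omega>) p / norm (fst p - snd p) powr a) * (difference w p * difference v p)" for p
  have dm: "(\<lambda>p. difference w p * difference v p) \<in> borel_measurable ?L"
    using measurable_lebesgue_imp(4)[OF wm] measurable_lebesgue_imp(4)[OF vm] by (rule borel_measurable_times)
  have "integrable gagliardo (\<lambda>p. difference w p * difference v p)"
    by (rule L2_mult_integrable[OF W_D(4)[OF w] W_D(4)[OF v(1)]])
  then have Qi: "integrable ?L Q"
    unfolding gagliardo_def Q_def using dm by (subst (asm) integrable_density) (auto intro!: kernel_measurable)
  have Q0: "(\<integral>p. Q p \<partial>?L) = 0"
    using form0 dm unfolding gagliardo_def Q_def by (subst (asm) integral_density) (auto intro!: kernel_measurable)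
  have gm: "g \<in> borel_measurable lebesgue" unfolding g_def using wm by measurable
  have nm: "(\<lambda>p. norm (fst p - snd p) powr (- a)) \<in> borel_measurable ?L"
    by (rule borel_pair_measurable_lebesgue) measurable
  have Tm: "T \<in> borel_measurable ?L" unfolding T_def using vm gm nm by measurable
  have ae: "AE p in ?L. Q p = - (T p + T (snd p, fst p))"
    using AE_pair_lebesgue_components[OF zero]
  proof eventually_elim
    case (elim p)
    obtain x y where p: "p = (x, y)" by (cases p)
    have n: "norm (y - x) = norm (x - y)" by (rule norm_minus_commute)
    show ?case
      using elim v(2)[of x] v(2)[of y]
      by (cases "x \<in> \<Omega>"; cases "y \<in> \<Omega>")
        (auto simp: p Q_def T_def g_def cross_region_def difference_def n powr_minus divide_inverse)
  qed
  have Ti: "integrable ?L T"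
  proof (rule Bochner_Integration.integrable_bound[OF Qi Tm])
    show "AE p in ?L. norm (T p) \<le> norm (Q p)"
      using AE_pair_lebesgue_components[OF zero]
    proof eventually_elim
      case (elim p)
      obtain x y where p: "p = (x, y)" by (cases p)
      show ?case
        using elim v(2)[of x] v(2)[of y]
        by (cases "x \<in> \<Omega>"; cases "y \<in> \<Omega>")
          (auto simp: p Q_def T_def g_def cross_region_def difference_def powr_minus divide_inverse abs_mult)
    qed
  qed
  have Tsi: "integrable ?L (\<lambda>(x, y). T (y, x))" by (rule lebesgue_pair.integrable_product_swap[OF Ti])
  have "0 = (\<integral>p. - (T p + (case p of (x, y) \<Rightarrow> T (y, x))) \<partial>?L)"
    unfolding Q0[symmetric]
  proof (rule integral_cong_AE)
    show "Q \<in> borel_measurable ?L" using Qi by auto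
    show "(\<lambda>p. - (T p + (case p of (x, y) \<Rightarrow> T (y, x)))) \<in> borel_measurable ?L" using Ti Tsi by auto
    show "AE p in ?L. Q p = - (T p + (case p of (x, y) \<Rightarrow> T (y, x)))"
      using ae by eventually_elim (simp add: case_prod_beta)
  qed
  also have "\<dots> = - ((\<integral>p. T p \<partial>?L) + (\<integral>p. (case p of (x, y) \<Rightarrow> T (y, x)) \<partial>?L))"
    using Ti Tsi by simp
  also have "(\<integral>p. (case p of (x, y) \<Rightarrow> T (y, x)) \<partial>?L) = (\<integral>p. T p \<partial>?L)"
    by (rule lebesgue_pair.integral_product_swap[OF Tm])
  finally have T0: "(\<integral>p. T p \<partial>?L) = 0" by simp
  have inner: "(\<integral>y. T (x, y) \<partial>lebesgue) = v x * (\<integral>y. g y * norm (x - y) powr (- a) \<partial>lebesgue)" for x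
    unfolding T_def by (simp add: mult.assoc)
  show ?int using lebesgue_pair.integrable_fst'[OF Ti] unfolding inner .
  show ?zero using lebesgue_pair.integral_fst'[OF Ti] unfolding inner T0 .
qed

text \<open>The potential is continuous, and its integral against every bump function supported near \<open>x\<close>
  vanishes, so it vanishes at \<open>x\<close>. Unique continuation does the rest.\<close>

lemma vanishing_state_AE_0:
  assumes sol: "robin_weak_solution \<Omega> \<kappa> s z w" and zero: "AE x in lebesgue_on \<Omega>. w x = 0"
  shows "AE x in lebesgue. w x = 0"
proof -
  have zero': "AE x in lebesgue. x \<in> \<Omega> \<longrightarrow> w x = 0" using zero by (subst (asm) AE_restrict_space_iff) auto
  have w: "w \<in> W" using sol by (simp add: weak_solution_iff)
  define g where "g y = (if y \<in> \<Omega> then 0 else w y)" for y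
  obtain x0 where "x0 \<in> \<Omega>" using \<Omega>(3) by blast
  then obtain e where e: "e > 0" "ball x0 e \<subseteq> \<Omega>" using \<Omega>(1) open_contains_ball by blast
  define r where "r = e / 2"
  have r: "r > 0" and ball: "\<And>y. dist y x0 < 2 * r \<Longrightarrow> y \<in> \<Omega>"
    using e by (auto simp: r_def dist_commute)
  interpret far_source g x0 r a
  proof
    show "g \<in> borel_measurable lebesgue" unfolding g_def using W_D(1)[OF w] by measurable
    show "g y = 0" if "dist y x0 < 2 * r" for y using ball[OF that] by (simp add: g_def)
    show "integrable lebesgue (\<lambda>y. g y * norm (y - x0) powr (- a))"
      unfolding g_def by (rule vanishing_state_weight_integrable[OF w zero' r ball])
  qed (use r a_pos in auto)
  define F where "F x = (\<integral>y. g y * norm (x - y) powr (- a) \<partial>lebesgue)" for x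
  have "F x = 0" if x: "dist x x0 < r" for x
  proof (rule ccontr)
    assume "F x \<noteq> 0"
    define c where "c = sgn (F x)"
    have "isCont (\<lambda>x. c * F x) x" unfolding F_def by (intro continuous_intros potential_continuous[OF x])
    moreover have "c * F x > 0" using \<open>F x \<noteq> 0\<close> by (simp add: c_def sgn_if)
    ultimately have "\<forall>\<^sub>F y in nhds x. c * F y > 0"
      using order_tendstoD(1)[OF isCont_tendsto_compose[OF _ filterlim_ident]] by blast
    then obtain \<delta> where \<delta>: "\<delta> > 0" "\<And>y. dist y x < \<delta> \<Longrightarrow> c * F y > 0"
      by (auto simp: eventually_nhds_metric)
    define \<rho> where "\<rho> = min \<delta> r"
    have \<rho>: "\<rho> > 0" using \<delta> r by (simp add: \<rho>_def)
    define v where "v y = max 0 (\<rho> - dist y x)" for y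
    have v_lip: "1-lipschitz_on UNIV v"
    proof (rule lipschitz_onI)
      fix p q
      have "\<bar>v p - v q\<bar> \<le> \<bar>dist p x - dist q x\<bar>" by (auto simp: v_def)
      also have "\<dots> \<le> dist p q"
        using dist_triangle[of p x q] dist_triangle[of q x p] by (simp add: dist_commute abs_le_iff)
      finally show "dist (v p) (v q) \<le> 1 * dist p q" by (simp add: dist_real_def)
    qed simp
    have vW: "v \<in> W" using \<rho> by (intro bounded_Lipschitz_in_W[OF v_lip, of \<rho>]) (auto simp: v_def)
    have v_pos: "v y > 0 \<longleftrightarrow> dist y x < \<rho>" "v y \<ge> 0" for y by (auto simp: v_def)
    have v0: "v y = 0" if "y \<notin> \<Omega>" for y
    proof (rule ccontr)
      assume "v y \<noteq> 0"
      then have "dist y x < \<rho>" using v_pos[of y] by simp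
      then have "dist y x0 < 2 * r" using dist_triangle[of y x0 x] x by (simp add: \<rho>_def)
      with that ball show False by blast
    qed
    have pot: "integrable lebesgue (\<lambda>y. v y * F y)" "(\<integral>y. v y * F y \<partial>lebesgue) = 0"
      unfolding F_def g_def using potential_of_vanishing_state[OF sol zero' vW v0] by simp_all
    have i: "integrable lebesgue (\<lambda>y. c * (v y * F y))" using pot(1) by simp
    have nn: "0 \<le> c * (v y * F y)" for y
    proof (cases "dist y x < \<rho>")
      case True
      then have "0 < c * F y" using \<delta>(2)[of y] by (simp add: \<rho>_def)
      then have "0 \<le> v y * (c * F y)" using v_pos(2)[of y] by simp
      then show ?thesis by (simp add: mult.left_commute)
    qed (use v_pos[of y] in simp)
    have "(\<integral>y. c * (v y * F y) \<partial>lebesgue) = 0" using pot(2) by simp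
    then have "AE y in lebesgue. c * (v y * F y) = 0"
      using integral_nonneg_eq_0_iff_AE[OF i] nn by simp
    then obtain y where y: "dist y x < \<rho>" "c * (v y * F y) = 0" by (rule AE_lebesgue_ball_witness[OF _ \<rho>])
    moreover have "c * F y > 0" using y(1) by (intro \<delta>) (simp add: \<rho>_def)
    moreover have "v y > 0" using y(1) v_pos by simp
    ultimately show False by auto
  qed
  then have "AE y in lebesgue. g y = 0"
    using s by (intro AE_eq_0_if_potential_eq_0) (auto simp: F_def a_def)
  with zero' show ?thesis by eventually_elim (auto simp: g_def split: if_splits)
qed

text \<open>With \<open>w = 0\<close> the state equation says that \<open>z\<close> is orthogonal in \<open>L\<^sup>2(\<mu>)\<close> to \<open>W\<close>. Since \<open>W\<close>
  contains all bounded Lipschitz functions on the whole space, also those that do not vanish on the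
  boundary of \<open>\<Omega>\<close>, this determines \<open>z\<close> almost everywhere.\<close>

lemma control_AE_0_if_state_AE_0:
  assumes z: "z \<in> Z" and sol: "robin_weak_solution \<Omega> \<kappa> s z w" and zero: "AE x in lebesgue_on \<Omega>. w x = 0"
  shows "AE x in \<mu>. z x = 0"
proof -
  have w0: "AE x in lebesgue. w x = 0" by (rule vanishing_state_AE_0[OF sol zero])
  have w: "w \<in> W" using sol by (simp add: weak_solution_iff)
  have \<kappa>m: "\<kappa> \<in> borel_measurable (lebesgue_on (- \<Omega>))" using \<kappa>_integrable by auto
  have zm: "z \<in> borel_measurable (lebesgue_on (- \<Omega>))" using L2_measurable[OF z] by (simp add: robin_measure_def)
  have \<kappa>0: "AE x in lebesgue_on (- \<Omega>). 0 \<le> \<kappa> x" using \<kappa>_pos by eventually_elim simp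
  define f where "f x = indicator (- \<Omega>) x *\<^sub>R (\<kappa> x * z x)" for x
  have "(\<lambda>x. 1) \<in> Z" using finite_\<mu> by (intro L2_I) auto
  from L2_mult_integrable[OF z this] have "integrable \<mu> z" by simp
  then have "integrable (lebesgue_on (- \<Omega>)) (\<lambda>x. \<kappa> x * z x)"
    unfolding robin_measure_def using \<kappa>m zm \<kappa>0 by (subst (asm) integrable_density) auto
  then have fi: "integrable lebesgue f"
    unfolding f_def by (subst (asm) integrable_restrict_space) auto
  have test: "(\<integral>x. f x * v x \<partial>lebesgue) = 0" if v: "v \<in> W" for v
  proof -
    have "(\<integral>x. z x * v x \<partial>\<mu>) = energy w v" using sol v by (simp add: weak_solution_iff)
    also have "\<dots> = 0"
    proof -
      have "AE p in gagliardo. difference w p * difference v p = 0"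
        using AE_lebesgue_imp(3)[OF w0] by eventually_elim (simp add: difference_def)
      moreover have "AE x in \<mu>. w x * v x = 0"
        using AE_lebesgue_imp(2)[OF w0] by eventually_elim simp
      ultimately have "(\<integral>p. difference w p * difference v p \<partial>gagliardo) = 0" "(\<integral>x. w x * v x \<partial>\<mu>) = 0"
        by (auto intro: integral_eq_zero_AE)
      then show ?thesis by (simp add: energy_eq[OF w v])
    qed
    finally have "(\<integral>x. z x * v x \<partial>\<mu>) = 0" .
    moreover have "(\<integral>x. z x * v x \<partial>\<mu>) = (\<integral>x. \<kappa> x *\<^sub>R (z x * v x) \<partial>lebesgue_on (- \<Omega>))"
      unfolding robin_measure_def using \<kappa>m zm \<kappa>0 measurable_restrict_space1[OF W_D(1)[OF v]]
      by (intro integral_density) auto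
    moreover have "\<dots> = (\<integral>x. indicator (- \<Omega>) x *\<^sub>R (\<kappa> x *\<^sub>R (z x * v x)) \<partial>lebesgue)"
      by (rule integral_restrict_space) simp
    moreover have "\<dots> = (\<integral>x. f x * v x \<partial>lebesgue)" by (simp add: f_def mult.assoc)
    ultimately show ?thesis by simp
  qed
  have "AE x in lebesgue. f x = 0"
    by (rule AE_eq_0_if_test_integrals_eq_0[OF fi]) (rule test[OF bounded_Lipschitz_in_W])
  then have "AE x in lebesgue_on (- \<Omega>). f x = 0" by (subst AE_restrict_space_iff) auto
  moreover have "AE x in lebesgue_on (- \<Omega>). x \<in> - \<Omega>" by (rule AE_I2) simp
  ultimately have "AE x in lebesgue_on (- \<Omega>). z x = 0"
    using \<kappa>_pos by eventually_elim (simp add: f_def)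
  then show ?thesis unfolding robin_measure_def using \<kappa>m by (subst AE_density) auto
qed

end

section \<open>The optimal control problem\<close>

text \<open>The constant sequence \<open>f\<close> converges weakly to \<open>g\<close>, and conversely.\<close>

lemma L2_weakly_lsc_cong_AE:
  assumes lsc: "L2_weakly_lsc M J" and f: "f \<in> L2 M" and g: "g \<in> L2 M" and eq: "AE x in M. f x = g x"
  shows "J f = J g"
proof -
  have le: "J k \<le> J h" if "h \<in> L2 M" "k \<in> L2 M" "AE x in M. h x = k x" for h k
  proof -
    have "(\<integral>x. h x * \<phi> x \<partial>M) = (\<integral>x. k x * \<phi> x \<partial>M)" if "\<phi> \<in> L2 M" for \<phi>
      using \<open>h \<in> L2 M\<close> \<open>k \<in> L2 M\<close> that \<open>AE x in M. h x = k x\<close>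
      by (intro integral_cong_AE borel_measurable_times L2_measurable) (auto elim!: eventually_mono)
    then have "L2_weak_tendsto M (\<lambda>n. h) k" by (simp add: L2_weak_tendsto_def)
    then have "(\<forall>n::nat. h \<in> L2 M) \<and> k \<in> L2 M \<and> L2_weak_tendsto M (\<lambda>n. h) k" using that by blast
    then have "ereal (J k) \<le> liminf (\<lambda>n. ereal (J h))"
      by (rule lsc[unfolded L2_weakly_lsc_def, THEN spec[of _ "\<lambda>n. h"], THEN spec[of _ k], THEN mp])
    then show ?thesis by (simp add: Liminf_const)
  qed
  have "AE x in M. g x = f x" using eq by eventually_elim simp
  then show ?thesis using le[OF f g eq] le[OF g f] by simp
qed

lemma L2_norm_square: "(L2_norm M f)\<^sup>2 = (\<integral>x. f x * f x \<partial>M)"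
  unfolding L2_norm_def by (subst real_sqrt_pow2) (auto intro!: integral_nonneg_AE simp: power2_eq_square)

context robin_problem begin

abbreviation S :: "(real ^ 'n \<Rightarrow> real) \<Rightarrow> real ^ 'n \<Rightarrow> real" where "S \<equiv> robin_state \<Omega> \<kappa> s"

lemma state_L2: "z \<in> Z \<Longrightarrow> S z \<in> L2 (lebesgue_on \<Omega>)"
  using robin_state_solution[of z] W_D(2) by (auto simp: weak_solution_iff)

text \<open>The state is selected by a choice operator; the objective does not see which solution is chosen.\<close>

lemma objective_weak_solution:
  assumes "L2_weakly_lsc (lebesgue_on \<Omega>) J" "z \<in> Z" "robin_weak_solution \<Omega> \<kappa> s z u"
  shows "J u = J (S z)"
proof (rule L2_weakly_lsc_cong_AE[OF assms(1)])
  show "u \<in> L2 (lebesgue_on \<Omega>)" using assms(3) W_D(2) by (auto simp: weak_solution_iff)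
  show "S z \<in> L2 (lebesgue_on \<Omega>)" by (rule state_L2[OF assms(2)])
  show "AE x in lebesgue_on \<Omega>. u x = S z x"
    by (rule weak_solution_unique[OF assms(2,3) robin_state_solution[OF assms(2)]])
qed

lemma objective_state_lincomb:
  assumes "L2_weakly_lsc (lebesgue_on \<Omega>) J" "z \<in> Z" "z' \<in> Z"
  shows "J (S (\<lambda>x. c * z x + d * z' x)) = J (\<lambda>x. c * S z x + d * S z' x)"
  by (rule objective_weak_solution[symmetric, OF assms(1) L2_lincomb[OF assms(2,3)]
        weak_solution_lincomb[OF assms(2,3) robin_state_solution[OF assms(2)] robin_state_solution[OF assms(3)]]])

lemma state_AE_injective:
  assumes z: "z \<in> Z" "z' \<in> Z" and eq: "AE x in lebesgue_on \<Omega>. S z x = S z' x"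
  shows "AE x in \<mu>. z x = z' x"
proof -
  have "AE x in \<mu>. 1 * z x + (-1) * z' x = 0"
  proof (rule control_AE_0_if_state_AE_0)
    show "(\<lambda>x. 1 * z x + (-1) * z' x) \<in> Z" by (rule L2_lincomb[OF z])
    show "robin_weak_solution \<Omega> \<kappa> s (\<lambda>x. 1 * z x + (-1) * z' x) (\<lambda>x. 1 * S z x + (-1) * S z' x)"
      by (rule weak_solution_lincomb[OF z robin_state_solution[OF z(1)] robin_state_solution[OF z(2)]])
    show "AE x in lebesgue_on \<Omega>. 1 * S z x + (-1) * S z' x = 0" using eq by eventually_elim simp
  qed
  then show ?thesis by eventually_elim simp
qed

lemma reduced_cost_weakly_lsc:
  assumes J: "L2_weakly_lsc (lebesgue_on \<Omega>) J"
  shows "semi_hilbert.weakly_lsc Z (\<lambda>f g. \<integral>x. f x * g x \<partial>\<mu>) (\<lambda>z. J (S z))"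
proof -
  interpret U: semi_hilbert Z "\<lambda>f g. \<integral>x. f x * g x \<partial>\<mu>" by (rule semi_hilbert_L2)
  show ?thesis
    unfolding U.weakly_lsc_def
  proof (intro allI impI)
    fix F g
    assume *: "(\<forall>n. F n \<in> Z) \<and> g \<in> Z \<and> (\<forall>w\<in>Z. (\<lambda>n. \<integral>x. F n x * w x \<partial>\<mu>) \<longlonglongrightarrow> (\<integral>x. g x * w x \<partial>\<mu>))"
    then have F: "F n \<in> Z" and g: "g \<in> Z" for n by auto
    have "L2_weak_tendsto \<mu> F g" using * by (simp add: L2_weak_tendsto_def)
    then have "L2_weak_tendsto (lebesgue_on \<Omega>) (\<lambda>n. S (F n)) (S g)"
      by (rule weak_solution_weakly_continuous[OF F g _ robin_state_solution[OF F] robin_state_solution[OF g]])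
    then have "(\<forall>n. S (F n) \<in> L2 (lebesgue_on \<Omega>)) \<and> S g \<in> L2 (lebesgue_on \<Omega>) \<and> L2_weak_tendsto (lebesgue_on \<Omega>) (\<lambda>n. S (F n)) (S g)"
      using state_L2[OF F] state_L2[OF g] by blast
    then show "ereal (J (S g)) \<le> liminf (\<lambda>n. ereal (J (S (F n))))"
      by (rule J[unfolded L2_weakly_lsc_def, THEN spec[of _ "\<lambda>n. S (F n)"], THEN spec[of _ "S g"], THEN mp])
  qed
qed

lemma reduced_solution_iff:
  "reduced_solution \<Omega> \<kappa> s J \<xi> Zad z \<longleftrightarrow>
     z \<in> Zad \<and> (\<forall>y\<in>Zad. J (S z) + \<xi> / 2 * (\<integral>x. z x * z x \<partial>\<mu>) \<le> J (S y) + \<xi> / 2 * (\<integral>x. y x * y x \<partial>\<mu>))"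
  by (auto simp: reduced_solution_def is_arg_min_def robin_cost_def L2_norm_square not_less)

lemma full_solution_iff:
  assumes J: "L2_weakly_lsc (lebesgue_on \<Omega>) J" and Zad: "Zad \<subseteq> Z"
  shows "full_solution \<Omega> \<kappa> s J \<xi> Zad u z \<longleftrightarrow> reduced_solution \<Omega> \<kappa> s J \<xi> Zad z \<and> robin_weak_solution \<Omega> \<kappa> s z u"
proof -
  have cost: "robin_cost \<Omega> \<kappa> J \<xi> v y = robin_cost \<Omega> \<kappa> J \<xi> (S y) y" if "y \<in> Zad" "robin_weak_solution \<Omega> \<kappa> s y v" for v y
    using objective_weak_solution[OF J _ that(2)] that(1) Zad by (auto simp: robin_cost_def)
  have adm: "robin_weak_solution \<Omega> \<kappa> s y (S y)" "S y \<in> W" if "y \<in> Zad" for y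
    using robin_state_solution[of y] that Zad by (auto simp: weak_solution_iff)
  have inW: "v \<in> W" if "robin_weak_solution \<Omega> \<kappa> s y v" for y v using that by (simp add: weak_solution_iff)
  show ?thesis
  proof
    assume *: "full_solution \<Omega> \<kappa> s J \<xi> Zad u z"
    then have z: "z \<in> Zad" and u: "robin_weak_solution \<Omega> \<kappa> s z u"
      by (auto simp: full_solution_def is_arg_min_def)
    have "\<not> robin_cost \<Omega> \<kappa> J \<xi> (S y) y < robin_cost \<Omega> \<kappa> J \<xi> (S z) z" if "y \<in> Zad" for y
      using * adm[OF that] that cost[OF z u] by (auto simp: full_solution_def is_arg_min_def)
    then show "reduced_solution \<Omega> \<kappa> s J \<xi> Zad z \<and> robin_weak_solution \<Omega> \<kappa> s z u"
      using z u by (auto simp: reduced_solution_def is_arg_min_def)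
  next
    assume *: "reduced_solution \<Omega> \<kappa> s J \<xi> Zad z \<and> robin_weak_solution \<Omega> \<kappa> s z u"
    then have z: "z \<in> Zad" and u: "robin_weak_solution \<Omega> \<kappa> s z u"
      by (auto simp: reduced_solution_def is_arg_min_def)
    have "\<not> robin_cost \<Omega> \<kappa> J \<xi> v y < robin_cost \<Omega> \<kappa> J \<xi> u z" if "y \<in> Zad" "robin_weak_solution \<Omega> \<kappa> s y v" for v y
      using * that cost[OF z u] cost[OF that] by (auto simp: reduced_solution_def is_arg_min_def)
    then show "full_solution \<Omega> \<kappa> s J \<xi> Zad u z"
      using z u inW[OF u] by (auto simp: full_solution_def is_arg_min_def)
  qed
qed

lemma reduced_solution_exists:
  assumes \<xi>: "\<xi> \<ge> 0"
    and Zad: "Zad \<subseteq> Z" "Zad \<noteq> {}" "L2_closed \<mu> Zad" "convex_fun_set Zad"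
    and \<xi>_or_bounded: "\<xi> > 0 \<or> L2_bounded \<mu> Zad"
    and J: "L2_weakly_lsc (lebesgue_on \<Omega>) J"
    and J_below: "L2_bounded \<mu> Zad \<or> L2_convex (lebesgue_on \<Omega>) J \<or> bdd_below (J ` L2 (lebesgue_on \<Omega>))"
  shows "\<exists>z. reduced_solution \<Omega> \<kappa> s J \<xi> Zad z"
proof -
  let ?B = "\<lambda>f g. \<integral>x. f x * g x \<partial>\<mu>" and ?j = "\<lambda>z. J (S z)"
  interpret U: semi_hilbert Z ?B by (rule semi_hilbert_L2)
  note lsc = reduced_cost_weakly_lsc[OF J]
  have "\<exists>g\<in>Zad. \<forall>f\<in>Zad. ?j g + \<xi> / 2 * ?B g g \<le> ?j f + \<xi> / 2 * ?B f f"
  proof (rule U.minimizer_exists[OF Zad(1,2) _ _ lsc \<xi>])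
    show "U.midconvex Zad"
      unfolding U.midconvex_def
    proof (intro ballI)
      fix f g assume "f \<in> Zad" "g \<in> Zad"
      then have "(\<lambda>x. (1 - 1/2) * f x + 1/2 * g x) \<in> Zad"
        by (intro Zad(4)[unfolded convex_fun_set_def, rule_format]) auto
      then show "(\<lambda>x. 1/2 * f x + 1/2 * g x) \<in> Zad" by simp
    qed
    fix p :: "nat \<Rightarrow> real ^ 'n \<Rightarrow> real" and g
    assume p: "\<And>k. p k \<in> Zad" "g \<in> Z" "(\<lambda>k. ?B (\<lambda>x. p k x - g x) (\<lambda>x. p k x - g x)) \<longlonglongrightarrow> 0"
    have "(\<lambda>k. L2_norm \<mu> (\<lambda>x. p k x - g x)) \<longlonglongrightarrow> 0"
      using tendsto_real_sqrt[OF p(3)] by (simp add: L2_norm_def power2_eq_square)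
    then show "g \<in> Zad" using Zad(3) p(1,2) unfolding L2_closed_def by blast
  next
    fix c
    show "\<exists>M. \<forall>f\<in>Zad. ?j f + \<xi> / 2 * ?B f f \<le> c \<longrightarrow> ?B f f \<le> M"
    proof (cases "L2_bounded \<mu> Zad")
      case True
      then obtain b where b: "\<And>f. f \<in> Zad \<Longrightarrow> L2_norm \<mu> f \<le> b" by (auto simp: L2_bounded_def)
      have "?B f f \<le> b\<^sup>2" if "f \<in> Zad" for f
      proof -
        have "0 \<le> L2_norm \<mu> f" by (simp add: L2_norm_def)
        then have "(L2_norm \<mu> f)\<^sup>2 \<le> b\<^sup>2" using b[OF that] by (intro power_mono)
        then show ?thesis unfolding L2_norm_square .
      qed
      then show ?thesis by blast
    next
      case False
      then have \<xi>0: "\<xi> > 0" using \<xi>_or_bounded by blast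
      have "\<exists>C\<ge>0. \<forall>f\<in>Z. - C * (1 + sqrt (?B f f)) \<le> ?j f"
      proof (cases "L2_convex (lebesgue_on \<Omega>) J")
        case True
        show ?thesis
        proof (rule U.convex_lsc_lower_bound[OF _ lsc])
          fix f g t assume fg: "f \<in> Z" "g \<in> Z" "0 \<le> t" "t \<le> (1::real)"
          show "?j (\<lambda>x. (1 - t) * f x + t * g x) \<le> (1 - t) * ?j f + t * ?j g"
            unfolding objective_state_lincomb[OF J fg(1,2)]
            using True state_L2[OF fg(1)] state_L2[OF fg(2)] fg(3,4) unfolding L2_convex_def by blast
        qed
      next
        case False
        with J_below \<open>\<not> L2_bounded \<mu> Zad\<close> have "bdd_below (J ` L2 (lebesgue_on \<Omega>))" by metis
        then obtain b where b: "\<And>u. u \<in> L2 (lebesgue_on \<Omega>) \<Longrightarrow> b \<le> J u" by (auto simp: bdd_below_def)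
        have "- \<bar>b\<bar> * (1 + sqrt (?B f f)) \<le> ?j f" if f: "f \<in> Z" for f
        proof -
          have "\<bar>b\<bar> * 1 \<le> \<bar>b\<bar> * (1 + sqrt (?B f f))" using U.nonneg[OF f] by (intro mult_left_mono) auto
          then show ?thesis using b[OF state_L2[OF f]] by (simp add: abs_le_iff)
        qed
        then show ?thesis by (intro exI[of _ "\<bar>b\<bar>"]) simp
      qed
      then obtain C where C: "C \<ge> 0" "\<And>f. f \<in> Z \<Longrightarrow> - C * (1 + sqrt (?B f f)) \<le> ?j f" by blast
      then show ?thesis using U.coercive_if_lower_bound[OF C \<xi>0, of c] Zad(1) by blast
    qed
  qed
  then show ?thesis by (auto simp: reduced_solution_iff)
qed

text \<open>The midpoint of two minimizers is admissible. Its squared norm lies below the mean of the squared norms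
  by a quarter of the squared distance, which settles the first case. In the second case the
  states agree in \<open>\<Omega>\<close>, and the control-to-state map is injective.\<close>

lemma reduced_solution_unique:
  assumes \<xi>: "\<xi> \<ge> 0" and Zad: "Zad \<subseteq> Z" "convex_fun_set Zad"
    and J: "L2_weakly_lsc (lebesgue_on \<Omega>) J"
    and J_convex: "L2_convex (lebesgue_on \<Omega>) J \<and> \<xi> > 0 \<or> L2_strictly_convex (lebesgue_on \<Omega>) J"
    and sol: "reduced_solution \<Omega> \<kappa> s J \<xi> Zad z" "reduced_solution \<Omega> \<kappa> s J \<xi> Zad z'"
  shows "AE x in \<mu>. z x = z' x"
proof -
  let ?B = "\<lambda>f g. \<integral>x. f x * g x \<partial>\<mu>" and ?j = "\<lambda>z. J (S z)"
  interpret U: semi_hilbert Z ?B by (rule semi_hilbert_L2)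
  have zad: "z \<in> Zad" "z' \<in> Zad" using sol by (auto simp: reduced_solution_iff)
  then have z: "z \<in> Z" "z' \<in> Z" using Zad by auto
  define m where "m = (\<lambda>x. (1 - 1/2) * z x + 1/2 * z' x)"
  have m: "m \<in> Zad"
    unfolding m_def by (rule Zad(2)[unfolded convex_fun_set_def, rule_format]) (use zad in auto)
  define N where "N y = \<xi> / 2 * ?B y y" for y
  have eq: "?j z + N z = ?j z' + N z'"
    using sol zad unfolding reduced_solution_iff N_def by (intro antisym) auto
  have min: "?j z + N z \<le> ?j m + N m"
    using sol m unfolding reduced_solution_iff N_def by blast
  define d where "d = ?B (\<lambda>x. z x - z' x) (\<lambda>x. z x - z' x)"
  have d: "d \<ge> 0" "d = ?B z z - 2 * ?B z z' + ?B z' z'"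
    unfolding d_def using U.nonneg[OF U.diff_mem[OF z]] U.diff_expand[OF z] by auto
  have "?B m m = (1 - 1/2)\<^sup>2 * ?B z z + 2 * (1 - 1/2) * (1/2) * ?B z z' + (1/2)\<^sup>2 * ?B z' z'"
    unfolding m_def by (rule U.quadratic_expand[OF z])
  then have "?B m m = ?B z z / 4 + ?B z z' / 2 + ?B z' z' / 4" by (simp add: power2_eq_square)
  then have mm: "?B m m = ?B z z / 2 + ?B z' z' / 2 - d / 4" using d(2) by linarith
  have jm: "?j m = J (\<lambda>x. (1 - 1/2) * S z x + 1/2 * S z' x)" unfolding m_def by (rule objective_state_lincomb[OF J z])
  have \<xi>mm: "N m = N z / 2 + N z' / 2 - \<xi> * d / 8"
    unfolding N_def mm by (simp add: algebra_simps)
  have \<xi>d: "\<xi> * d \<ge> 0" using \<xi> d by simp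
  from J_convex show ?thesis
  proof
    assume *: "L2_convex (lebesgue_on \<Omega>) J \<and> \<xi> > 0"
    have "?j m \<le> (1 - 1/2) * ?j z + 1/2 * ?j z'"
      unfolding jm by (rule *[THEN conjunct1, unfolded L2_convex_def, rule_format]) (use state_L2 z in auto)
    then have "?j m \<le> ?j z / 2 + ?j z' / 2" by simp
    then have "\<xi> * d \<le> 0" using min eq \<xi>mm by linarith
    then have "d = 0" using * d(1) by (simp add: mult_le_0_iff)
    then have "(\<integral>\<^sup>+x. ennreal ((z x - z' x)\<^sup>2) \<partial>\<mu>) = 0"
      unfolding L2_nn_integral[OF U.diff_mem[OF z]] d_def by simp
    moreover have "(\<lambda>x. ennreal ((z x - z' x)\<^sup>2)) \<in> borel_measurable \<mu>"
      using L2_measurable[OF z(1)] L2_measurable[OF z(2)] by measurable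
    ultimately have "AE x in \<mu>. ennreal ((z x - z' x)\<^sup>2) = 0" by (simp add: nn_integral_0_iff_AE)
    then show ?thesis by eventually_elim (simp add: ennreal_eq_0_iff)
  next
    assume *: "L2_strictly_convex (lebesgue_on \<Omega>) J"
    have "AE x in lebesgue_on \<Omega>. S z x = S z' x"
    proof (rule ccontr)
      assume "\<not> (AE x in lebesgue_on \<Omega>. S z x = S z' x)"
      then have "?j m < (1 - 1/2) * ?j z + 1/2 * ?j z'"
        unfolding jm by (intro *[unfolded L2_strictly_convex_def, rule_format]) (use state_L2 z in auto)
      then have "?j m < ?j z / 2 + ?j z' / 2" by simp
      then show False using min eq \<xi>mm \<xi>d by linarith
    qed
    then show ?thesis by (rule state_AE_injective[OF z])
  qed
qed

end

theorem theorem5p1: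
  fixes \<Omega> :: "(real ^ 'n) set"
    and \<kappa> :: "real ^ 'n \<Rightarrow> real"
    and s \<xi> :: real
    and J :: "(real ^ 'n \<Rightarrow> real) \<Rightarrow> real"
    and Zad :: "(real ^ 'n \<Rightarrow> real) set"
  assumes "0 < s" and "s < 1"
    and "bounded_lipschitz_domain \<Omega>"
    and "integrable (lebesgue_on (- \<Omega>)) \<kappa>"
    and "\<exists>B. AE x in lebesgue_on (- \<Omega>). \<bar>\<kappa> x\<bar> \<le> B"
    and "AE x in lebesgue_on (- \<Omega>). \<kappa> x > 0"
    and "\<xi> \<ge> 0"
    and "Zad \<subseteq> L2 (robin_measure \<Omega> \<kappa>)" and "Zad \<noteq> {}"
    and "L2_closed (robin_measure \<Omega> \<kappa>) Zad" and "convex_fun_set Zad"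
    and "\<xi> > 0 \<or> L2_bounded (robin_measure \<Omega> \<kappa>) Zad"
    and "L2_weakly_lsc (lebesgue_on \<Omega>) J"
    and "L2_bounded (robin_measure \<Omega> \<kappa>) Zad \<or> L2_convex (lebesgue_on \<Omega>) J
         \<or> bdd_below (J ` L2 (lebesgue_on \<Omega>))"
  shows "(\<exists>z. reduced_solution \<Omega> \<kappa> s J \<xi> Zad z)
    \<and> (\<exists>u z. full_solution \<Omega> \<kappa> s J \<xi> Zad u z)
    \<and> (\<forall>u z. full_solution \<Omega> \<kappa> s J \<xi> Zad u z \<longleftrightarrow>
               reduced_solution \<Omega> \<kappa> s J \<xi> Zad z \<and> robin_weak_solution \<Omega> \<kappa> s z u)
    \<and> ((L2_convex (lebesgue_on \<Omega>) J \<and> \<xi> > 0) \<or> (L2_strictly_convex (lebesgue_on \<Omega>) J \<and> \<xi> \<ge> 0)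
         \<longrightarrow> (\<forall>z z'. reduced_solution \<Omega> \<kappa> s J \<xi> Zad z \<and> reduced_solution \<Omega> \<kappa> s J \<xi> Zad z'
                \<longrightarrow> (AE x in robin_measure \<Omega> \<kappa>. z x = z' x)))"
proof -
  interpret robin_problem \<Omega> \<kappa> s "real CARD('n) + 2 * s"
    using assms(1-6) by unfold_locales (auto simp: bounded_lipschitz_domain_def)
  have exists: "\<exists>z. reduced_solution \<Omega> \<kappa> s J \<xi> Zad z"
    by (rule reduced_solution_exists[OF assms(7-14)])
  note full = full_solution_iff[OF assms(13,8)]
  obtain z where z: "reduced_solution \<Omega> \<kappa> s J \<xi> Zad z" using exists by blast
  then have "z \<in> Z" using assms(8) by (auto simp: reduced_solution_def is_arg_min_def)
  then have "full_solution \<Omega> \<kappa> s J \<xi> Zad (S z) z" using full z robin_state_solution by blast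
  moreover have "AE x in \<mu>. y x = y' x"
    if "(L2_convex (lebesgue_on \<Omega>) J \<and> \<xi> > 0) \<or> (L2_strictly_convex (lebesgue_on \<Omega>) J \<and> \<xi> \<ge> 0)"
      "reduced_solution \<Omega> \<kappa> s J \<xi> Zad y" "reduced_solution \<Omega> \<kappa> s J \<xi> Zad y'" for y y'
    using that(1) by (intro reduced_solution_unique[OF assms(7,8,11,13) _ that(2,3)]) blast
  ultimately show ?thesis using exists full by blast
qed

end
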